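(* Let $\lambda>-1/2$, $1\le p<\infty$, $\delta\in\mathbb{R}$. Then the maximal operator $W_*^{\lambda}$, considered on the measure space $(\mathbb{R}_+,x^{\delta}dx)$, has the following mapping properties: (a) $W_*^{\lambda}$ is of strong type $(p,p)$ if and only if $p>1$ and $-1<\delta<(2\lambda+1)p-1$; (b) $W_*^{\lambda}$ is of weak type $(p,p)$ if and only if $-1<\delta<(2\lambda+1)p-1$ or $\delta=2\lambda$; (c) $W_*^{\lambda}$ is of restricted weak type $(p,p)$ if and only if $-1<\delta\le(2\lambda+1)p-1$. Moreover, $W_*^{\lambda}$ is of strong type $(\infty,\infty)$.
   Context: $\mathbb{R}_+=(0,\infty)$ and $d\mu_\lambda(x)=x^{2\lambda}dx$ on $\mathbb{R}_+$. For $\lambda>-1/2$ the heat kernel associated with the Bessel operator $\Delta_\lambda=-\frac{d^2}{dx^2}-\frac{2\lambda}{x}\frac{d}{dx}$ is $$W_t^\lambda(x,y)=\frac{(xy)^{-\lambda+1/2}}{2t}\,e^{-(x^2+y^2)/(4t)}\,I_{\lambda-1/2}\Big(\frac{xy}{2t}\Big),\qquad t,x,y>0,$$ where $I_\nu$ is the modified Bessel function of the first kind of order $\nu$. The heat-diffusion integral is $W_t^\lambda f(x)=\int_0^\infty W_t^\lambda(x,y)f(y)\,d\mu_\lambda(y)$ and the maximal operator is $W_*^\lambda f(x)=\sup_{t>0}|W_t^\lambda f(x)|$, $x>0$. Let $T$ be an operator defined on $L^2(\mathbb{R}_+,d\mu_\lambda)$ and let $1\le p<\infty$. On the measure space $(\mathbb{R}_+,x^\delta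 dx)$: $T$ is of strong type $(p,p)$ if it extends from $L^2(\mathbb{R}_+,d\mu_\lambda)\cap L^p(\mathbb{R}_+,x^\delta dx)$ to a bounded operator from $L^p(\mathbb{R}_+,x^\delta dx)$ to itself (i.e. $\|Tf\|_{L^p(x^\delta dx)}\le C\|f\|_{L^p(x^\delta dx)}$); of weak type $(p,p)$ if it extends in the same way to a bounded operator from $L^p(\mathbb{R}_+,x^\delta dx)$ to weak $L^{p,\infty}(\mathbb{R}_+,x^\delta dx)$ (i.e. $\int_{\{|Tf|>\gamma\}}x^\delta dx\le C\gamma^{-p}\|f\|^p_{L^p(x^\delta dx)}$ for all $\gamma>0$); of restricted weak type $(p,p)$ if the weak type inequality holds for $f=\chi_E$, with $C$ independent of $\gamma$ and of the measurable set $E$ of finite measure. Strong type $(\infty,\infty)$ means $\|Tf\|_{\infty}\le C\|f\|_\infty$ for all $f\in L^\infty(\mathbb{R}_+)$. *)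

theory Defs
  imports "HOL-Analysis.Analysis" "HOL-Probability.Essential_Supremum"
begin

section \<open>Lebesgue norms for functions with values in \<open>[0, \<infinity>]\<close>\<close>

definition epowr :: "ennreal \<Rightarrow> real \<Rightarrow> ennreal" where
  "epowr a p = (if a = top then top else ennreal (enn2real a powr p))"

definition lp_norm :: "'a measure \<Rightarrow> real \<Rightarrow> ('a \<Rightarrow> ennreal) \<Rightarrow> ennreal" where
  "lp_norm M p g = epowr (\<integral>\<^sup>+x. epowr (g x) p \<partial>M) (1 / p)"

definition emod :: "('a \<Rightarrow> complex) \<Rightarrow> 'a \<Rightarrow> ennreal" where
  "emod f = (\<lambda>x. ennreal (cmod (f x)))"

definition Lp :: "'a measure \<Rightarrow> real \<Rightarrow> ('a \<Rightarrow> complex) set" where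
  "Lp M p = {f \<in> borel_measurable M. lp_norm M p (emod f) < top}"

definition Linfty :: "'a measure \<Rightarrow> ('a \<Rightarrow> complex) set" where
  "Linfty M = {f \<in> borel_measurable M. esssup M (emod f) < top}"


section \<open>Mapping properties of sublinear operators\<close>

text \<open>
  An operator \<open>T\<close> sends a complex function to the \<open>[0, \<infinity>]\<close>-valued function written
  \<open>|T f|\<close> in the usual notation. It is given on \<open>L\<^sup>2\<close> of a measure \<open>M0\<close>; its mapping
  properties refer to a second measure \<open>M\<close> with the same null sets.
\<close>

definition sublinear_on ::
  "'a measure \<Rightarrow> ('a \<Rightarrow> complex) set \<Rightarrow> (('a \<Rightarrow> complex) \<Rightarrow> 'a \<Rightarrow> ennreal) \<Rightarrow> bool" where
  "sublinear_on M X S \<longleftrightarrow>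
     (\<forall>f\<in>X. \<forall>g\<in>X. AE x in M. S (\<lambda>y. f y + g y) x \<le> S f x + S g x) \<and>
     (\<forall>f\<in>X. \<forall>c. AE x in M. S (\<lambda>y. c * f y) x = ennreal (cmod c) * S f x)"

text \<open>
  The extension is required to be sublinear: together with boundedness this makes it continuous on
  \<open>Lp M p\<close>, hence determined almost everywhere by \<open>T\<close> on the dense subspace. Without
  such a requirement, extending by \<open>0\<close> off the subspace would already qualify.
\<close>

definition sublinear_extension ::
  "'a measure \<Rightarrow> 'a measure \<Rightarrow> real \<Rightarrow> (('a \<Rightarrow> complex) \<Rightarrow> 'a \<Rightarrow> ennreal)
    \<Rightarrow> (('a \<Rightarrow> complex) \<Rightarrow> 'a \<Rightarrow> ennreal) \<Rightarrow> bool" where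
  "sublinear_extension M0 M p T S \<longleftrightarrow>
     (\<forall>f \<in> Lp M0 2 \<inter> Lp M p. AE x in M. S f x = T f x) \<and>
     (\<forall>f \<in> Lp M p. S f \<in> borel_measurable M) \<and>
     sublinear_on M (Lp M p) S"

definition strong_type ::
  "'a measure \<Rightarrow> 'a measure \<Rightarrow> real \<Rightarrow> (('a \<Rightarrow> complex) \<Rightarrow> 'a \<Rightarrow> ennreal) \<Rightarrow> bool" where
  "strong_type M0 M p T \<longleftrightarrow>
     (\<exists>S. sublinear_extension M0 M p T S \<and>
       (\<exists>C::real. \<forall>f \<in> Lp M p. lp_norm M p (S f) \<le> ennreal C * lp_norm M p (emod f)))"

definition weak_type_ineq ::
  "'a measure \<Rightarrow> real \<Rightarrow> real \<Rightarrow> ('a \<Rightarrow> ennreal) \<Rightarrow> ('a \<Rightarrow> complex) \<Rightarrow> bool" where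
  "weak_type_ineq M p C g f \<longleftrightarrow>
     (\<forall>\<gamma>::real. \<gamma> > 0 \<longrightarrow>
       emeasure M {x \<in> space M. g x > ennreal \<gamma>}
         \<le> ennreal (C * \<gamma> powr (- p)) * epowr (lp_norm M p (emod f)) p)"

definition weak_type ::
  "'a measure \<Rightarrow> 'a measure \<Rightarrow> real \<Rightarrow> (('a \<Rightarrow> complex) \<Rightarrow> 'a \<Rightarrow> ennreal) \<Rightarrow> bool" where
  "weak_type M0 M p T \<longleftrightarrow>
     (\<exists>S. sublinear_extension M0 M p T S \<and>
       (\<exists>C. \<forall>f \<in> Lp M p. weak_type_ineq M p C (S f) f))"

definition restricted_weak_type ::
  "'a measure \<Rightarrow> real \<Rightarrow> (('a \<Rightarrow> complex) \<Rightarrow> 'a \<Rightarrow> ennreal) \<Rightarrow> bool" where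
  "restricted_weak_type M p T \<longleftrightarrow>
     (\<exists>C. \<forall>E \<in> sets M. emeasure M E < top \<longrightarrow>
       T (indicator E) \<in> borel_measurable M \<and>
       weak_type_ineq M p C (T (indicator E)) (indicator E))"

definition strong_type_infty ::
  "'a measure \<Rightarrow> (('a \<Rightarrow> complex) \<Rightarrow> 'a \<Rightarrow> ennreal) \<Rightarrow> bool" where
  "strong_type_infty M T \<longleftrightarrow>
     (\<exists>C::real. \<forall>f \<in> Linfty M.
       T f \<in> borel_measurable M \<and> esssup M (T f) \<le> ennreal C * esssup M (emod f))"


section \<open>The Bessel heat semigroup\<close>

text \<open>Only meant for \<open>z > 0\<close>; \<open>rGamma\<close> is the entire function \<open>1/\<Gamma>\<close>.\<close>

definition bessel_I :: "real \<Rightarrow> real \<Rightarrow> real" where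
  "bessel_I \<nu> z = (\<Sum>k. (z / 2) powr (2 * real k + \<nu>) * rGamma (real k + \<nu> + 1) / fact k)"

definition power_measure :: "real \<Rightarrow> real measure" where
  "power_measure \<delta> = density (lebesgue_on {0<..}) (\<lambda>x. ennreal (x powr \<delta>))"

definition heat_kernel :: "real \<Rightarrow> real \<Rightarrow> real \<Rightarrow> real \<Rightarrow> real" where
  "heat_kernel l t x y =
     (x * y) powr (- l + 1 / 2) / (2 * t) * exp (- (x\<^sup>2 + y\<^sup>2) / (4 * t))
       * bessel_I (l - 1 / 2) (x * y / (2 * t))"

text \<open>
  The integral converges absolutely for \<open>f\<close> in \<open>Lp (power_measure (2 * l)) 2\<close> and for
  bounded measurable \<open>f\<close>; elsewhere the convention that a divergent integral is \<open>0\<close> may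
  apply, but \<open>heat_maximal\<close> is never used there by the notions above.
\<close>

definition heat_integral :: "real \<Rightarrow> real \<Rightarrow> (real \<Rightarrow> complex) \<Rightarrow> real \<Rightarrow> complex" where
  "heat_integral l t f x =
     (LINT y|power_measure (2 * l). complex_of_real (heat_kernel l t x y) * f y)"

definition heat_maximal :: "real \<Rightarrow> (real \<Rightarrow> complex) \<Rightarrow> real \<Rightarrow> ennreal" where
  "heat_maximal l f x = (SUP t\<in>{0<..}. ennreal (cmod (heat_integral l t f x)))"

end

theory Submission
  imports Defs
begin

text \<open>
  The order of the Bessel function in the kernel is \<open>l - 1/2\<close>. Write \<open>d\<mu>(y) = y\<^bsup>2l\<^esup> dy\<close>,
  \<open>W\<^sub>t\<close> for the heat kernel and \<open>F = |f|\<close>.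

  \<^bold>\<open>Sufficiency.\<close> The power series of the Bessel function shows that it behaves like
  \<open>z\<^bsup>l-1/2\<^esup>\<close> for small and like \<open>e\<^sup>z / z\<^bsup>1/2\<^esup>\<close> for large argument, and this gives two-sided bounds for
  \<open>W\<^sub>t(x, y)\<close> (\<open>heat_kernel_two_sided\<close>). They imply, uniformly in \<open>t\<close>, that
  \<open>W\<^sub>t(x, y)\<close> is at most a multiple of \<open>x\<^bsup>-2l-1\<^esup>\<close> for \<open>y\<close> well below \<open>x\<close>, at most a multiple of
  \<open>y\<^bsup>-2l-1\<^esup>\<close> for \<open>y\<close> well above \<open>x\<close>, and at most \<open>x\<^bsup>-2l\<^esup>\<close> times a Gaussian of
  width \<open>t\<^bsup>1/2\<^esup>\<close>, up to a harmless term, for \<open>y\<close> close to \<open>x\<close>. Hence the maximal function of \<open>f\<close> is at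
  most a multiple of the sum of the Hardy mean \<open>x\<^bsup>-2l-1\<^esup> \<integral>\<^sub>0\<^sup>x F d\<mu>\<close>, the Hardy
  tail \<open>\<integral>\<^sub>x\<^sup>\<infinity> F(y) dy/y\<close> and a local Hardy-Littlewood maximal function \<open>M F\<close>
  that only looks at intervals \<open>(a, b)\<close> with \<open>b \<le> 5a/4\<close> (\<open>heat_pos_le_dominating\<close>).
  On such an interval every power weight is essentially constant. Therefore Vitali's covering
  lemma gives the weak type (1,1) of \<open>M\<close> for every weight \<open>x\<^sup>\<delta>\<close>, and a layer-cake argument gives the strong type
  \<open>(p,p)\<close> for \<open>p > 1\<close>.

  The two Hardy operators need no further integral inequality. Cut at geometric points, they become
  sums of dilates of \<open>M F\<close>: the tail is bounded by \<open>\<Sum>\<^sub>j M F(q\<^sup>j x)\<close> and the mean by a multiple of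
  \<open>\<Sum>\<^sub>j q\<^bsup>-j(2l+1)\<^esup> M F(q\<^bsup>-j\<^esup> x)\<close>, with \<open>q = 10/9\<close>. A dilation by \<open>q\<^sup>j\<close> multiplies
  the \<open>p\<close>-th power of the norm by \<open>q\<^bsup>-j(\<delta>+1)\<^esup>\<close>, so the first sum converges if \<open>\<delta> > -1\<close> and
  the second if \<open>\<delta> + 1 < (2l+1)p\<close>. The same argument serves the strong and the weak
  type, see the locale \<open>dilation_functional\<close>. At the endpoint \<open>\<delta> + 1 = (2l+1)p\<close> only the Hardy mean
  has to be treated anew: \<open>\<integral> F d\<mu>\<close> is the norm of \<open>f\<close> if \<open>p = 1\<close>, and for
  \<open>F = \<chi>\<^sub>E\<close> it is controlled by the \<open>p\<close>-th root of the weighted measure of \<open>E\<close>; and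
  the function \<open>x\<^bsup>-2l-1\<^esup>\<close> lies in weak \<open>L\<^sup>p\<close>.

  Finiteness of the dominating operator also yields that the heat integrals converge for every
  \<open>f\<close> in question. They are then continuous in \<open>x\<close>, so their supremum over \<open>t\<close> is lower semicontinuous
  and hence measurable, and the maximal operator itself serves as its sublinear extension.

  \<^bold>\<open>Necessity.\<close> If \<open>f \<ge> 0\<close> lives on \<open>(0, 1)\<close>, then the choice \<open>t = max(1, x)\<^sup>2\<close> shows that the maximal
  function is at least a multiple of \<open>max(1, x)\<^bsup>-2l-1\<^esup> \<integral> f d\<mu>\<close>
  (\<open>heat_maximal_lower_bound\<close>). A weak type inequality for \<open>f\<close> thus bounds the weighted measure of
  every interval \<open>(0, R)\<close>. With the indicator of \<open>(1/2, 1)\<close> this forces \<open>\<delta> > -1\<close> and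
  \<open>\<delta> + 1 \<le> (2l+1)p\<close>; with \<open>y\<^bsup>-2l-1\<^esup>\<close> cut off near \<open>0\<close> it excludes equality for the weak
  type if \<open>p > 1\<close>. The strong type (1,1) fails because the maximal function of a normalized bump at \<open>1\<close> is at least
  a multiple of \<open>1/(x - 1)\<close> to the right of the bump.
\<close>

section \<open>The modified Bessel function\<close>

text \<open>
  The term of the exponential series at the real exponent \<open>s\<close>; it interpolates \<open>z\<^sup>n / n!\<close>.
\<close>

definition exp_term :: "real \<Rightarrow> real \<Rightarrow> real" where
  "exp_term z s = z powr s / Gamma (s + 1)"

lemma exp_term_pos: "z > 0 \<Longrightarrow> s > -1 \<Longrightarrow> exp_term z s > 0"
  by (simp add: exp_term_def Gamma_real_pos)

lemma exp_term_Suc: "z > 0 \<Longrightarrow> s > -1 \<Longrightarrow> exp_term z (s + 1) = z / (s + 1) * exp_term z s"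
proof -
  assume a: "z > 0" "s > -1"
  have "Gamma (s + 1 + 1) = (s + 1) * Gamma (s + 1)"
    using a by (intro Gamma_plus1) (auto elim!: nonpos_Ints_cases)
  thus ?thesis using a by (simp add: exp_term_def powr_add mult.commute)
qed

lemma exp_term_nat: "z > 0 \<Longrightarrow> exp_term z (real n) = z ^ n / fact n"
  using Gamma_fact[of n, where 'a=real] by (simp add: exp_term_def powr_realpow add.commute)

text \<open>
  This is the log-convexity of the Gamma function between \<open>x\<close> and \<open>x + 1\<close>.
\<close>

lemma Gamma_add_le:
  fixes x \<theta> :: real
  assumes x: "x > 0" and \<theta>: "0 \<le> \<theta>" "\<theta> \<le> 1"
  shows "Gamma (x + \<theta>) \<le> x powr \<theta> * Gamma x"
proof -
  have "(ln \<circ> Gamma) ((1 - \<theta>) *\<^sub>R x + \<theta> *\<^sub>R (x + 1)) \<le> (1 - \<theta>) * (ln \<circ> Gamma) x + \<theta> * (ln \<circ> Gamma) (x + 1)"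
    by (rule convex_onD[OF log_convex_Gamma_real]) (use assms in auto)
  moreover have "(1 - \<theta>) *\<^sub>R x + \<theta> *\<^sub>R (x + 1) = x + \<theta>" by (simp add: algebra_simps)
  moreover have "Gamma (x + 1) = x * Gamma x" using x by (intro Gamma_plus1) (auto elim!: nonpos_Ints_cases)
  ultimately have "ln (Gamma (x + \<theta>)) \<le> (1 - \<theta>) * ln (Gamma x) + \<theta> * ln (x * Gamma x)" by simp
  also have "\<dots> = ln (Gamma x) + \<theta> * ln x"
    using x by (subst ln_mult_pos) (auto simp: algebra_simps intro!: Gamma_real_pos)
  finally have "ln (Gamma (x + \<theta>)) \<le> ln (Gamma x) + \<theta> * ln x" .
  hence "exp (ln (Gamma (x + \<theta>))) \<le> exp (ln (Gamma x) + \<theta> * ln x)" by simp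
  moreover have "Gamma x > 0" "Gamma (x + \<theta>) > 0" using x \<theta> by (auto intro!: Gamma_real_pos)
  ultimately show ?thesis using x by (simp add: exp_add powr_def mult.commute)
qed

text \<open>
  The series with exponents \<open>2k + l\<close> has to be compared with the exponential series, although the
  exponents are not integers. A term at an intermediate exponent is controlled by the two
  neighbouring ones: log-convexity of Gamma bounds it by a weighted geometric mean of \<open>z\<close> and
  \<open>s + 1 + \<theta>\<close>, and a geometric mean is at most the sum.
\<close>

lemma exp_term_interpolate:
  assumes z: "z > 0" and s: "s \<ge> -1/2" and \<theta>: "0 \<le> \<theta>" "\<theta> \<le> 1"
  shows "exp_term z (s + \<theta>) \<le> 3 * (exp_term z s + exp_term z (s + 1))"
proof -
  let ?b = "s + 1 + \<theta>"
  have b: "?b > 0" and s1: "s + 1 > 0" using s \<theta> by linarith+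
  have "Gamma (?b + (1 - \<theta>)) \<le> ?b powr (1 - \<theta>) * Gamma ?b"
    by (rule Gamma_add_le) (use b \<theta> in auto)
  hence G: "Gamma (s + 2) \<le> ?b powr (1 - \<theta>) * Gamma ?b" by (simp add: algebra_simps)
  have Gp: "Gamma (s + 2) > 0" "Gamma ?b > 0" using b s1 by (auto intro!: Gamma_real_pos)
  have young: "z powr \<theta> * ?b powr (1 - \<theta>) \<le> z + ?b"
  proof -
    have "z powr \<theta> * ?b powr (1 - \<theta>) \<le> (max z ?b) powr \<theta> * (max z ?b) powr (1 - \<theta>)"
      by (intro mult_mono powr_mono2) (use z b \<theta> in auto)
    also have "\<dots> = max z ?b" using z b by (simp flip: powr_add)
    finally show ?thesis using z b by auto
  qed
  have "exp_term z (s + \<theta>) = z powr s * z powr \<theta> / Gamma ?b" by (simp add: exp_term_def powr_add algebra_simps)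
  also have "\<dots> \<le> z powr s * z powr \<theta> * (?b powr (1 - \<theta>) / Gamma (s + 2))"
  proof -
    have "1 / Gamma ?b \<le> ?b powr (1 - \<theta>) / Gamma (s + 2)" using G Gp by (simp add: field_simps)
    from mult_left_mono[OF this, of "z powr s * z powr \<theta>"] show ?thesis by simp
  qed
  also have "\<dots> = z powr s / Gamma (s + 2) * (z powr \<theta> * ?b powr (1 - \<theta>))" by simp
  also have "\<dots> \<le> z powr s / Gamma (s + 2) * (z + ?b)"
    by (intro mult_left_mono young) (use Gp in auto)
  also have "\<dots> = exp_term z (s + 1) + ?b / (s + 1) * exp_term z s"
  proof -
    have e: "Gamma (s + 2) = (s + 1) * Gamma (s + 1)"
      using Gamma_plus1[of "s + 1"] s1 by (fastforce simp: add.assoc elim!: nonpos_Ints_cases)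
    have e': "exp_term z (s + 1) = z / (s + 1) * exp_term z s" using z s1 by (simp add: exp_term_Suc)
    have "a / (u * v) * (z + b) = z / u * (a / v) + b / u * (a / v)" for a u v b :: real
      by (simp add: add_divide_distrib distrib_left mult.commute)
    thus ?thesis unfolding e' unfolding exp_term_def e .
  qed
  also have "\<dots> \<le> exp_term z (s + 1) + 3 * exp_term z s"
    by (intro add_left_mono mult_right_mono) (use s1 s \<theta> exp_term_pos[of z s] z in \<open>auto simp: field_simps\<close>)
  also have "\<dots> \<le> 3 * (exp_term z s + exp_term z (s + 1))" using exp_term_pos[of z "s+1"] z s1 by simp
  finally show ?thesis .
qed

text \<open>
  The exponents \<open>2k + l\<close> advance in steps of two, so the term halfway between two of them has to be recovered;
  with \<open>w = z / (s + 1)\<close> this is \<open>w \<le> 1 + w\<^sup>2\<close>.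
\<close>

lemma exp_term_midpoint:
  assumes z: "z > 0" and s: "s \<ge> -1/2"
  shows "exp_term z (s + 1) \<le> 3 * (exp_term z s + exp_term z (s + 2))"
proof -
  define w where "w = z / (s + 1)"
  have s1: "s + 1 > 0" using s by linarith
  have g: "exp_term z s > 0" using z s1 by (intro exp_term_pos) auto
  have e1: "exp_term z (s + 1) = w * exp_term z s" using z s1 by (simp add: exp_term_Suc w_def)
  have e2: "exp_term z (s + 2) = (s + 1) / (s + 2) * w\<^sup>2 * exp_term z s"
    using exp_term_Suc[of z "s + 1"] z s1 by (simp add: e1 w_def power2_eq_square add.assoc)
  have "1/3 \<le> (s + 1) / (s + 2)" using s by (simp add: field_simps)
  from mult_right_mono[OF this, of "3 * w\<^sup>2"] have "w\<^sup>2 \<le> 3 * ((s + 1) / (s + 2) * w\<^sup>2)"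
    by (simp add: mult_ac)
  moreover have "w \<le> 1 + w\<^sup>2" using sum_squares_bound[of w 1] by (simp add: power2_eq_square) (smt (verit) zero_le_square)
  ultimately have "w \<le> 3 * (1 + (s + 1) / (s + 2) * w\<^sup>2)" by simp
  from mult_right_mono[OF this, of "exp_term z s"] g show ?thesis
    unfolding e1 e2 by (simp add: algebra_simps)
qed

definition exp_term_sum :: "real \<Rightarrow> real \<Rightarrow> real" where
  "exp_term_sum l z = (\<Sum>k. exp_term z (2 * real k + l))"

text \<open>
  The exponential series without its first \<open>m\<close> terms, summed in pairs.
\<close>

lemma exp_tail_pairs:
  fixes z :: real assumes "z > 0"
  shows "summable (\<lambda>k. exp_term z (2 * real k + real m) + exp_term z (2 * real k + real m + 1))" (is ?A)
    and "(\<Sum>k. exp_term z (2 * real k + real m) + exp_term z (2 * real k + real m + 1)) = exp z - (\<Sum>n<m. z ^ n / fact n)" (is ?B)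
proof -
  have "(\<lambda>n. z ^ n / fact n) sums exp z" using exp_converges[of z] by (simp add: scaleR_conv_of_real field_simps)
  hence "(\<lambda>n. z ^ (n + m) / fact (n + m)) sums (exp z - (\<Sum>n<m. z ^ n / fact n))"
    by (rule sums_split_initial_segment)
  from sums_group[OF this, of 2]
  have "(\<lambda>k. z ^ (2*k+m) / fact (2*k+m) + z ^ (2*k+m+1) / fact (2*k+m+1)) sums (exp z - (\<Sum>n<m. z ^ n / fact n))"
    by (simp add: mult.commute numeral_2_eq_2)
  moreover have "exp_term z (2 * real k + real m) + exp_term z (2 * real k + real m + 1) =
    z ^ (2*k+m) / fact (2*k+m) + z ^ (2*k+m+1) / fact (2*k+m+1)" for k
    using exp_term_nat[OF assms, of "2*k+m"] exp_term_nat[OF assms, of "2*k+m+1"] by (simp add: add_ac)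
  ultimately show ?A ?B by (auto simp: sums_iff)
qed

text \<open>
  For \<open>k \<ge> 1\<close> the exponent \<open>2k + l\<close> lies between two consecutive natural numbers, and distinct \<open>k\<close> use
  disjoint pairs. The first term is kept apart because \<open>l\<close> may be negative.
\<close>

lemma exp_term_sum_upper:
  assumes l: "l > -1/2" and z: "z > 0"
  shows "summable (\<lambda>k. exp_term z (2 * real k + l))" and "exp_term_sum l z \<le> exp_term z l + 3 * exp z"
proof -
  define m where "m = nat \<lfloor>l + 2\<rfloor>"
  define \<theta> where "\<theta> = l + 2 - real m"
  have m: "real m = of_int \<lfloor>l + 2\<rfloor>" using l unfolding m_def by (intro of_nat_nat) linarith
  have \<theta>: "0 \<le> \<theta>" "\<theta> \<le> 1" unfolding \<theta>_def m by linarith+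
  have le: "exp_term z (2 * real (Suc k) + l) \<le> 3 * (exp_term z (2 * real k + real m) + exp_term z (2 * real k + real m + 1))" for k
  proof -
    have "2 * real (Suc k) + l = (2 * real k + real m) + \<theta>" by (simp add: \<theta>_def)
    thus ?thesis using exp_term_interpolate[OF z _ \<theta>, of "2 * real k + real m"] by (simp del: of_nat_Suc)
  qed
  have pos: "0 \<le> exp_term z (2 * real k + l)" for k using exp_term_pos[OF z, of "2 * real k + l"] l by simp
  note t = exp_tail_pairs[OF z, of m]
  have S: "summable (\<lambda>k. exp_term z (2 * real (Suc k) + l))"
    by (rule summable_comparison_test'[OF summable_mult[OF t(1)], where N=0 and c1=3])
       (use pos[of "Suc _"] le in auto)
  thus S0: "summable (\<lambda>k. exp_term z (2 * real k + l))" by (subst (asm) summable_Suc_iff)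
  have "exp_term_sum l z = exp_term z l + (\<Sum>k. exp_term z (2 * real (Suc k) + l))"
    using suminf_split_head[OF S0] by (simp add: exp_term_sum_def)
  also have "\<dots> \<le> exp_term z l + (\<Sum>k. 3 * (exp_term z (2 * real k + real m) + exp_term z (2 * real k + real m + 1)))"
    by (intro add_left_mono suminf_le le S summable_mult t(1))
  also have "\<dots> = exp_term z l + 3 * (exp z - (\<Sum>n<m. z ^ n / fact n))"
    by (subst suminf_mult[OF t(1)]) (simp add: t(2))
  also have "\<dots> \<le> exp_term z l + 3 * exp z" using z by (simp add: sum_nonneg)
  finally show "exp_term_sum l z \<le> exp_term z l + 3 * exp z" .
qed

lemma exp_term_sum_ge: 
  assumes l: "l > -1/2" and z: "z > 0"
  shows "exp_term z l \<le> exp_term_sum l z"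
proof -
  have "(\<Sum>k<1. exp_term z (2 * real k + l)) \<le> exp_term_sum l z" unfolding exp_term_sum_def
    by (rule sum_le_suminf[OF exp_term_sum_upper(1)[OF l z]]) (use exp_term_pos[OF z] l in \<open>auto intro!: less_imp_le\<close>)
  thus ?thesis by simp
qed

text \<open>
  Conversely, two consecutive terms of the exponential series beyond \<open>l\<close> are controlled by two consecutive terms with exponents
  \<open>2k + l\<close>. The finitely many terms of exponent at most \<open>l\<close> are dominated by
  \<open>z\<^sup>l\<close>, because \<open>z \<ge> 1\<close>.
\<close>

lemma exp_term_sum_lower:
  assumes l: "l > -1/2" 
  shows "\<exists>C>0. \<forall>z\<ge>1. exp z \<le> C * exp_term_sum l z"
proof -
  define N where "N = nat \<lceil>l\<rceil>"
  define \<theta> where "\<theta> = real N - l"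
  have N: "real N = of_int \<lceil>l\<rceil>" using l unfolding N_def by (simp add: le_ceiling_iff)
  have \<theta>: "0 \<le> \<theta>" "\<theta> \<le> 1" unfolding \<theta>_def N by linarith+
  define C where "C = real N * Gamma (l + 1) + 42"
  have "exp z \<le> C * exp_term_sum l z" if z1: "z \<ge> 1" for z
  proof -
    have z: "z > 0" using z1 by simp
    note t = exp_tail_pairs[OF z, of N]
    note S0 = exp_term_sum_upper(1)[OF l z]
    have S1: "summable (\<lambda>k. exp_term z (2 * real (Suc k) + l))" using S0 by (subst summable_Suc_iff)
    have le: "exp_term z (2 * real k + real N) + exp_term z (2 * real k + real N + 1)
        \<le> 21 * (exp_term z (2 * real k + l) + exp_term z (2 * real (Suc k) + l))" for k
    proof -
      let ?s = "2 * real k + l"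
      have s: "?s \<ge> -1/2" using l by (smt (verit) of_nat_0_le_iff)
      have "exp_term z (?s + \<theta>) \<le> 3 * (exp_term z ?s + exp_term z (?s + 1))" by (rule exp_term_interpolate[OF z s \<theta>])
      moreover have "exp_term z (?s + 1 + \<theta>) \<le> 3 * (exp_term z (?s + 1) + exp_term z (?s + 1 + 1))"
        by (rule exp_term_interpolate[OF z _ \<theta>]) (use s in simp)
      moreover have "exp_term z (?s + 1) \<le> 3 * (exp_term z ?s + exp_term z (?s + 2))" by (rule exp_term_midpoint[OF z s])
      moreover have "?s + \<theta> = 2 * real k + real N" "?s + 1 + \<theta> = 2 * real k + real N + 1"
        "?s + 1 + 1 = 2 * real (Suc k) + l" "?s + 2 = 2 * real (Suc k) + l" by (simp_all add: \<theta>_def)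
      ultimately show ?thesis using exp_term_pos[OF z, of ?s] s by (simp del: of_nat_Suc)
    qed
    have "exp z - (\<Sum>n<N. z ^ n / fact n) \<le> (\<Sum>k. 21 * (exp_term z (2 * real k + l) + exp_term z (2 * real (Suc k) + l)))"
      unfolding t(2)[symmetric] by (intro suminf_le le t(1) summable_mult summable_add S0 S1)
    also have "\<dots> = 21 * ((\<Sum>k. exp_term z (2 * real k + l)) + (\<Sum>k. exp_term z (2 * real (Suc k) + l)))"
      by (subst suminf_mult[OF summable_add[OF S0 S1]]) (simp only: suminf_add[OF S0 S1])
    also have "(\<Sum>k. exp_term z (2 * real (Suc k) + l)) \<le> exp_term_sum l z"
      using suminf_split_head[OF S0] exp_term_pos[OF z, of l] l by (simp add: exp_term_sum_def)
    finally have a: "exp z - (\<Sum>n<N. z ^ n / fact n) \<le> 42 * exp_term_sum l z" by (simp add: exp_term_sum_def)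
    have "(\<Sum>n<N. z ^ n / fact n) \<le> (\<Sum>n<N. Gamma (l + 1) * exp_term_sum l z)"
    proof (rule sum_mono)
      fix n assume "n \<in> {..<N}"
      hence "real n \<le> l" unfolding N_def by (simp, linarith)
      hence "z ^ n \<le> z powr l" using z1 powr_mono[of "real n" l z] by (simp add: powr_realpow)
      hence "z ^ n / fact n \<le> z powr l" by (smt (verit) divide_le_eq_1 fact_ge_1 frac_le z zero_le_power div_by_1)
      also have "\<dots> = Gamma (l + 1) * exp_term z l" using l by (auto simp: exp_term_def Gamma_eq_zero_iff elim!: nonpos_Ints_cases)
      also have "\<dots> \<le> Gamma (l + 1) * exp_term_sum l z"
        by (intro mult_left_mono exp_term_sum_ge[OF l z]) (use Gamma_real_pos[of "l+1"] l in auto)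
      finally show "z ^ n / fact n \<le> Gamma (l + 1) * exp_term_sum l z" .
    qed
    with a show ?thesis by (simp add: C_def algebra_simps)
  qed
  moreover have "C > 0" unfolding C_def using Gamma_real_pos[of "l+1"] l
    by (intro add_nonneg_pos mult_nonneg_nonneg) auto
  ultimately show ?thesis by blast
qed

text \<open>
  The infinite product converges to a nonzero limit, so its partial products stay away from \<open>0\<close> and from infinity.
\<close>

lemma prod_one_plus_bounds:
  fixes \<theta> :: "nat \<Rightarrow> real"
  assumes S: "summable (\<lambda>k. \<bar>\<theta> k\<bar>)" and pos: "\<And>k. 1 + \<theta> k > 0"
  shows "\<exists>c>0. \<exists>C>0. \<forall>n. c \<le> (\<Prod>k<n. 1 + \<theta> k) \<and> (\<Prod>k<n. 1 + \<theta> k) \<le> C"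
proof -
  have "convergent_prod (\<lambda>k. 1 + \<theta> k)"
    by (rule summable_imp_convergent_prod_real[OF S]) (use pos in \<open>smt (verit)\<close>)
  then obtain L where L: "L \<noteq> 0" "(\<lambda>n. \<Prod>k\<le>n. 1 + \<theta> k) \<longlonglongrightarrow> L"
    using pos convergent_prod_iff_nz_lim[of "\<lambda>k. 1 + \<theta> k"] by (metis less_irrefl)
  let ?P = "\<lambda>n. \<Prod>k<n. 1 + \<theta> k"
  have "(\<lambda>n. ?P (Suc n)) \<longlonglongrightarrow> L" using L(2) by (simp only: lessThan_Suc_atMost)
  hence lim: "?P \<longlonglongrightarrow> L" by (rule filterlim_sequentially_Suc[THEN iffD1])
  have P: "?P n > 0" for n using pos by (intro prod_pos) auto
  have "Bseq ?P" by (rule convergent_imp_Bseq[OF convergentI[OF lim]])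
  then obtain C where C: "C > 0" "\<And>n. norm (?P n) \<le> C" by (auto elim!: BseqE)
  have "(\<lambda>n. inverse (?P n)) \<longlonglongrightarrow> inverse L" by (rule tendsto_inverse[OF lim L(1)])
  hence "Bseq (\<lambda>n. inverse (?P n))" by (rule convergent_imp_Bseq[OF convergentI])
  then obtain D where D: "D > 0" "\<And>n. norm (inverse (?P n)) \<le> D" by (auto elim!: BseqE)
  have "inverse D \<le> ?P n \<and> ?P n \<le> C" for n
    using D(2)[of n] C(2)[of n] P[of n] D(1) by (auto simp: field_simps)
  thus ?thesis using C(1) D(1) by (intro exI[of _ "inverse D"] conjI exI[of _ C]) auto
qed

text \<open>
  By the functional equation of Gamma, the quotient of the two sequences is multiplied by
  \<open>1 + l(l - 1) / ((2k + 2)(2k + 2l + 1))\<close> when passing from \<open>k\<close> to \<open>k + 1\<close>. These factors form a convergent product. So the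
  Bessel series may be replaced by the series of the \<open>z\<^bsup>2k+l\<^esup> / \<Gamma>(2k + l + 1)\<close>, up to constants.
\<close>

lemma bessel_coefficient_bounds:
  assumes l: "l > -1/2"
  shows "\<exists>c>0. \<exists>C>0. \<forall>k. c / Gamma (2 * real k + l + 1) \<le> rGamma (real k + l + 1/2) / (4 ^ k * fact k)
            \<and> rGamma (real k + l + 1/2) / (4 ^ k * fact k) \<le> C / Gamma (2 * real k + l + 1)"
proof -
  define \<alpha> where "\<alpha> = (\<lambda>k. rGamma (real k + l + 1/2) / (4 ^ k * fact k))"
  define r where "r = (\<lambda>k. \<alpha> k * Gamma (2 * real k + l + 1))"
  \<comment> \<open>\<open>r\<close> is the quotient of the two sequences and \<open>1 + \<theta> k\<close> the quotient of consecutive values of \<open>r\<close>.\<close>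
  define \<theta> where "\<theta> = (\<lambda>k. l * (l - 1) / ((2 * real k + 2) * (2 * real k + 2 * l + 1)))"
  have G0: "Gamma (2 * real k + l + 1) > 0" for k using l by (intro Gamma_real_pos) (smt (verit) of_nat_0_le_iff field_sum_of_halves)
  have den: "(2 * real k + 2) * (2 * real k + 2 * l + 1) > 0" for k using l by (intro mult_pos_pos) (auto intro: add_nonneg_pos)
  have th: "1 + \<theta> k = (2 * real k + l + 1) * (2 * real k + l + 2) / ((2 * real k + 2) * (2 * real k + 2 * l + 1))" for k
  proof -
    have "(2 * real k + 2) * (2 * real k + 2 * l + 1) + l * (l - 1) = (2 * real k + l + 1) * (2 * real k + l + 2)"
      by (simp add: algebra_simps)
    thus ?thesis using den[of k] by (simp add: \<theta>_def field_split_simps)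
  qed
  have thp: "1 + \<theta> k > 0" for k unfolding th
    by (intro divide_pos_pos mult_pos_pos den) (use l in \<open>auto intro: add_nonneg_pos\<close>)
  have rS: "r (Suc k) = (1 + \<theta> k) * r k" for k
  proof -
    have p1: "2 * real k + l + 1 > 0" "real k + l + 1/2 > 0" using l by (smt (verit) of_nat_0_le_iff field_sum_of_halves)+
    have "rGamma (real k + l + 1/2) = (real k + l + 1/2) * rGamma (real k + l + 1/2 + 1)"
      using rGamma_plus1[of "real k + l + 1/2"] by simp
    hence "\<alpha> k = (real k + l + 1/2) * (rGamma (real k + l + 1/2 + 1) / (4 ^ k * fact k))"
      by (simp add: \<alpha>_def)
    moreover have "\<alpha> (Suc k) = rGamma (real k + l + 1/2 + 1) / (4 ^ k * fact k) / (4 * (real k + 1))"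
      unfolding \<alpha>_def
      by (rule arg_cong2[where f="(/)", THEN trans, OF _ _ divide_divide_eq_left[symmetric]]) (simp_all add: add_ac)
    moreover have "real k + 1 \<noteq> 0" by linarith
    ultimately have a: "\<alpha> k = (real k + l + 1/2) * (4 * (real k + 1)) * \<alpha> (Suc k)" by simp
    have b: "Gamma (2 * real (Suc k) + l + 1) = (2 * real k + l + 2) * ((2 * real k + l + 1) * Gamma (2 * real k + l + 1))"
    proof -
      have "Gamma (2 * real k + l + 1 + 1) = (2 * real k + l + 1) * Gamma (2 * real k + l + 1)"
        using p1 by (intro Gamma_plus1) (auto elim!: nonpos_Ints_cases)
      moreover have "Gamma (2 * real k + l + 1 + 1 + 1) = (2 * real k + l + 1 + 1) * Gamma (2 * real k + l + 1 + 1)"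
        using p1 by (intro Gamma_plus1) (auto elim!: nonpos_Ints_cases)
      moreover have "2 * real (Suc k) + l + 1 = 2 * real k + l + 1 + 1 + 1" by simp
      moreover have "2 * real k + l + 1 + 1 = 2 * real k + l + 2" by simp
      ultimately show ?thesis by simp
    qed
    show ?thesis unfolding th r_def b a using den[of k] by (simp add: field_simps)
  qed
  have r0: "r 0 > 0" unfolding r_def \<alpha>_def rGamma_inverse_Gamma using G0[of 0] Gamma_real_pos[of "l + 1/2"] l by simp
  have rP: "r n = r 0 * (\<Prod>k<n. 1 + \<theta> k)" for n by (induction n) (auto simp: rS)
  have "summable (\<lambda>k. \<bar>\<theta> k\<bar>)"
  proof -
    have s: "summable (\<lambda>k. \<bar>l * (l - 1)\<bar> * inverse (real (Suc k) ^ 2))"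
      by (intro summable_mult) (use inverse_power_summable[of 2, where 'a=real] in \<open>subst summable_Suc_iff, simp\<close>)
    show ?thesis
    proof (rule summable_comparison_test'[OF s, where N=1])
      fix k :: nat assume k: "1 \<le> k"
      have "real (Suc k) ^ 2 \<le> (2 * real k + 2) * (2 * real k + 2 * l + 1)"
        unfolding power2_eq_square using k l by (intro mult_mono) auto
      hence "inverse ((2 * real k + 2) * (2 * real k + 2 * l + 1)) \<le> inverse (real (Suc k) ^ 2)"
        by (intro le_imp_inverse_le) auto
      moreover have "norm \<bar>\<theta> k\<bar> = \<bar>l * (l - 1)\<bar> * inverse ((2 * real k + 2) * (2 * real k + 2 * l + 1))"
        by (simp only: \<theta>_def real_norm_def abs_idempotent divide_inverse)
           (simp only: abs_mult[of "l * (l - 1)"] abs_of_pos[OF positive_imp_inverse_positive[OF den]])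
      ultimately show "norm \<bar>\<theta> k\<bar> \<le> \<bar>l * (l - 1)\<bar> * inverse (real (Suc k) ^ 2)"
        by (metis abs_ge_zero mult_left_mono)
    qed
  qed
  from prod_one_plus_bounds[OF this thp] obtain c C where
    c: "c > 0" "C > 0" "\<And>n. c \<le> (\<Prod>k<n. 1 + \<theta> k)" "\<And>n. (\<Prod>k<n. 1 + \<theta> k) \<le> C" by blast
  have "r 0 * c / Gamma (2 * real k + l + 1) \<le> \<alpha> k \<and> \<alpha> k \<le> r 0 * C / Gamma (2 * real k + l + 1)" for k
  proof -
    have "r 0 * c \<le> r k" "r k \<le> r 0 * C" unfolding rP[of k] using r0 c by auto
    moreover have "\<alpha> k = r k / Gamma (2 * real k + l + 1)" using G0[of k] by (simp add: r_def)
    ultimately show ?thesis using G0[of k] by (simp add: divide_right_mono)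
  qed
  thus ?thesis using r0 c(1,2) unfolding \<alpha>_def by (intro exI[of _ "r 0 * c"] exI[of _ "r 0 * C"] conjI) auto
qed

lemma bessel_I_term:
  assumes z: "z > 0"
  shows "(z / 2) powr (2 * real k + (l - 1/2)) * rGamma (real k + (l - 1/2) + 1) / fact k =
     2 powr (1/2 - l) / sqrt z * (z powr (2 * real k + l) * (rGamma (real k + l + 1/2) / (4 ^ k * fact k)))"
proof -
  have "(z / 2) powr (2 * real k + (l - 1/2)) = z powr (2 * real k + l) * z powr (-1/2) * (2 powr (1/2 - l) * 2 powr (- (2 * real k)))"
    using z by (simp add: powr_divide flip: powr_add) (simp add: powr_minus field_simps flip: powr_add)
  also have "z powr (-1/2) = 1 / sqrt z" using z by (simp add: powr_minus powr_half_sqrt field_simps)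
  also have "2 powr (- (2 * real k)) = 1 / (4 ^ k :: real)"
    using powr_realpow[of 2 "2 * k"] by (simp add: powr_minus power_mult divide_inverse)
  moreover have "real k + (l - 1/2) + 1 = real k + l + 1/2" by simp
  moreover have "A * (1 / q) * (B * (1 / w)) * R / f = B / q * (A * (R / (w * f)))" for A B R q w f :: real
    by (simp add: mult_ac)
  ultimately show ?thesis by (simp only:)
qed

lemma bessel_I_exp_term_sum:
  assumes l: "l > -1/2"
  shows "\<exists>c>0. \<exists>C>0. \<forall>z>0. c * exp_term_sum l z / sqrt z \<le> bessel_I (l - 1/2) z \<and> bessel_I (l - 1/2) z \<le> C * exp_term_sum l z / sqrt z"
proof -
  obtain c C where c: "c > 0" "C > 0" and
    b: "\<And>k. c / Gamma (2 * real k + l + 1) \<le> rGamma (real k + l + 1/2) / (4 ^ k * fact k)"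
       "\<And>k. rGamma (real k + l + 1/2) / (4 ^ k * fact k) \<le> C / Gamma (2 * real k + l + 1)"
    using bessel_coefficient_bounds[OF l] by blast
  define \<alpha> where "\<alpha> = (\<lambda>k. rGamma (real k + l + 1/2) / (4 ^ k * fact k))"
  define B where "B = 2 powr (1/2 - l)"
  have B: "B > 0" by (simp add: B_def)
  have "B * c * exp_term_sum l z / sqrt z \<le> bessel_I (l - 1/2) z \<and> bessel_I (l - 1/2) z \<le> B * C * exp_term_sum l z / sqrt z"
    if z: "z > 0" for z
  proof -
    note S = exp_term_sum_upper(1)[OF l z]
    have lo: "c * exp_term z (2 * real k + l) \<le> z powr (2 * real k + l) * \<alpha> k" 
      and up: "z powr (2 * real k + l) * \<alpha> k \<le> C * exp_term z (2 * real k + l)" for k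
      using mult_left_mono[OF b(1)[of k], of "z powr (2 * real k + l)"]
        mult_left_mono[OF b(2)[of k], of "z powr (2 * real k + l)"] by (simp_all add: exp_term_def \<alpha>_def mult.commute)
    have pos: "0 < exp_term z (2 * real k + l)" for k using exp_term_pos[OF z, of "2 * real k + l"] l by simp
    have T: "summable (\<lambda>k. z powr (2 * real k + l) * \<alpha> k)"
    proof (rule summable_comparison_test'[OF summable_mult[OF S], where N=0 and c1=C])
      fix k show "norm (z powr (2 * real k + l) * \<alpha> k) \<le> C * exp_term z (2 * real k + l)"
        using lo[of k] up[of k] mult_pos_pos[OF c(1) pos[of k]] by simp
    qed
    have e: "bessel_I (l - 1/2) z = B / sqrt z * (\<Sum>k. z powr (2 * real k + l) * \<alpha> k)"
      using suminf_mult[OF T, of "B / sqrt z"] unfolding bessel_I_def bessel_I_term[OF z] B_def \<alpha>_def .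
    have "c * exp_term_sum l z \<le> (\<Sum>k. z powr (2 * real k + l) * \<alpha> k)"
      unfolding exp_term_sum_def suminf_mult[OF S, symmetric] by (intro suminf_le lo T summable_mult S)
    moreover have "(\<Sum>k. z powr (2 * real k + l) * \<alpha> k) \<le> C * exp_term_sum l z"
      unfolding exp_term_sum_def suminf_mult[OF S, symmetric] by (intro suminf_le up T summable_mult S)
    moreover have "B / sqrt z \<ge> 0" using z B by simp
    ultimately have "B / sqrt z * (c * exp_term_sum l z) \<le> bessel_I (l - 1/2) z \<and> bessel_I (l - 1/2) z \<le> B / sqrt z * (C * exp_term_sum l z)"
      unfolding e by (intro conjI mult_left_mono)
    thus ?thesis by (simp add: mult_ac)
  qed
  thus ?thesis using c B by (intro exI[of _ "B * c"] exI[of _ "B * C"] conjI) auto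
qed

lemma bessel_I_small:
  assumes l: "l > -1/2"
  shows "\<exists>c>0. \<exists>C>0. \<forall>z. 0 < z \<and> z \<le> 1 \<longrightarrow> c * z powr (l - 1/2) \<le> bessel_I (l - 1/2) z
           \<and> bessel_I (l - 1/2) z \<le> C * z powr (l - 1/2)"
proof -
  obtain c C where c: "c > 0" "C > 0" and
    b: "\<And>z. z > 0 \<Longrightarrow> c * exp_term_sum l z / sqrt z \<le> bessel_I (l - 1/2) z"
       "\<And>z. z > 0 \<Longrightarrow> bessel_I (l - 1/2) z \<le> C * exp_term_sum l z / sqrt z"
    using bessel_I_exp_term_sum[OF l] by blast
  have G: "Gamma (l + 1) > 0" using l by (intro Gamma_real_pos) simp
  have S1: "exp_term_sum l 1 > 0" using exp_term_sum_ge[OF l, of 1] exp_term_pos[of 1 l] l by simp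
  have "c / Gamma (l + 1) * z powr (l - 1/2) \<le> bessel_I (l - 1/2) z \<and> bessel_I (l - 1/2) z \<le> C * exp_term_sum l 1 * z powr (l - 1/2)"
    if z: "0 < z" "z \<le> 1" for z
  proof
    have s: "z powr (l - 1/2) = z powr l / sqrt z" using z by (simp add: powr_diff powr_half_sqrt)
    have "c / Gamma (l + 1) * z powr (l - 1/2) = c * exp_term z l / sqrt z" by (simp add: s exp_term_def)
    also have "\<dots> \<le> c * exp_term_sum l z / sqrt z"
      by (intro divide_right_mono mult_left_mono exp_term_sum_ge l) (use z c in auto)
    also note b(1)[OF z(1)]
    finally show "c / Gamma (l + 1) * z powr (l - 1/2) \<le> bessel_I (l - 1/2) z" .
    have "exp_term_sum l z \<le> (\<Sum>k. z powr l * exp_term 1 (2 * real k + l))" unfolding exp_term_sum_def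
    proof (intro suminf_le summable_mult exp_term_sum_upper(1) l z)
      fix k
      have "z powr (2 * real k) \<le> 1" using z by (intro powr_le1) auto
      hence "z powr (2 * real k + l) \<le> z powr l" by (simp add: powr_add mult_left_le_one_le)
      thus "exp_term z (2 * real k + l) \<le> z powr l * exp_term 1 (2 * real k + l)"
        using l by (auto simp: exp_term_def intro!: divide_right_mono less_imp_le[OF Gamma_real_pos])
    qed simp
    also have "\<dots> = z powr l * exp_term_sum l 1" unfolding exp_term_sum_def
      by (intro suminf_mult exp_term_sum_upper(1) l) simp
    finally have "C * exp_term_sum l z / sqrt z \<le> C * (z powr l * exp_term_sum l 1) / sqrt z"
      by (intro divide_right_mono mult_left_mono) (use z c in auto)
    with b(2)[OF z(1)] show "bessel_I (l - 1/2) z \<le> C * exp_term_sum l 1 * z powr (l - 1/2)"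
      by (simp add: s mult_ac)
  qed
  thus ?thesis using c G S1 by (intro exI[of _ "c / Gamma (l + 1)"] exI[of _ "C * exp_term_sum l 1"] conjI) auto
qed

text \<open>
  The series with terms \<open>exp_term z (2k + l)\<close> is comparable with \<open>e\<^sup>z\<close>, and the Bessel function carries the extra factor \<open>z\<^bsup>-1/2\<^esup>\<close>.
\<close>

lemma bessel_I_large:
  assumes l: "l > -1/2"
  shows "\<exists>c>0. \<exists>C>0. \<forall>z\<ge>1. c * (exp z / sqrt z) \<le> bessel_I (l - 1/2) z
           \<and> bessel_I (l - 1/2) z \<le> C * (exp z / sqrt z)"
proof -
  obtain c C where c: "c > 0" "C > 0" and
    b: "\<And>z. z > 0 \<Longrightarrow> c * exp_term_sum l z / sqrt z \<le> bessel_I (l - 1/2) z"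
       "\<And>z. z > 0 \<Longrightarrow> bessel_I (l - 1/2) z \<le> C * exp_term_sum l z / sqrt z"
    using bessel_I_exp_term_sum[OF l] by blast
  obtain D where D: "D > 0" "\<And>z. z \<ge> 1 \<Longrightarrow> exp z \<le> D * exp_term_sum l z" using exp_term_sum_lower[OF l] by blast
  have G: "Gamma (l + 1) > 0" using l by (intro Gamma_real_pos) simp
  define m where "m = nat \<lceil>\<bar>l\<bar>\<rceil>"
  define E where "E = fact m / Gamma (l + 1) + 3"
  have E: "E > 0" using G by (auto simp: E_def intro!: add_nonneg_pos)
  have "c / D * (exp z / sqrt z) \<le> bessel_I (l - 1/2) z \<and> bessel_I (l - 1/2) z \<le> C * E * (exp z / sqrt z)"
    if z: "z \<ge> 1" for z
  proof
    have "c / D * (exp z / sqrt z) \<le> c / D * (D * exp_term_sum l z / sqrt z)"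
      by (intro mult_left_mono divide_right_mono D) (use z c D in auto)
    also have "\<dots> \<le> bessel_I (l - 1/2) z" using b(1)[of z] z D by simp
    finally show "c / D * (exp z / sqrt z) \<le> bessel_I (l - 1/2) z" .
    have "z powr l \<le> z powr (real m)" by (rule powr_mono) (use z in \<open>auto simp: m_def, linarith\<close>)
    also have "\<dots> = fact m * (z ^ m / fact m)" using z by (simp add: powr_realpow)
    also have "z ^ m / fact m \<le> exp z"
    proof -
      have "(\<lambda>n. z ^ n / fact n) sums exp z" using exp_converges[of z] by (simp add: scaleR_conv_of_real field_simps)
      from sum_le_suminf[OF sums_summable[OF this], of "{m}"] sums_unique[OF this] z show ?thesis by simp
    qed
    finally have "exp_term z l \<le> fact m * exp z / Gamma (l + 1)" using G by (simp add: exp_term_def divide_right_mono)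
    hence "exp_term_sum l z \<le> E * exp z" using exp_term_sum_upper(2)[OF l, of z] z by (simp add: E_def algebra_simps)
    hence "C * exp_term_sum l z / sqrt z \<le> C * (E * exp z) / sqrt z"
      by (intro divide_right_mono mult_left_mono) (use z c in auto)
    with b(2)[of z] z show "bessel_I (l - 1/2) z \<le> C * E * (exp z / sqrt z)" by (simp add: mult_ac)
  qed
  thus ?thesis using c D E by (intro exI[of _ "c / D"] exI[of _ "C * E"] conjI) auto
qed

lemma summable_bessel_I_series:
  fixes l w :: real
  assumes l: "l > -1/2"
  shows "summable (\<lambda>k. rGamma (real k + l + 1/2) / fact k * w ^ k)" (is "summable (\<lambda>k. ?a k * w ^ k)")
proof (rule summable_ratio_test[of "1/2" "nat \<lceil>2 * \<bar>w\<bar>\<rceil> + 2"])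
  fix k assume k: "nat \<lceil>2 * \<bar>w\<bar>\<rceil> + 2 \<le> k"
  have p: "real k + l + 1/2 > 0" using l by (smt (verit) of_nat_0_le_iff field_sum_of_halves)
  have k1: "real k + l + 1/2 \<ge> 1" "real (Suc k) \<ge> 2 * \<bar>w\<bar>" using k l by linarith+
  have e: "?a k = (real k + l + 1/2) * (real (Suc k) * ?a (Suc k))"
    using rGamma_plus1[of "real k + l + 1/2"] by (simp add: add_ac)
  have "2 * \<bar>w\<bar> \<le> (real k + l + 1/2) * real (Suc k)" 
    using mult_mono[OF k1(1) k1(2)] p by simp
  from mult_right_mono[OF this, of "\<bar>?a (Suc k)\<bar> * \<bar>w\<bar> ^ k"]
  have "2 * (\<bar>?a (Suc k)\<bar> * \<bar>w\<bar> ^ Suc k) \<le> (real k + l + 1/2) * real (Suc k) * \<bar>?a (Suc k)\<bar> * \<bar>w\<bar> ^ k"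
    by (simp add: mult_ac)
  also have "\<dots> = \<bar>?a k\<bar> * \<bar>w\<bar> ^ k" unfolding e using p by (simp add: abs_mult mult_ac)
  finally have "2 * norm (?a (Suc k) * w ^ Suc k) \<le> norm (?a k * w ^ k)"
    by (simp only: norm_mult norm_power real_norm_def abs_mult power_abs)
  thus "norm (?a (Suc k) * w ^ Suc k) \<le> 1/2 * norm (?a k * w ^ k)" by linarith
qed simp

lemma bessel_I_power_series:
  assumes l: "l > -1/2" and z: "z > 0"
  shows "bessel_I (l - 1/2) z = (z / 2) powr (l - 1/2) * (\<Sum>k. rGamma (real k + l + 1/2) / fact k * (z\<^sup>2 / 4) ^ k)"
proof -
  have t: "(z / 2) powr (2 * real k + (l - 1/2)) * rGamma (real k + (l - 1/2) + 1) / fact k =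
     (z / 2) powr (l - 1/2) * (rGamma (real k + l + 1/2) / fact k * (z\<^sup>2 / 4) ^ k)" for k
  proof -
    have "(z / 2) powr (2 * real k) = ((z / 2)\<^sup>2) ^ k"
      using z powr_realpow[of "z/2" "2*k"] by (simp add: power_mult)
    also have "\<dots> = (z\<^sup>2 / 4) ^ k" by (simp add: power_divide)
    moreover have "real k + (l - 1/2) + 1 = real k + l + 1/2" by simp
    ultimately show ?thesis by (simp only: powr_add) simp
  qed
  show ?thesis unfolding bessel_I_def t by (intro suminf_mult summable_bessel_I_series l)
qed

lemma continuous_on_bessel_I:
  assumes l: "l > -1/2"
  shows "continuous_on {0<..} (bessel_I (l - 1/2))"
proof -
  let ?a = "\<lambda>k. rGamma (real k + l + 1/2) / fact k"
  have c: "continuous_on UNIV (\<lambda>w::real. \<Sum>k. ?a k * w ^ k)"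
    by (intro continuous_at_imp_continuous_on ballI isCont_powser_converges_everywhere summable_bessel_I_series l)
  have "continuous_on {0<..} (\<lambda>z. (z / 2) powr (l - 1/2) * (\<Sum>k. ?a k * (z\<^sup>2 / 4) ^ k))"
    by (intro continuous_intros continuous_on_compose2[OF c]) auto
  thus ?thesis by (rule continuous_on_cong[THEN iffD1, rotated -1]) (auto simp: bessel_I_power_series[OF l])
qed

section \<open>Bounds for the heat kernel\<close>

lemma powr_times_exp_bounded:
  fixes a c :: real
  assumes "a \<ge> 0" "c > 0"
  shows "\<exists>K>0. \<forall>s>0. s powr a * exp (- c * s) \<le> K"
proof (cases "a = 0")
  case True
  thus ?thesis using assms by (intro exI[of _ 1]) auto
next
  case False
  hence a: "a > 0" using assms by simp
  have "s powr a * exp (- c * s) \<le> exp (a * ln (a / c))" if s: "s > 0" for s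
  proof -
    have "ln (c * s / a) \<le> c * s / a - 1" using assms a s by (intro ln_le_minus_one) auto
    moreover have "ln (c * s / a) = ln s - ln (a / c)"
      using assms a s by (simp add: ln_div ln_mult)
    ultimately have "ln s \<le> ln (a / c) + c * s / a" by simp
    from mult_left_mono[OF this, of a] a have "a * ln s - c * s \<le> a * ln (a / c)" by (simp add: algebra_simps)
    moreover have "s powr a * exp (- c * s) = exp (a * ln s - c * s)"
      using s by (simp add: powr_def flip: exp_add)
    ultimately show ?thesis by simp
  qed
  thus ?thesis by (intro exI[of _ "exp (a * ln (a / c))"]) auto
qed

lemma square_powr: "y > 0 \<Longrightarrow> (y\<^sup>2) powr r = y powr (2 * r)" for y :: real
  using powr_powr[of y 2 r] by simp

lemma powr_scaling_identity:
  fixes w s a b :: real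
  assumes "w > 0" "s > 0"
  shows "w powr a / s * (w / s) powr b = w powr (a + b) * s powr (-1 - b)"
proof -
  have "s powr (-1 - b) = s powr (-1) * s powr (-b)" by (simp only: powr_add[symmetric]) simp
  also have "\<dots> = inverse s * inverse (s powr b)" using assms by (simp add: powr_minus)
  finally have "s powr (-1 - b) = inverse s * inverse (s powr b)" .
  moreover have "(w / s) powr b = w powr b * inverse (s powr b)"
    using assms by (subst powr_divide) (auto simp: field_simps)
  ultimately show ?thesis by (simp only: powr_add divide_inverse mult_ac)
qed

text \<open>
  The behaviour of the heat kernel up to constants: the first case is the small argument regime of
  the Bessel function, the second the large argument regime, where completing the
  square produces the Gaussian.
\<close>

definition heat_model :: "real \<Rightarrow> real \<Rightarrow> real \<Rightarrow> real \<Rightarrow> real" where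
  "heat_model l t x y = (if x * y \<le> 2 * t then (2*t) powr (-l - 1/2) * exp (- (x\<^sup>2 + y\<^sup>2) / (4*t))
     else (x*y) powr (-l) * (2*t) powr (-1/2) * exp (- (x - y)\<^sup>2 / (4*t)))"

lemma heat_kernel_two_sided:
  assumes l: "l > -1/2"
  shows "\<exists>c>0. \<exists>C>0. \<forall>t>0. \<forall>x>0. \<forall>y>0.
     c * heat_model l t x y \<le> heat_kernel l t x y \<and> heat_kernel l t x y \<le> C * heat_model l t x y"
proof -
  obtain c1 C1 where 1: "c1 > 0" "C1 > 0" "\<And>z. 0 < z \<Longrightarrow> z \<le> 1 \<Longrightarrow> c1 * z powr (l - 1/2) \<le> bessel_I (l - 1/2) z"
    "\<And>z. 0 < z \<Longrightarrow> z \<le> 1 \<Longrightarrow> bessel_I (l - 1/2) z \<le> C1 * z powr (l - 1/2)"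
    using bessel_I_small[OF l] by blast
  obtain c2 C2 where 2: "c2 > 0" "C2 > 0" "\<And>z. z \<ge> 1 \<Longrightarrow> c2 * (exp z / sqrt z) \<le> bessel_I (l - 1/2) z"
    "\<And>z. z \<ge> 1 \<Longrightarrow> bessel_I (l - 1/2) z \<le> C2 * (exp z / sqrt z)"
    using bessel_I_large[OF l] by blast
  define c where "c = min c1 c2"
  define C where "C = max C1 C2"
  have cC: "c > 0" "C > 0" "c \<le> c1" "c \<le> c2" "C1 \<le> C" "C2 \<le> C" using 1 2 by (auto simp: c_def C_def)
  have A: "c * ((2*t) powr (-l - 1/2) * exp (- (x\<^sup>2 + y\<^sup>2) / (4*t))) \<le> heat_kernel l t x y \<and>
        heat_kernel l t x y \<le> C * ((2*t) powr (-l - 1/2) * exp (- (x\<^sup>2 + y\<^sup>2) / (4*t)))"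
    if p: "t > 0" "x > 0" "y > 0" and le: "x * y \<le> 2 * t" for t x y
  proof -
    define z where "z = x * y / (2 * t)"
    have z: "0 < z" "z \<le> 1" using p le by (auto simp: z_def)
    define A where "A = (x * y) powr (- l + 1 / 2) / (2 * t) * exp (- (x\<^sup>2 + y\<^sup>2) / (4 * t))"
    have A0: "A > 0" using p by (simp add: A_def)
    have W: "heat_kernel l t x y = A * bessel_I (l - 1/2) z" by (simp add: heat_kernel_def A_def z_def)
    have "(x * y) powr (- l + 1 / 2) / (2 * t) * z powr (l - 1/2) = (x * y) powr (- l + 1 / 2 + (l - 1/2)) * (2 * t) powr (-1 - (l - 1/2))"
      unfolding z_def by (rule powr_scaling_identity) (use p in auto)
    moreover have "- l + 1 / 2 + (l - 1/2) = 0" "-1 - (l - 1/2) = -l - 1/2" by simp_all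
    ultimately have "(x * y) powr (- l + 1 / 2) / (2 * t) * z powr (l - 1/2) = (2*t) powr (-l - 1/2)"
      using p by (simp only:) simp
    from arg_cong[OF this, of "\<lambda>u. u * exp (- (x\<^sup>2 + y\<^sup>2) / (4*t))"]
    have e: "A * z powr (l - 1/2) = (2*t) powr (-l - 1/2) * exp (- (x\<^sup>2 + y\<^sup>2) / (4*t))"
      unfolding A_def by (simp only: mult_ac)
    have "c * z powr (l - 1/2) \<le> bessel_I (l - 1/2) z"
      by (rule order_trans[OF mult_right_mono[OF cC(3)] 1(3)[OF z]]) simp
    moreover have "bessel_I (l - 1/2) z \<le> C * z powr (l - 1/2)"
      by (rule order_trans[OF 1(4)[OF z] mult_right_mono[OF cC(5)]]) simp
    ultimately show ?thesis unfolding W e[symmetric] using A0 by (simp add: mult.left_commute)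
  qed
  have B: "c * ((x*y) powr (-l) * (2*t) powr (-1/2) * exp (- (x - y)\<^sup>2 / (4*t))) \<le> heat_kernel l t x y \<and>
        heat_kernel l t x y \<le> C * ((x*y) powr (-l) * (2*t) powr (-1/2) * exp (- (x - y)\<^sup>2 / (4*t)))"
    if p: "t > 0" "x > 0" "y > 0" and le: "x * y \<ge> 2 * t" for t x y
  proof -
    define z where "z = x * y / (2 * t)"
    have z: "z \<ge> 1" using p le by (auto simp: z_def)
    define A where "A = (x * y) powr (- l + 1 / 2) / (2 * t) * exp (- (x\<^sup>2 + y\<^sup>2) / (4 * t))"
    have A0: "A > 0" using p by (simp add: A_def)
    have W: "heat_kernel l t x y = A * bessel_I (l - 1/2) z" by (simp add: heat_kernel_def A_def z_def)
    have "(x * y) powr (- l + 1 / 2) / (2 * t) * z powr (-1/2) = (x * y) powr (-l + 1/2 + -1/2) * (2*t) powr (-1 - -1/2)"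
      unfolding z_def by (rule powr_scaling_identity) (use p in auto)
    moreover have "- l + 1 / 2 + -1/2 = -l" "-1 - (-1/2) = (-1/2 :: real)" by simp_all
    moreover have "z powr (-1/2) = 1 / sqrt z" using z by (simp add: powr_minus_divide powr_half_sqrt)
    ultimately have e1: "(x * y) powr (- l + 1 / 2) / (2 * t) * (1 / sqrt z) = (x*y) powr (-l) * (2*t) powr (-1/2)"
      by (simp only:)
    have "- (x\<^sup>2 + y\<^sup>2) / (4 * t) + z = - (x - y)\<^sup>2 / (4*t)"
      using p unfolding z_def by (simp add: field_simps power2_eq_square)
    hence e2: "exp (- (x\<^sup>2 + y\<^sup>2) / (4 * t)) * exp z = exp (- (x - y)\<^sup>2 / (4*t))" by (simp only: exp_add[symmetric])
    have e: "A * (exp z / sqrt z) = (x*y) powr (-l) * (2*t) powr (-1/2) * exp (- (x - y)\<^sup>2 / (4*t))"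
      unfolding A_def e1[symmetric] e2[symmetric] by simp
    have "c * (exp z / sqrt z) \<le> bessel_I (l - 1/2) z"
      by (rule order_trans[OF mult_right_mono[OF cC(4)] 2(3)[OF z]]) (use z in simp)
    moreover have "bessel_I (l - 1/2) z \<le> C * (exp z / sqrt z)"
      by (rule order_trans[OF 2(4)[OF z] mult_right_mono[OF cC(6)]]) (use z in simp)
    ultimately show ?thesis unfolding W e[symmetric] using A0 
      by (simp only: mult.left_commute[of _ A] mult_le_cancel_left_pos)
  qed
  have "c * heat_model l t x y \<le> heat_kernel l t x y \<and> heat_kernel l t x y \<le> C * heat_model l t x y"
    if "t > 0" "x > 0" "y > 0" for t x y
    using A[OF that] B[OF that] by (simp add: heat_model_def)
  with cC(1,2) show ?thesis by blast
qed

lemma heat_kernel_nonneg: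
  assumes "l > -1/2" "t > 0" "x > 0" "y > 0"
  shows "heat_kernel l t x y \<ge> 0"
proof -
  obtain c where c: "c > 0" "c * heat_model l t x y \<le> heat_kernel l t x y"
    using heat_kernel_two_sided[OF assms(1)] assms(2-4) by blast
  have "0 \<le> c * heat_model l t x y" using c(1) by (simp add: heat_model_def)
  with c(2) show ?thesis by simp
qed

lemma heat_kernel_commute: "heat_kernel l t x y = heat_kernel l t y x"
  by (simp add: heat_kernel_def mult.commute add.commute)

lemma continuous_on_heat_kernel:
  assumes l: "l > -1/2" and t: "t > 0"
  shows "continuous_on ({0<..} \<times> {0<..}) (\<lambda>(x, y). heat_kernel l t x y)"
proof -
  have I: "continuous_on ({0<..} \<times> {0<..}) (\<lambda>p. bessel_I (l - 1 / 2) (fst p * snd p / (2 * t)))"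
    by (intro continuous_on_compose2[OF continuous_on_bessel_I[OF l]] continuous_intros) (use t in auto)
  show ?thesis unfolding heat_kernel_def split_def
    by (intro continuous_on_mult I continuous_intros) (use t in auto)
qed

text \<open>
  Away from the diagonal the Gaussian beats every power of \<open>y\<^sup>2 / t\<close> as \<open>t \<rightarrow> 0\<close>, while as \<open>t \<rightarrow> \<infinity>\<close> the kernel decays
  like \<open>t\<^bsup>-l-1/2\<^esup>\<close>; this is the reason for the restriction on \<open>\<sigma>\<close>. The value \<open>\<sigma> = 0\<close> removes \<open>t\<close> and gives the
  maximal estimate, \<open>\<sigma> = -1/2\<close> and \<open>\<sigma> = l + 1/2\<close> give integrability over the half-line uniformly in \<open>t\<close>.
\<close>

lemma heat_kernel_far:
  assumes l: "l > -1/2" and \<sigma>: "\<sigma> \<le> l + 1/2"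
  shows "\<exists>C>0. \<forall>t>0. \<forall>x>0. \<forall>y\<ge>10/9 * x.
     heat_kernel l t x y \<le> C * (y powr (-2*l - 1) * (y\<^sup>2 / t) powr \<sigma>)"
proof -
  obtain C where C: "C > 0" and
    M0: "\<forall>t>0. \<forall>x>0. \<forall>y>0. heat_kernel l t x y \<le> C * heat_model l t x y"
    using heat_kernel_two_sided[OF l] by meson
  note M = M0[rule_format]
  have A: "heat_kernel l t x y \<le> C * ((2*t) powr (-l - 1/2) * exp (- (x\<^sup>2 + y\<^sup>2) / (4*t)))"
    if "t > 0" "x > 0" "y > 0" "x * y \<le> 2 * t" for t x y
    using M[OF that(1-3)] that(4) by (simp add: heat_model_def)
  have B: "heat_kernel l t x y \<le> C * ((x*y) powr (-l) * (2*t) powr (-1/2) * exp (- (x - y)\<^sup>2 / (4*t)))"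
    if "t > 0" "x > 0" "y > 0" "x * y > 2 * t" for t x y
    using M[OF that(1-3)] that(4) by (simp add: heat_model_def)
  define a where "a = max (l + 1/2) (1/2)"
  obtain K1 where K1: "K1 > 0" "\<And>s. s > 0 \<Longrightarrow> s powr (l + 1/2 - \<sigma>) * exp (- (1/400) * s) \<le> K1"
    using powr_times_exp_bounded[of "l + 1/2 - \<sigma>" "1/400"] \<sigma> by auto
  obtain K2 where K2: "K2 > 0" "\<And>s. s > 0 \<Longrightarrow> s powr (a - \<sigma>) * exp (- (1/400) * s) \<le> K2"
  proof -
    have "a - \<sigma> \<ge> 0" using \<sigma> by (simp add: a_def)
    from powr_times_exp_bounded[OF this, of "1/400"] show ?thesis using that by auto
  qed
  define K where "K = max K1 K2"
  have K: "K > 0" "\<And>s. s > 0 \<Longrightarrow> s powr (l + 1/2) * exp (- (1/400) * s) \<le> K * s powr \<sigma>"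
     "\<And>s. s > 0 \<Longrightarrow> s powr a * exp (- (1/400) * s) \<le> K * s powr \<sigma>"
  proof -
    show "K > 0" using K1 by (auto simp: K_def)
    fix s :: real assume s: "s > 0"
    have "s powr (l + 1/2 - \<sigma>) * exp (- (1/400) * s) \<le> K" using K1(2)[OF s] by (auto simp: K_def)
    from mult_right_mono[OF this, of "s powr \<sigma>"] s
    show "s powr (l + 1/2) * exp (- (1/400) * s) \<le> K * s powr \<sigma>" by (simp add: powr_diff)
    have "s powr (a - \<sigma>) * exp (- (1/400) * s) \<le> K" using K2(2)[OF s] by (auto simp: K_def)
    from mult_right_mono[OF this, of "s powr \<sigma>"] s
    show "s powr a * exp (- (1/400) * s) \<le> K * s powr \<sigma>" by (simp add: powr_diff)
  qed
  define D where "D = max (2 powr (-l - 1/2)) (2 powr (-1/2))"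
  have D: "D > 0" "2 powr (-l - 1/2) \<le> D" "2 powr (-1/2) \<le> D" by (auto simp: D_def less_max_iff_disj)
  have "heat_kernel l t x y \<le> C * D * K * (y powr (-2*l - 1) * (y\<^sup>2 / t) powr \<sigma>)"
    if p: "t > 0" "x > 0" and xy: "y \<ge> 10/9 * x" for t x y
  proof -
    have y: "y > 0" "x \<le> y" using p xy by linarith+
    define s where "s = y\<^sup>2 / t"
    have s: "s > 0" using p y by (simp add: s_def)
    have ts: "t = y\<^sup>2 / s" using p y by (simp add: s_def)
    have tp: "(2*t) powr r = 2 powr r * y powr (2*r) * s powr (-r)" for r
      using s y unfolding ts by (simp add: powr_divide powr_mult square_powr powr_minus_divide)
    show ?thesis
    proof (cases "x * y \<le> 2 * t")
      case True
      have "- (x\<^sup>2 + y\<^sup>2) / (4*t) = - (x\<^sup>2 / t + s) / 4" using p by (simp add: s_def field_simps)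
      moreover have "- (u + s) / 4 \<le> - (1/400) * s" if "u \<ge> 0" for u using s that by simp
      moreover have "x\<^sup>2 / t \<ge> 0" using p by simp
      ultimately have "- (x\<^sup>2 + y\<^sup>2) / (4*t) \<le> - (1/400) * s" by (simp only:)
      hence "exp (- (x\<^sup>2 + y\<^sup>2) / (4*t)) \<le> exp (- (1/400) * s)" by (simp only: exp_le_cancel_iff)
      hence "(2*t) powr (-l - 1/2) * exp (- (x\<^sup>2 + y\<^sup>2) / (4*t)) \<le> (2*t) powr (-l - 1/2) * exp (- (1/400) * s)"
        by (intro mult_left_mono) auto
      also have "\<dots> = 2 powr (-l - 1/2) * (y powr (-2*l - 1) * (s powr (l + 1/2) * exp (- (1/400) * s)))"
        unfolding tp by (simp add: algebra_simps)
      also have "\<dots> \<le> D * (y powr (-2*l - 1) * (K * s powr \<sigma>))"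
        by (intro mult_mono mult_left_mono K D s) (use D K in auto)
      finally have "C * ((2*t) powr (-l - 1/2) * exp (- (x\<^sup>2 + y\<^sup>2) / (4*t))) \<le> C * (D * (y powr (-2*l - 1) * (K * s powr \<sigma>)))"
        using C by (intro mult_left_mono) auto
      with A[OF p y(1) True] show ?thesis by (simp add: s_def mult_ac)
    next
      case False
      hence F: "x * y > 2 * t" by simp
      \<comment> \<open>The distance to the diagonal is at least \<open>y/10\<close>, which explains the constant \<open>1/400\<close>.\<close>
      have "(y / 10)\<^sup>2 \<le> (y - x)\<^sup>2" by (rule power_mono) (use xy y in auto)
      hence "exp (- (x - y)\<^sup>2 / (4*t)) \<le> exp (- (1/400) * s)"
        using p y by (simp add: s_def field_simps power2_commute)
      hence "(x*y) powr (-l) * (2*t) powr (-1/2) * exp (- (x - y)\<^sup>2 / (4*t)) \<le> (x*y) powr (-l) * (2*t) powr (-1/2) * exp (- (1/400) * s)"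
        by (intro mult_left_mono) auto
      also have "\<dots> \<le> D * (y powr (-2*l - 1) * (s powr a * exp (- (1/400) * s)))"
      proof (cases "l \<ge> 0")
        case True
        have "(x*y) powr (-l) \<le> (2*t) powr (-l)" using F True p by (intro powr_mono2') auto
        hence "(x*y) powr (-l) * (2*t) powr (-1/2) \<le> (2*t) powr (-l) * (2*t) powr (-1/2)"
          by (intro mult_right_mono) auto
        also have "\<dots> = (2*t) powr (-l - 1/2)" by (simp add: algebra_simps flip: powr_add)
        also have "\<dots> = 2 powr (-l - 1/2) * (y powr (-2*l - 1) * s powr a)" unfolding tp using True by (simp add: a_def algebra_simps)
        also have "\<dots> \<le> D * (y powr (-2*l - 1) * s powr a)" by (intro mult_right_mono D) auto
        finally have "(x*y) powr (-l) * (2*t) powr (-1/2) \<le> D * (y powr (-2*l - 1) * s powr a)" .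
        from mult_right_mono[OF this, of "exp (- (1/400) * s)"] show ?thesis by (simp add: mult.assoc)
      next
        case False
        have "(x*y) powr (-l) \<le> (y\<^sup>2) powr (-l)" using F False p y by (intro powr_mono2) (auto simp: power2_eq_square)
        hence "(x*y) powr (-l) * (2*t) powr (-1/2) \<le> (y\<^sup>2) powr (-l) * (2*t) powr (-1/2)"
          by (intro mult_right_mono) auto
        also have "\<dots> = 2 powr (-1/2) * (y powr (-2*l) * y powr (-1) * s powr a)" unfolding tp using False y by (simp add: a_def square_powr mult_ac)
        also have "y powr (-2*l) * y powr (-1) = y powr (-2*l - 1)" by (simp only: powr_add[symmetric]) simp
        also have "2 powr (-1/2) * (y powr (-2*l - 1) * s powr a) \<le> D * (y powr (-2*l - 1) * s powr a)" by (intro mult_right_mono D) auto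
        finally have "(x*y) powr (-l) * (2*t) powr (-1/2) \<le> D * (y powr (-2*l - 1) * s powr a)" .
        from mult_right_mono[OF this, of "exp (- (1/400) * s)"] show ?thesis by (simp add: mult.assoc)
      qed
      also have "\<dots> \<le> D * (y powr (-2*l - 1) * (K * s powr \<sigma>))"
        by (intro mult_left_mono K D s) (use D K in auto)
      finally have "C * ((x*y) powr (-l) * (2*t) powr (-1/2) * exp (- (x - y)\<^sup>2 / (4*t))) \<le> C * (D * (y powr (-2*l - 1) * (K * s powr \<sigma>)))"
        using C by (intro mult_left_mono) auto
      with B[OF p y(1) F] show ?thesis by (simp add: s_def mult_ac)
    qed
  qed
  moreover have "C * D * K > 0" using C D K by simp
  ultimately show ?thesis by blast
qed

lemma powr_ratio_bound:
  fixes u :: real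
  assumes "1/2 \<le> u" "u \<le> 2"
  shows "u powr a \<le> 2 powr \<bar>a\<bar>"
proof (cases "a \<ge> 0")
  case True
  thus ?thesis using assms powr_mono2[of a u 2] by simp
next
  case False
  have "u powr a \<le> (1/2) powr a" by (rule powr_mono2') (use False assms in auto)
  also have "(1/2 :: real) = 2 powr (-1)" by (simp add: powr_minus_divide)
  also have "(2 powr (-1)) powr a = 2 powr \<bar>a\<bar>" using False by (simp only: powr_powr) simp
  finally show ?thesis .
qed

text \<open>
  For \<open>l < 0\<close> the Gaussian times \<open>x\<^bsup>-2l\<^esup>\<close> is too small when \<open>t\<close> is much larger than \<open>xy\<close>. In that range
  the factor \<open>t\<^bsup>-l-1/2\<^esup>\<close> is at most a multiple of \<open>(xy)\<^bsup>-l-1/2\<^esup>\<close>, which is of order \<open>x\<^bsup>-2l-1\<^esup>\<close>; hence the summand \<open>1/x\<close>.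
\<close>

lemma heat_kernel_near:
  assumes l: "l > -1/2"
  shows "\<exists>C>0. \<forall>t>0. \<forall>x>0. \<forall>y. 9/10 * x \<le> y \<and> y \<le> 10/9 * x \<longrightarrow>
     heat_kernel l t x y \<le> C * (x powr (-2*l) * (t powr (-1/2) * exp (- (x - y)\<^sup>2 / (4*t)) + 1 / x))"
proof -
  obtain C where C: "C > 0" and
    M0: "\<forall>t>0. \<forall>x>0. \<forall>y>0. heat_kernel l t x y \<le> C * heat_model l t x y"
    using heat_kernel_two_sided[OF l] by meson
  note M = M0[rule_format]
  have A: "heat_kernel l t x y \<le> C * ((2*t) powr (-l - 1/2) * exp (- (x\<^sup>2 + y\<^sup>2) / (4*t)))"
    if "t > 0" "x > 0" "y > 0" "x * y \<le> 2 * t" for t x y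
    using M[OF that(1-3)] that(4) by (simp add: heat_model_def)
  have B: "heat_kernel l t x y \<le> C * ((x*y) powr (-l) * (2*t) powr (-1/2) * exp (- (x - y)\<^sup>2 / (4*t)))"
    if "t > 0" "x > 0" "y > 0" "x * y > 2 * t" for t x y
    using M[OF that(1-3)] that(4) by (simp add: heat_model_def)
  define D where "D = 2 powr \<bar>l\<bar> + 2 powr \<bar>l + 1/2\<bar>"
  have D: "D > 0" "2 powr \<bar>l\<bar> \<le> D" "2 powr \<bar>l + 1/2\<bar> \<le> D" by (auto simp: D_def intro: add_pos_pos)
  have "heat_kernel l t x y \<le> C * D * (x powr (-2*l) * (t powr (-1/2) * exp (- (x - y)\<^sup>2 / (4*t)) + 1 / x))"
    if p: "t > 0" "x > 0" and xy: "9/10 * x \<le> y" "y \<le> 10/9 * x" for t x y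
  proof -
    have y: "y > 0" using p xy by linarith
    have u: "1/2 \<le> y / x" "y / x \<le> 2" using xy p by (simp_all add: field_simps)
    have xyp: "(x * y) powr r \<le> 2 powr \<bar>r\<bar> * x powr (2*r)" for r
    proof -
      have "(x * y) powr r = (x\<^sup>2 * (y / x)) powr r" using p by (simp add: power2_eq_square)
      also have "\<dots> = x powr (2 * r) * (y / x) powr r" using p y
        by (subst powr_mult) (auto simp: square_powr)
      also have "\<dots> \<le> x powr (2*r) * 2 powr \<bar>r\<bar>" by (intro mult_left_mono powr_ratio_bound u) auto
      finally show ?thesis by (simp add: mult.commute)
    qed
    show ?thesis
    proof (cases "x * y \<le> 2 * t")
      case True
      have "(2*t) powr (-l - 1/2) \<le> (x * y) powr (-l - 1/2)" using True p y l by (intro powr_mono2') auto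
      also have "\<dots> \<le> 2 powr \<bar>-l - 1/2\<bar> * x powr (2*(-l - 1/2))" by (rule xyp)
      also have "\<bar>-l - 1/2\<bar> = \<bar>l + 1/2\<bar>" by simp
      also have "2 powr \<bar>l + 1/2\<bar> * x powr (2*(-l - 1/2)) \<le> D * x powr (2*(-l - 1/2))"
        by (intro mult_right_mono D) auto
      also have "x powr (2*(-l - 1/2)) = x powr (-2*l) * (1/x)" using p by (simp add: powr_diff)
      finally have "(2*t) powr (-l - 1/2) \<le> D * (x powr (-2*l) * (1/x))" .
      hence "(2*t) powr (-l - 1/2) * exp (- (x\<^sup>2 + y\<^sup>2) / (4*t)) \<le> D * (x powr (-2*l) * (1/x)) * 1"
        using p by (intro mult_mono) (auto simp: D(1) less_imp_le divide_nonpos_pos)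
      also have "\<dots> \<le> D * (x powr (-2*l) * (t powr (-1/2) * exp (- (x - y)\<^sup>2 / (4*t)) + 1 / x))"
        unfolding mult_1_right using D(1) by (intro mult_left_mono) auto
      finally have "C * ((2*t) powr (-l - 1/2) * exp (- (x\<^sup>2 + y\<^sup>2) / (4*t))) \<le> C * (D * (x powr (-2*l) * (t powr (-1/2) * exp (- (x - y)\<^sup>2 / (4*t)) + 1 / x)))"
        using C by (intro mult_left_mono) auto
      with A[OF p y True] show ?thesis by (simp add: mult_ac)
    next
      case False
      hence F: "x * y > 2 * t" by simp
      have "(x*y) powr (-l) \<le> D * x powr (-2*l)"
        using xyp[of "-l"] mult_right_mono[OF D(2), of "x powr (-2*l)"] by simp
      moreover have "(2*t) powr (-1/2) \<le> t powr (-1/2)" using p by (intro powr_mono2') auto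
      ultimately have "(x*y) powr (-l) * (2*t) powr (-1/2) * exp (- (x - y)\<^sup>2 / (4*t))
         \<le> D * x powr (-2*l) * t powr (-1/2) * exp (- (x - y)\<^sup>2 / (4*t))"
        using D(1) by (intro mult_right_mono mult_mono) auto
      also have "\<dots> \<le> D * (x powr (-2*l) * (t powr (-1/2) * exp (- (x - y)\<^sup>2 / (4*t)) + 1 / x))"
        using D(1) p by (simp add: distrib_left)
      finally have "C * ((x*y) powr (-l) * (2*t) powr (-1/2) * exp (- (x - y)\<^sup>2 / (4*t))) \<le> C * (D * (x powr (-2*l) * (t powr (-1/2) * exp (- (x - y)\<^sup>2 / (4*t)) + 1 / x)))"
        using C by (intro mult_left_mono) auto
      with B[OF p y F] show ?thesis by (simp add: mult_ac)
    qed
  qed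
  moreover have "C * D > 0" using C D by simp
  ultimately show ?thesis by blast
qed

section \<open>Powers in the extended half-line and power weights\<close>

lemma epowr_zero [simp]: "epowr 0 p = 0" by (simp add: epowr_def)

lemma epowr_top [simp]: "epowr top p = top" by (simp add: epowr_def)

lemma epowr_ennreal [simp]: "r \<ge> 0 \<Longrightarrow> epowr (ennreal r) p = ennreal (r powr p)"
  by (simp add: epowr_def)

lemma epowr_one [simp]: "epowr a 1 = a"
  by (cases a) auto

lemma epowr_mono: "a \<le> b \<Longrightarrow> p \<ge> 0 \<Longrightarrow> epowr a p \<le> epowr b p"
  by (cases a; cases b) (auto simp: powr_mono2 top_unique)

lemma epowr_cmult: "c \<ge> 0 \<Longrightarrow> epowr (ennreal c * a) p = ennreal (c powr p) * epowr a p"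
  by (cases a; cases "c = 0") (auto simp: powr_mult ennreal_mult_top simp flip: ennreal_mult)

lemma epowr_epowr: "epowr (epowr a p) q = epowr a (p * q)"
  by (cases a) (auto simp: powr_powr)

lemma epowr_times_self: "epowr a p * a = epowr a (p + 1)"
proof (cases a)
  case (real r)
  have "r powr p * r = r powr (p + 1)" using real(1) by (cases "r = 0") (auto simp: powr_add)
  with real show ?thesis by (simp flip: ennreal_mult)
qed (simp add: ennreal_mult_top)

lemma borel_measurable_epowr [measurable (raw)]:
  assumes [measurable]: "f \<in> borel_measurable M"
  shows "(\<lambda>x. epowr (f x) p) \<in> borel_measurable M"
  unfolding epowr_def by measurable

text \<open>
  The Borel version of \<open>power_measure\<close>, living on the whole line. Estimates are proved for Borel
  functions and this measure, and are transferred to Lebesgue measurable functions afterwards.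
\<close>

definition half_line_measure :: "real \<Rightarrow> real measure" where
  "half_line_measure d = density lborel (\<lambda>x. ennreal (x powr d) * indicator {0<..} x)"

lemma sets_half_line_measure [simp, measurable_cong]: "sets (half_line_measure d) = sets borel"
  by (simp add: half_line_measure_def)

lemma space_half_line_measure [simp]: "space (half_line_measure d) = UNIV"
  by (simp add: half_line_measure_def)

lemma nn_integral_half_line:
  "f \<in> borel_measurable borel \<Longrightarrow>
    (\<integral>\<^sup>+x. f x \<partial>half_line_measure d) = (\<integral>\<^sup>+x. ennreal (x powr d) * indicator {0<..} x * f x \<partial>lborel)"
  unfolding half_line_measure_def by (subst nn_integral_density) auto

lemma emeasure_half_line:
  assumes "A \<in> sets borel"
  shows "emeasure (half_line_measure d) A = (\<integral>\<^sup>+x. ennreal (x powr d) * indicator {0<..} x * indicator A x \<partial>lborel)"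
  using assms nn_integral_half_line[of "indicator A" d] nn_integral_indicator[of A "half_line_measure d"] by simp

text \<open>
  On \<open>[a/2, 2a]\<close> the weight \<open>x\<^sup>d\<close> is comparable with the constant \<open>a\<^sup>d\<close>.
\<close>

lemma half_line_comparison:
  assumes a: "a > 0" and f[measurable]: "f \<in> borel_measurable borel"
    and B[measurable]: "B \<in> sets borel" and sub: "B \<subseteq> {a/2..2*a}"
  shows "(\<integral>\<^sup>+x\<in>B. f x \<partial>half_line_measure d) \<le> ennreal (2 powr \<bar>d\<bar> * a powr d) * (\<integral>\<^sup>+x\<in>B. f x \<partial>lborel)"
    and "ennreal (a powr d) * (\<integral>\<^sup>+x\<in>B. f x \<partial>lborel) \<le> ennreal (2 powr \<bar>d\<bar>) * (\<integral>\<^sup>+x\<in>B. f x \<partial>half_line_measure d)"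
proof -
  have *: "x powr d \<le> 2 powr \<bar>d\<bar> * a powr d" if "x \<in> B" for x
  proof -
    have x: "x \<ge> a / 2" "x \<le> 2 * a" using that sub by auto
    have "(x / a) powr d \<le> 2 powr \<bar>d\<bar>" using x a by (intro powr_ratio_bound) (simp_all add: field_simps)
    moreover have "(x / a) powr d = x powr d / a powr d" by (simp add: powr_divide)
    ultimately show ?thesis using a by (simp add: field_simps)
  qed
  have "ennreal (x powr d) * indicator {0<..} x * (f x * indicator B x)
      \<le> ennreal (2 powr \<bar>d\<bar> * a powr d) * (f x * indicator B x)" for x
    using *[of x] by (cases "x \<in> B"; cases "x > 0") (auto intro!: mult_right_mono ennreal_leI)
  hence "(\<integral>\<^sup>+x\<in>B. f x \<partial>half_line_measure d) \<le> (\<integral>\<^sup>+x. ennreal (2 powr \<bar>d\<bar> * a powr d) * (f x * indicator B x) \<partial>lborel)"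
    by (subst nn_integral_half_line) (auto intro!: nn_integral_mono)
  thus "(\<integral>\<^sup>+x\<in>B. f x \<partial>half_line_measure d) \<le> ennreal (2 powr \<bar>d\<bar> * a powr d) * (\<integral>\<^sup>+x\<in>B. f x \<partial>lborel)"
    by (simp add: nn_integral_cmult)
  have *: "a powr d \<le> 2 powr \<bar>d\<bar> * x powr d \<and> 0 < x" if "x \<in> B" for x
  proof -
    have x: "x \<ge> a / 2" "x \<le> 2 * a" using that sub by auto
    have "(a / x) powr d \<le> 2 powr \<bar>d\<bar>" using x a by (intro powr_ratio_bound) (simp_all add: field_simps)
    moreover have "(a / x) powr d = a powr d / x powr d" by (simp add: powr_divide)
    ultimately show ?thesis using a x by (simp add: field_simps)
  qed
  have "ennreal (a powr d) * (f x * indicator B x) \<le> ennreal (2 powr \<bar>d\<bar>) * (ennreal (x powr d) * indicator {0<..} x * (f x * indicator B x))" for x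
    using *[of x] by (cases "x \<in> B") (auto simp flip: mult.assoc ennreal_mult intro!: mult_right_mono ennreal_leI)
  hence "(\<integral>\<^sup>+x. ennreal (a powr d) * (f x * indicator B x) \<partial>lborel) \<le> (\<integral>\<^sup>+x. ennreal (2 powr \<bar>d\<bar>) * (ennreal (x powr d) * indicator {0<..} x * (f x * indicator B x)) \<partial>lborel)"
    by (intro nn_integral_mono)
  thus "ennreal (a powr d) * (\<integral>\<^sup>+x\<in>B. f x \<partial>lborel) \<le> ennreal (2 powr \<bar>d\<bar>) * (\<integral>\<^sup>+x\<in>B. f x \<partial>half_line_measure d)"
    by (simp add: nn_integral_cmult nn_integral_half_line)
qed

section \<open>The local maximal function\<close>

lemma ennreal_cmult_cmult: "a \<ge> 0 \<Longrightarrow> b \<ge> 0 \<Longrightarrow> ennreal a * (ennreal b * u) = ennreal (a * b) * u"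
  by (simp add: ennreal_mult mult.assoc)

lemma ennreal_mult_divide_cancel: "c > 0 \<Longrightarrow> ennreal c * (a / ennreal c) = a"
  unfolding ennreal_times_divide by (subst mult.commute) (rule mult_divide_eq_ennreal; simp)

text \<open>
  An uncentred maximal function over intervals whose length is small compared with their distance
  to \<open>0\<close>. The bound \<open>5/4\<close> is chosen such that the fivefold enlargement of \<open>(a, b)\<close> stays within \<open>[a/2, 2a]\<close>, where
  power weights are harmless.
\<close>

definition local_max :: "(real \<Rightarrow> ennreal) \<Rightarrow> real \<Rightarrow> ennreal" where
  "local_max F x = (SUP (a, b)\<in>{(a, b). 0 < a \<and> a < x \<and> x < b \<and> b \<le> 5/4 * a}.
      (\<integral>\<^sup>+y\<in>{a<..<b}. F y \<partial>lborel) / ennreal (b - a))"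

lemma less_local_max_iff:
  "c < local_max F x \<longleftrightarrow>
     (\<exists>a b. 0 < a \<and> a < x \<and> x < b \<and> b \<le> 5/4 * a \<and> c < (\<integral>\<^sup>+y\<in>{a<..<b}. F y \<partial>lborel) / ennreal (b - a))"
  by (auto simp: local_max_def less_SUP_iff)

lemma average_le_local_max:
  assumes "0 < a" "a < x" "x < b" "b \<le> 5/4 * a"
  shows "(\<integral>\<^sup>+y\<in>{a<..<b}. F y \<partial>lborel) \<le> ennreal (b - a) * local_max F x"
proof -
  have "(\<integral>\<^sup>+y\<in>{a<..<b}. F y \<partial>lborel) / ennreal (b - a) \<le> local_max F x"
    unfolding local_max_def using assms by (intro SUP_upper2[of "(a, b)"]) auto
  from mult_left_mono[OF this, of "ennreal (b - a)"] show ?thesis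
    using ennreal_mult_divide_cancel[of "b - a"] assms by simp
qed

text \<open>
  This is the reason for taking uncentred intervals: a superlevel set is a union of open intervals.
\<close>

lemma open_local_max: "open {x. c < local_max F x}"
proof -
  define I where "I = {(a, b). 0 < a \<and> b \<le> 5/4 * a \<and> c < (\<integral>\<^sup>+y\<in>{a<..<b}. F y \<partial>lborel) / ennreal (b - a)}"
  have "{x. c < local_max F x} = (\<Union>i\<in>I. {fst i<..<snd i})"
  proof (intro set_eqI iffI)
    fix x assume "x \<in> {x. c < local_max F x}"
    then obtain a b where "(a, b) \<in> I" "a < x" "x < b" unfolding less_local_max_iff I_def by blast
    thus "x \<in> (\<Union>i\<in>I. {fst i<..<snd i})" by (intro UN_I[of "(a, b)"]) auto
  next
    fix x assume "x \<in> (\<Union>i\<in>I. {fst i<..<snd i})"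
    then obtain a b where "(a, b) \<in> I" "a < x" "x < b" by auto
    thus "x \<in> {x. c < local_max F x}" unfolding less_local_max_iff mem_Collect_eq I_def by blast
  qed
  thus ?thesis by (auto intro!: open_UN)
qed

lemma borel_measurable_local_max [measurable]: "local_max F \<in> borel_measurable borel"
  by (rule borel_measurableI_greater) (simp add: borel_open open_local_max)

lemma emeasure_countable_UN_le:
  assumes "countable I" and X[measurable]: "\<And>i. i \<in> I \<Longrightarrow> X i \<in> sets M"
  shows "emeasure M (\<Union>i\<in>I. X i) \<le> (\<integral>\<^sup>+i. emeasure M (X i) \<partial>count_space I)"
proof -
  have [measurable]: "(\<Union>i\<in>I. X i) \<in> sets M" using assms by (intro sets.countable_UN') auto
  have "emeasure M (\<Union>i\<in>I. X i) = (\<integral>\<^sup>+x. indicator (\<Union>i\<in>I. X i) x \<partial>M)" by simp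
  also have "\<dots> \<le> (\<integral>\<^sup>+x. \<integral>\<^sup>+i. indicator (X i) x \<partial>count_space I \<partial>M)"
  proof (intro nn_integral_mono)
    fix x
    show "indicator (\<Union>i\<in>I. X i) x \<le> (\<integral>\<^sup>+i. indicator (X i) x \<partial>count_space I :: ennreal)"
    proof (cases "x \<in> (\<Union>i\<in>I. X i)")
      case True
      then obtain i where "i \<in> I" "x \<in> X i" by auto
      thus ?thesis using nn_integral_ge_point[of i I "\<lambda>i. indicator (X i) x"] by (auto split: split_indicator)
    qed auto
  qed
  also have "\<dots> = (\<integral>\<^sup>+i. \<integral>\<^sup>+x. indicator (X i) x \<partial>M \<partial>count_space I)"
    by (intro nn_integral_count_space_nn_integral assms) auto
  also have "\<dots> = (\<integral>\<^sup>+i. emeasure M (X i) \<partial>count_space I)" by (intro nn_integral_cong) auto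
  finally show ?thesis .
qed

text \<open>
  Vitali's covering lemma selects disjoint intervals with large averages whose fivefold
  enlargements cover the superlevel set. Since the weight is essentially constant on each enlargement, passing between Lebesgue measure
  and the weight costs a constant only. The lemma needs bounded lengths, so the right endpoints are first
  restricted to \<open>b \<le> n\<close>.
\<close>

lemma local_max_weak_type:
  assumes F[measurable]: "F \<in> borel_measurable borel" and \<gamma>: "\<gamma> > 0"
  shows "emeasure (half_line_measure d) {x. ennreal \<gamma> < local_max F x}
     \<le> ennreal (5 * 4 powr \<bar>d\<bar> / \<gamma>) * (\<integral>\<^sup>+x. F x \<partial>half_line_measure d)"
proof -
  let ?P = "half_line_measure d"
  let ?I = "\<lambda>a b. (\<integral>\<^sup>+y\<in>{a<..<b}. F y \<partial>lborel)"
  define K where "K = (\<lambda>n::nat. {(a, b). 0 < a \<and> a < b \<and> b \<le> 5/4 * a \<and> b \<le> real n \<and> ennreal \<gamma> < ?I a b / ennreal (b - a)})"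
  define A where "A = (\<lambda>n. \<Union>(a, b)\<in>K n. {a<..<b})"
  have un: "{x. ennreal \<gamma> < local_max F x} = (\<Union>n. A n)"
  proof (intro set_eqI iffI)
    fix x assume "x \<in> {x. ennreal \<gamma> < local_max F x}"
    then obtain a b where ab: "0 < a" "a < x" "x < b" "b \<le> 5/4 * a" "ennreal \<gamma> < ?I a b / ennreal (b - a)"
      by (auto simp: less_local_max_iff)
    obtain n where "b \<le> real n" using real_arch_simple by blast
    with ab have "(a, b) \<in> K n" by (auto simp: K_def)
    with ab have "x \<in> A n" unfolding A_def by (intro UN_I[of "(a, b)"]) auto
    thus "x \<in> (\<Union>n. A n)" by blast
  next
    fix x assume "x \<in> (\<Union>n. A n)"
    then obtain n a b where "(a, b) \<in> K n" "a < x" "x < b" by (auto simp: A_def)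
    thus "x \<in> {x. ennreal \<gamma> < local_max F x}" unfolding less_local_max_iff mem_Collect_eq K_def by blast
  qed
  have openA: "open (A n)" for n by (auto simp: A_def intro!: open_UN)
  have bound: "emeasure ?P (A n) \<le> ennreal (5 * 4 powr \<bar>d\<bar> / \<gamma>) * (\<integral>\<^sup>+x. F x \<partial>?P)" for n
  proof -
    define c where "c = (\<lambda>(a, b). (a + b) / 2 :: real)"
    define r where "r = (\<lambda>(a, b). (b - a) / 2 :: real)"
    have ball: "ball (c i) (r i) = {fst i<..<snd i}" for i
      by (cases i) (auto simp: ball_eq_greaterThanLessThan c_def r_def field_simps)
    have r: "\<And>i. i \<in> K n \<Longrightarrow> 0 < r i \<and> r i \<le> real n" by (auto simp: K_def r_def)
    have "A n \<subseteq> (\<Union>i\<in>K n. ball (c i) (r i))" unfolding ball A_def by auto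
    from Vitali_covering_lemma_balls[OF this r] obtain J where J: "countable J" "J \<subseteq> K n"
      "pairwise (\<lambda>i j. disjnt (ball (c i) (r i)) (ball (c j) (r j))) J"
      "A n \<subseteq> (\<Union>i\<in>J. ball (c i) (5 * r i))" by blast
    have each: "emeasure ?P (ball (c i) (5 * r i)) \<le> ennreal (5 * 4 powr \<bar>d\<bar> / \<gamma>) * (\<integral>\<^sup>+x\<in>ball (c i) (r i). F x \<partial>?P)"
      if "i \<in> J" for i
    proof -
      obtain a b where i: "i = (a, b)" by (cases i)
      have ab: "0 < a" "a < b" "b \<le> 5/4 * a" "ennreal \<gamma> < ?I a b / ennreal (b - a)"
        using that J(2) by (auto simp: K_def i)
      have "ball (c i) (5 * r i) = {3 * a - 2 * b<..<3 * b - 2 * a}" "ball (c i) (r i) = {a<..<b}"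
      proof -
        have "(a + b) / 2 - 5 * ((b - a) / 2) = 3 * a - 2 * b" "(a + b) / 2 + 5 * ((b - a) / 2) = 3 * b - 2 * a"
          "(a + b) / 2 - (b - a) / 2 = a" "(a + b) / 2 + (b - a) / 2 = b" by argo+
        thus "ball (c i) (5 * r i) = {3 * a - 2 * b<..<3 * b - 2 * a}" "ball (c i) (r i) = {a<..<b}"
          by (simp_all only: ball_eq_greaterThanLessThan c_def r_def i prod.case)
      qed
      hence sub: "ball (c i) (5 * r i) \<subseteq> {a/2..2*a}" "ball (c i) (r i) \<subseteq> {a/2..2*a}"
        using ab by auto
      have "emeasure ?P (ball (c i) (5 * r i)) = (\<integral>\<^sup>+x\<in>ball (c i) (5 * r i). 1 \<partial>?P)" by simp
      also have "\<dots> \<le> ennreal (2 powr \<bar>d\<bar> * a powr d) * (\<integral>\<^sup>+x\<in>ball (c i) (5 * r i). 1 \<partial>lborel)"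
        by (rule half_line_comparison[OF ab(1) _ _ sub(1)]) auto
      also have "(\<integral>\<^sup>+x\<in>ball (c i) (5 * r i). 1 \<partial>lborel) = ennreal (5 * (b - a))"
        using ab by (simp add: ball_eq_greaterThanLessThan c_def r_def i) (simp add: field_simps)
      also have "ennreal (5 * (b - a)) \<le> ennreal (5 / \<gamma>) * ?I a b"
      proof -
        have "ennreal (b - a) * ennreal \<gamma> \<le> ennreal (b - a) * (?I a b / ennreal (b - a))"
          using ab(4) by (intro mult_left_mono) auto
        also have "\<dots> = ?I a b" using ab by (intro ennreal_mult_divide_cancel) auto
        finally have "ennreal \<gamma> * ennreal (b - a) \<le> ?I a b" by (simp add: mult.commute)
        from mult_left_mono[OF this, of "ennreal (5 / \<gamma>)"] show ?thesis
          using \<gamma> ab by (simp add: ennreal_cmult_cmult flip: ennreal_mult)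
      qed
      also have "ennreal (2 powr \<bar>d\<bar> * a powr d) * (ennreal (5 / \<gamma>) * ?I a b)
          = ennreal (2 powr \<bar>d\<bar> * 5 / \<gamma>) * (ennreal (a powr d) * ?I a b)"
        using \<gamma> by (simp add: ennreal_cmult_cmult) (simp add: mult_ac)?
      also have "\<dots> \<le> ennreal (2 powr \<bar>d\<bar> * 5 / \<gamma>) * (ennreal (2 powr \<bar>d\<bar>) * (\<integral>\<^sup>+x\<in>{a<..<b}. F x \<partial>?P))"
        by (intro mult_left_mono half_line_comparison) (use ab in auto)
      also have "\<dots> = ennreal (5 * 4 powr \<bar>d\<bar> / \<gamma>) * (\<integral>\<^sup>+x\<in>{a<..<b}. F x \<partial>?P)"
        using \<gamma> powr_mult[of 2 2 "\<bar>d\<bar>"] by (simp add: ennreal_cmult_cmult) (simp add: mult_ac)?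
      finally show ?thesis unfolding ball by (simp add: i mult_left_mono)
    qed
    have "emeasure ?P (A n) \<le> emeasure ?P (\<Union>i\<in>J. ball (c i) (5 * r i))"
      by (intro emeasure_mono J(4)) (auto intro!: borel_open)
    also have "\<dots> \<le> (\<integral>\<^sup>+i. emeasure ?P (ball (c i) (5 * r i)) \<partial>count_space J)"
      by (intro emeasure_countable_UN_le J(1)) auto
    also have "\<dots> \<le> (\<integral>\<^sup>+i. ennreal (5 * 4 powr \<bar>d\<bar> / \<gamma>) * (\<integral>\<^sup>+x\<in>ball (c i) (r i). F x \<partial>?P) \<partial>count_space J)"
      by (intro nn_integral_mono each) simp
    also have "\<dots> = ennreal (5 * 4 powr \<bar>d\<bar> / \<gamma>) * (\<integral>\<^sup>+i. (\<integral>\<^sup>+x\<in>ball (c i) (r i). F x \<partial>?P) \<partial>count_space J)"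
      by (rule nn_integral_cmult) simp
    also have "(\<integral>\<^sup>+i. (\<integral>\<^sup>+x\<in>ball (c i) (r i). F x \<partial>?P) \<partial>count_space J)
        = (\<integral>\<^sup>+i. emeasure (density ?P F) (ball (c i) (r i)) \<partial>count_space J)"
      by (intro nn_integral_cong) (subst emeasure_density; simp)
    also have "\<dots> = emeasure (density ?P F) (\<Union>i\<in>J. ball (c i) (r i))"
      using J(1,3) by (intro emeasure_UN_countable[symmetric])
        (auto simp: disjoint_family_on_def pairwise_def disjnt_def)
    also have "\<dots> \<le> emeasure (density ?P F) UNIV" by (intro emeasure_mono) auto
    also have "\<dots> = (\<integral>\<^sup>+x. F x \<partial>?P)" by (subst emeasure_density) auto
    finally show ?thesis by (simp add: mult_left_mono)
  qed
  have "K m \<subseteq> K n" if "m \<le> n" for m n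
    using of_nat_mono[OF that, where 'a=real] unfolding K_def by (auto intro: order_trans)
  hence "incseq A" unfolding A_def incseq_def by (intro allI impI UN_mono) auto
  hence "emeasure ?P (\<Union>n. A n) = (SUP n. emeasure ?P (A n))"
    using openA by (intro SUP_emeasure_incseq[symmetric]) (auto intro: borel_open)
  also have "\<dots> \<le> ennreal (5 * 4 powr \<bar>d\<bar> / \<gamma>) * (\<integral>\<^sup>+x. F x \<partial>?P)"
    by (rule SUP_least) (rule bound)
  finally show ?thesis unfolding un .
qed

text \<open>
  The identity \<open>u\<^sup>q = \<integral>\<^sub>0\<^sup>u q \<gamma>\<^bsup>q-1\<^esup> d\<gamma>\<close>, valid also for \<open>u = \<infinity>\<close>.
\<close>

lemma epowr_layer_cake:
  assumes q: "q > 0"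
  shows "(\<integral>\<^sup>+\<gamma>. ennreal (q * \<gamma> powr (q - 1)) * indicator {0<..} \<gamma> * indicator {\<gamma>. ennreal \<gamma> < u} \<gamma> \<partial>lborel) = epowr u q"
proof -
  have fin: "(\<integral>\<^sup>+\<gamma>. ennreal (q * \<gamma> powr (q - 1)) * indicator {0<..<r} \<gamma> \<partial>lborel) = ennreal (r powr q)" if r: "r \<ge> 0" for r
  proof -
    have "((\<lambda>x. x powr (q - 1)) has_integral (r powr (q - 1 + 1) / (q - 1 + 1))) {0..r}"
      by (rule has_integral_powr_from_0) (use q r in auto)
    from has_integral_mult_right[OF this, of q] q
    have "((\<lambda>x. q * x powr (q - 1)) has_integral (r powr q)) {0..r}" by simp
    hence "(\<integral>\<^sup>+x. ennreal (q * x powr (q - 1)) * indicator {0..r} x \<partial>lborel) = ennreal (r powr q)"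
      by (intro nn_integral_has_integral_lebesgue') (use q in auto)
    moreover have "(\<integral>\<^sup>+x. ennreal (q * x powr (q - 1)) * indicator {0..r} x \<partial>lborel) =
        (\<integral>\<^sup>+\<gamma>. ennreal (q * \<gamma> powr (q - 1)) * indicator {0<..<r} \<gamma> \<partial>lborel)"
      using AE_lborel_singleton[of 0] AE_lborel_singleton[of r]
      by (intro nn_integral_cong_AE) (auto split: split_indicator)
    ultimately show ?thesis by simp
  qed
  show ?thesis
  proof (cases u)
    case (real r)
    have "indicator {0<..} \<gamma> * indicator {\<gamma>. ennreal \<gamma> < u} \<gamma> = (indicator {0<..<r} \<gamma> :: ennreal)" for \<gamma>
      using real by (auto split: split_indicator simp: ennreal_less_iff)
    hence "ennreal (q * \<gamma> powr (q - 1)) * indicator {0<..} \<gamma> * indicator {\<gamma>. ennreal \<gamma> < u} \<gamma> =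
       ennreal (q * \<gamma> powr (q - 1)) * indicator {0<..<r} \<gamma>" for \<gamma> by (simp only: mult.assoc)
    thus ?thesis using fin[OF real(1)] real by simp
  next
    case top
    have ge: "of_nat n \<le> (\<integral>\<^sup>+\<gamma>. ennreal (q * \<gamma> powr (q - 1)) * indicator {0<..} \<gamma> * indicator {\<gamma>. ennreal \<gamma> < u} \<gamma> \<partial>lborel)" for n
    proof -
      define r where "r = real n powr (1 / q)"
      have "r powr q = real n" using q by (simp add: r_def powr_powr)
      hence "of_nat n = (\<integral>\<^sup>+\<gamma>. ennreal (q * \<gamma> powr (q - 1)) * indicator {0<..<r} \<gamma> \<partial>lborel)"
        using fin[of r] by (simp add: r_def ennreal_of_nat_eq_real_of_nat)
      also have "\<dots> \<le> (\<integral>\<^sup>+\<gamma>. ennreal (q * \<gamma> powr (q - 1)) * indicator {0<..} \<gamma> * indicator {\<gamma>. ennreal \<gamma> < u} \<gamma> \<partial>lborel)"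
        by (intro nn_integral_mono) (auto split: split_indicator simp: top)
      finally show ?thesis .
    qed
    have "(\<integral>\<^sup>+\<gamma>. ennreal (q * \<gamma> powr (q - 1)) * indicator {0<..} \<gamma> * indicator {\<gamma>. ennreal \<gamma> < u} \<gamma> \<partial>lborel) = top"
      (is "?I = top")
    proof (rule ccontr)
      assume "?I \<noteq> top"
      then obtain n where "?I < of_nat n" using ennreal_Ex_less_of_nat less_top by blast
      with ge[of n] show False by simp
    qed
    thus ?thesis by (simp add: top)
  qed
qed

text \<open>
  The part of \<open>F\<close> below \<open>\<gamma>/2\<close> contributes at most \<open>\<gamma>/2\<close> to every average.
\<close>

lemma local_max_truncation:
  assumes [measurable]: "F \<in> borel_measurable borel" and \<gamma>: "\<gamma> > 0" and x: "ennreal \<gamma> < local_max F x"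
  shows "ennreal (\<gamma> / 2) < local_max (\<lambda>y. F y * indicator {y. ennreal (\<gamma> / 2) < F y} y) x"
proof -
  let ?F1 = "\<lambda>y. F y * indicator {y. ennreal (\<gamma> / 2) < F y} y"
  obtain a b where ab: "0 < a" "a < x" "x < b" "b \<le> 5/4 * a" "ennreal \<gamma> < (\<integral>\<^sup>+y\<in>{a<..<b}. F y \<partial>lborel) / ennreal (b - a)"
    using x unfolding less_local_max_iff by blast
  have "(\<integral>\<^sup>+y\<in>{a<..<b}. F y \<partial>lborel) \<le> (\<integral>\<^sup>+y. ?F1 y * indicator {a<..<b} y + ennreal (\<gamma> / 2) * indicator {a<..<b} y \<partial>lborel)"
    by (intro nn_integral_mono) (auto split: split_indicator simp: not_less)
  also have "\<dots> = (\<integral>\<^sup>+y\<in>{a<..<b}. ?F1 y \<partial>lborel) + ennreal (\<gamma> / 2) * ennreal (b - a)"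
    using ab by (subst nn_integral_add) (auto simp: nn_integral_cmult)
  finally have "(\<integral>\<^sup>+y\<in>{a<..<b}. F y \<partial>lborel) / ennreal (b - a) \<le> ((\<integral>\<^sup>+y\<in>{a<..<b}. ?F1 y \<partial>lborel) + ennreal (\<gamma> / 2) * ennreal (b - a)) / ennreal (b - a)"
    by (rule divide_right_mono_ennreal)
  also have "\<dots> = (\<integral>\<^sup>+y\<in>{a<..<b}. ?F1 y \<partial>lborel) / ennreal (b - a) + ennreal (\<gamma> / 2)"
    unfolding add_divide_distrib_ennreal using ab by (subst mult_divide_eq_ennreal) auto
  finally have "ennreal \<gamma> < (\<integral>\<^sup>+y\<in>{a<..<b}. ?F1 y \<partial>lborel) / ennreal (b - a) + ennreal (\<gamma> / 2)" using ab(5) by simp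
  hence "ennreal (\<gamma> / 2) + ennreal (\<gamma> / 2) < (\<integral>\<^sup>+y\<in>{a<..<b}. ?F1 y \<partial>lborel) / ennreal (b - a) + ennreal (\<gamma> / 2)"
    using \<gamma> by (simp flip: ennreal_plus)
  hence "ennreal (\<gamma> / 2) < (\<integral>\<^sup>+y\<in>{a<..<b}. ?F1 y \<partial>lborel) / ennreal (b - a)"
    by (meson add_right_mono leD leI)
  thus ?thesis unfolding less_local_max_iff using ab by blast
qed

text \<open>
  Interpolation between the weak type (1,1) and the trivial bound on bounded functions: the weak
  inequality is applied at each level \<open>\<gamma>\<close> to the part of \<open>F\<close> above \<open>\<gamma>/2\<close>, and the result is integrated over the
  levels, once with the exponent \<open>p\<close> for the maximal function and once with \<open>p - 1\<close> for \<open>F\<close>.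
\<close>

lemma local_max_strong_type:
  assumes F[measurable]: "F \<in> borel_measurable borel" and p: "p > 1"
  shows "(\<integral>\<^sup>+x. epowr (local_max F x) p \<partial>half_line_measure d)
     \<le> ennreal (10 * 4 powr \<bar>d\<bar> * (p / (p - 1)) * 2 powr (p - 1)) * (\<integral>\<^sup>+x. epowr (F x) p \<partial>half_line_measure d)"
proof -
  let ?P = "half_line_measure d"
  let ?w = "\<lambda>x. ennreal (x powr d) * indicator {0<..} x"
  define B where "B = 10 * 4 powr \<bar>d\<bar>"
  have B: "B \<ge> 0" by (simp add: B_def)
  let ?k = "\<lambda>\<gamma>. ennreal (p * \<gamma> powr (p - 1)) * indicator {0<..} \<gamma>"
  let ?h = "\<lambda>\<gamma>. ennreal ((p - 1) * \<gamma> powr (p - 1 - 1)) * indicator {0<..} \<gamma>"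
  have "(\<integral>\<^sup>+x. epowr (local_max F x) p \<partial>?P) = (\<integral>\<^sup>+x. ?w x * (\<integral>\<^sup>+\<gamma>. ?k \<gamma> * indicator {\<gamma>. ennreal \<gamma> < local_max F x} \<gamma> \<partial>lborel) \<partial>lborel)"
    using p by (subst nn_integral_half_line) (auto simp: epowr_layer_cake)
  also have "\<dots> = (\<integral>\<^sup>+x. (\<integral>\<^sup>+\<gamma>. ?w x * (?k \<gamma> * indicator {\<gamma>. ennreal \<gamma> < local_max F x} \<gamma>) \<partial>lborel) \<partial>lborel)"
    by (intro nn_integral_cong nn_integral_cmult[symmetric]) measurable
  also have "\<dots> = (\<integral>\<^sup>+\<gamma>. (\<integral>\<^sup>+x. ?w x * (?k \<gamma> * indicator {\<gamma>. ennreal \<gamma> < local_max F x} \<gamma>) \<partial>lborel) \<partial>lborel)"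
    by (rule lborel_pair.Fubini') measurable
  also have "\<dots> = (\<integral>\<^sup>+\<gamma>. ?k \<gamma> * emeasure ?P {x. ennreal \<gamma> < local_max F x} \<partial>lborel)"
  proof (intro nn_integral_cong)
    fix \<gamma> :: real
    have "(\<integral>\<^sup>+x. ?w x * (?k \<gamma> * indicator {\<gamma>. ennreal \<gamma> < local_max F x} \<gamma>) \<partial>lborel) =
      (\<integral>\<^sup>+x. ?k \<gamma> * (?w x * indicator {x. ennreal \<gamma> < local_max F x} x) \<partial>lborel)"
      by (intro nn_integral_cong) (auto simp: mult_ac split: split_indicator)
    also have "\<dots> = ?k \<gamma> * emeasure ?P {x. ennreal \<gamma> < local_max F x}"
      by (subst emeasure_half_line) (auto intro!: nn_integral_cmult)
    finally show "(\<integral>\<^sup>+x. ?w x * (?k \<gamma> * indicator {\<gamma>. ennreal \<gamma> < local_max F x} \<gamma>) \<partial>lborel) = ?k \<gamma> * emeasure ?P {x. ennreal \<gamma> < local_max F x}" .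
  qed
  also have "\<dots> \<le> (\<integral>\<^sup>+\<gamma>. ennreal (B * (p / (p - 1))) * (?h \<gamma> * (\<integral>\<^sup>+x. F x * indicator {x. ennreal (\<gamma> / 2) < F x} x \<partial>?P)) \<partial>lborel)"
  proof (intro nn_integral_mono)
    fix \<gamma> :: real
    show "?k \<gamma> * emeasure ?P {x. ennreal \<gamma> < local_max F x} \<le> ennreal (B * (p / (p - 1))) * (?h \<gamma> * (\<integral>\<^sup>+x. F x * indicator {x. ennreal (\<gamma> / 2) < F x} x \<partial>?P))"
    proof (cases "\<gamma> > 0")
      case True
      let ?F1 = "\<lambda>y. F y * indicator {y. ennreal (\<gamma> / 2) < F y} y"
      have "emeasure ?P {x. ennreal \<gamma> < local_max F x} \<le> emeasure ?P {x. ennreal (\<gamma> / 2) < local_max ?F1 x}"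
        using True by (intro emeasure_mono) (auto intro!: local_max_truncation)
      also have "\<dots> \<le> ennreal (5 * 4 powr \<bar>d\<bar> / (\<gamma> / 2)) * (\<integral>\<^sup>+x. ?F1 x \<partial>?P)"
        by (rule local_max_weak_type) (use True in auto)
      also have "5 * 4 powr \<bar>d\<bar> / (\<gamma> / 2) = B / \<gamma>" by (simp add: B_def)
      finally have "?k \<gamma> * emeasure ?P {x. ennreal \<gamma> < local_max F x} \<le> ennreal (p * \<gamma> powr (p - 1)) * (ennreal (B / \<gamma>) * (\<integral>\<^sup>+x. ?F1 x \<partial>?P))"
        using True by (simp add: mult_left_mono)
      also have "\<dots> = ennreal (p * \<gamma> powr (p - 1) * (B / \<gamma>)) * (\<integral>\<^sup>+x. ?F1 x \<partial>?P)"
        by (rule ennreal_cmult_cmult) (use p B True in auto)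
      also have "p * \<gamma> powr (p - 1) * (B / \<gamma>) = B * (p / (p - 1)) * ((p - 1) * \<gamma> powr (p - 1 - 1))"
        using p True by (simp add: powr_diff power2_eq_square)
      also have "ennreal (B * (p / (p - 1)) * ((p - 1) * \<gamma> powr (p - 1 - 1))) * (\<integral>\<^sup>+x. ?F1 x \<partial>?P)
         = ennreal (B * (p / (p - 1))) * (ennreal ((p - 1) * \<gamma> powr (p - 1 - 1)) * (\<integral>\<^sup>+x. ?F1 x \<partial>?P))"
        by (rule ennreal_cmult_cmult[symmetric]) (use p B in auto)
      finally show ?thesis using True by simp
    qed auto
  qed
  also have "\<dots> = ennreal (B * (p / (p - 1))) * (\<integral>\<^sup>+\<gamma>. (\<integral>\<^sup>+x. ?h \<gamma> * (?w x * (F x * indicator {x. ennreal (\<gamma> / 2) < F x} x)) \<partial>lborel) \<partial>lborel)"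
    by (subst nn_integral_cmult) (auto simp: nn_integral_half_line intro!: arg_cong2[where f="(*)"] nn_integral_cong nn_integral_cmult[symmetric])
  also have "(\<integral>\<^sup>+\<gamma>. (\<integral>\<^sup>+x. ?h \<gamma> * (?w x * (F x * indicator {x. ennreal (\<gamma> / 2) < F x} x)) \<partial>lborel) \<partial>lborel)
      = (\<integral>\<^sup>+x. (\<integral>\<^sup>+\<gamma>. ?h \<gamma> * (?w x * (F x * indicator {x. ennreal (\<gamma> / 2) < F x} x)) \<partial>lborel) \<partial>lborel)"
    by (rule lborel_pair.Fubini'[symmetric]) measurable
  also have "\<dots> = (\<integral>\<^sup>+x. ?w x * (ennreal (2 powr (p - 1)) * epowr (F x) p) \<partial>lborel)"
  proof (intro nn_integral_cong)
    fix x :: real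
    have "ennreal (\<gamma> / 2) < F x \<longleftrightarrow> ennreal \<gamma> < ennreal 2 * F x" if "\<gamma> > 0" for \<gamma>
    proof (cases "F x")
      case (real r)
      have "ennreal 2 * ennreal r = ennreal (2 * r)" using real(1) by (intro ennreal_mult[symmetric]) auto
      thus ?thesis unfolding real(2) using that by (simp only: ennreal_less_iff less_imp_le half_gt_zero_iff) (auto simp: ennreal_less_iff)
    qed (simp add: ennreal_mult_top)
    hence "(\<integral>\<^sup>+\<gamma>. ?h \<gamma> * (?w x * (F x * indicator {x. ennreal (\<gamma> / 2) < F x} x)) \<partial>lborel)
      = (\<integral>\<^sup>+\<gamma>. (?w x * F x) * (?h \<gamma> * indicator {\<gamma>. ennreal \<gamma> < ennreal 2 * F x} \<gamma>) \<partial>lborel)"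
      by (intro nn_integral_cong) (auto simp: mult_ac split: split_indicator)
    also have "\<dots> = (?w x * F x) * (\<integral>\<^sup>+\<gamma>. ?h \<gamma> * indicator {\<gamma>. ennreal \<gamma> < ennreal 2 * F x} \<gamma> \<partial>lborel)"
      by (rule nn_integral_cmult) measurable
    also have "(\<integral>\<^sup>+\<gamma>. ?h \<gamma> * indicator {\<gamma>. ennreal \<gamma> < ennreal 2 * F x} \<gamma> \<partial>lborel) = epowr (ennreal 2 * F x) (p - 1)"
      by (rule epowr_layer_cake) (use p in auto)
    also have "\<dots> = ennreal (2 powr (p - 1)) * epowr (F x) (p - 1)" by (rule epowr_cmult) auto
    also have "(?w x * F x) * (ennreal (2 powr (p - 1)) * epowr (F x) (p - 1)) = ?w x * (ennreal (2 powr (p - 1)) * (epowr (F x) (p - 1) * F x))"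
      by (simp add: mult_ac)
    also have "epowr (F x) (p - 1) * F x = epowr (F x) p" by (simp add: epowr_times_self)
    finally show "(\<integral>\<^sup>+\<gamma>. ?h \<gamma> * (?w x * (F x * indicator {x. ennreal (\<gamma> / 2) < F x} x)) \<partial>lborel) = ?w x * (ennreal (2 powr (p - 1)) * epowr (F x) p)" .
  qed
  also have "\<dots> = (\<integral>\<^sup>+x. ennreal (2 powr (p - 1)) * epowr (F x) p \<partial>?P)" by (subst nn_integral_half_line) auto
  also have "\<dots> = ennreal (2 powr (p - 1)) * (\<integral>\<^sup>+x. epowr (F x) p \<partial>?P)" by (rule nn_integral_cmult) simp
  also have "ennreal (B * (p / (p - 1))) * (ennreal (2 powr (p - 1)) * (\<integral>\<^sup>+x. epowr (F x) p \<partial>?P)) = ennreal (B * (p / (p - 1)) * 2 powr (p - 1)) * (\<integral>\<^sup>+x. epowr (F x) p \<partial>?P)"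
    by (rule ennreal_cmult_cmult) (use p B in auto)
  finally show ?thesis by (simp add: B_def)
qed

section \<open>Functionals compatible with dilations\<close>

lemma nn_integral_half_line_dilate:
  assumes f[measurable]: "f \<in> borel_measurable borel" and a: "a > 0"
  shows "(\<integral>\<^sup>+x. f (a * x) \<partial>half_line_measure d) = ennreal (a powr (- d - 1)) * (\<integral>\<^sup>+x. f x \<partial>half_line_measure d)"
proof -
  have "(\<integral>\<^sup>+x. f x \<partial>half_line_measure d) = ennreal a * (\<integral>\<^sup>+x. ennreal ((a * x) powr d) * indicator {0<..} (a * x) * f (a * x) \<partial>lborel)"
    using nn_integral_real_affine[of "\<lambda>x. ennreal (x powr d) * indicator {0<..} x * f x" a 0] a
    by (simp add: nn_integral_half_line)
  also have "(\<integral>\<^sup>+x. ennreal ((a * x) powr d) * indicator {0<..} (a * x) * f (a * x) \<partial>lborel)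
     = (\<integral>\<^sup>+x. ennreal (a powr d) * (ennreal (x powr d) * indicator {0<..} x * f (a * x)) \<partial>lborel)"
    using a by (intro nn_integral_cong) (auto simp: powr_mult ennreal_mult zero_less_mult_iff mult.assoc split: split_indicator)
  also have "\<dots> = ennreal (a powr d) * (\<integral>\<^sup>+x. f (a * x) \<partial>half_line_measure d)"
    by (subst nn_integral_cmult) (auto simp: nn_integral_half_line)
  finally have "(\<integral>\<^sup>+x. f x \<partial>half_line_measure d) = ennreal (a powr (d + 1)) * (\<integral>\<^sup>+x. f (a * x) \<partial>half_line_measure d)"
    using a by (simp add: ennreal_cmult_cmult powr_add mult.commute)
  moreover have "a powr (- d - 1) * a powr (d + 1) = 1" using a by (simp flip: powr_add)
  ultimately show ?thesis using a by (simp add: ennreal_cmult_cmult)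
qed

definition dilated_sum :: "real \<Rightarrow> real \<Rightarrow> (real \<Rightarrow> ennreal) \<Rightarrow> real \<Rightarrow> ennreal" where
  "dilated_sum b a g x = (\<Sum>j. ennreal (b ^ j) * g (a ^ j * x))"

lemma borel_measurable_dilated_sum [measurable]:
  assumes [measurable]: "g \<in> borel_measurable borel"
  shows "dilated_sum b a g \<in> borel_measurable borel"
  unfolding dilated_sum_def by measurable

lemma suminf_ennreal_geometric:
  fixes r :: real
  assumes "0 \<le> r" "r < 1"
  shows "(\<Sum>j. ennreal (r ^ j)) = ennreal (1 / (1 - r))"
proof -
  have "(\<lambda>j. r ^ j) sums (1 / (1 - r))" using assms by (intro geometric_sums) auto
  thus ?thesis using assms by (subst suminf_ennreal2) (auto simp: sums_iff)
qed

text \<open>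
  What the \<open>p\<close>-th power of the norm of \<open>L\<^sup>p(x\<^sup>d dx)\<close> and of weak \<open>L\<^sup>p(x\<^sup>d dx)\<close> have in common. Countable suprema
  replace sums here, because for them both functionals are subadditive without any loss, even for the weak norm
  with \<open>p = 1\<close>, where the triangle inequality fails.
\<close>

locale dilation_functional =
  fixes \<Phi> :: "(real \<Rightarrow> ennreal) \<Rightarrow> ennreal" and p d :: real
  assumes p_pos: "p > 0"
    and mono: "\<And>g h. g \<in> borel_measurable borel \<Longrightarrow> h \<in> borel_measurable borel \<Longrightarrow>
          (\<And>x. x > 0 \<Longrightarrow> g x \<le> h x) \<Longrightarrow> \<Phi> g \<le> \<Phi> h"
    and max_le: "\<And>g h. g \<in> borel_measurable borel \<Longrightarrow> h \<in> borel_measurable borel \<Longrightarrow>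
          \<Phi> (\<lambda>x. max (g x) (h x)) \<le> \<Phi> g + \<Phi> h"
    and SUP_le: "\<And>g :: nat \<Rightarrow> real \<Rightarrow> ennreal. (\<And>j. g j \<in> borel_measurable borel) \<Longrightarrow>
          \<Phi> (\<lambda>x. SUP j. g j x) \<le> (\<Sum>j. \<Phi> (g j))"
    and dilate_le: "\<And>g a c. g \<in> borel_measurable borel \<Longrightarrow> a > 0 \<Longrightarrow> c > 0 \<Longrightarrow>
          \<Phi> (\<lambda>x. ennreal c * g (a * x)) \<le> ennreal (c powr p * a powr (- d - 1)) * \<Phi> g"
begin

lemma cmult_le:
  assumes "g \<in> borel_measurable borel" "c > 0"
  shows "\<Phi> (\<lambda>x. ennreal c * g x) \<le> ennreal (c powr p) * \<Phi> g"
  using dilate_le[OF assms(1), of 1 c] assms(2) by simp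

lemma add_le:
  assumes [measurable]: "g \<in> borel_measurable borel" "h \<in> borel_measurable borel"
  shows "\<Phi> (\<lambda>x. g x + h x) \<le> ennreal (2 powr p) * (\<Phi> g + \<Phi> h)"
proof -
  have "g x + h x \<le> ennreal 2 * max (g x) (h x)" for x
  proof -
    have "g x + h x \<le> max (g x) (h x) + max (g x) (h x)" by (intro add_mono) auto
    thus ?thesis by (simp add: mult_2)
  qed
  hence "\<Phi> (\<lambda>x. g x + h x) \<le> \<Phi> (\<lambda>x. ennreal 2 * max (g x) (h x))" by (intro mono) auto
  also have "\<dots> \<le> ennreal (2 powr p) * \<Phi> (\<lambda>x. max (g x) (h x))" by (intro cmult_le) auto
  also have "\<dots> \<le> ennreal (2 powr p) * (\<Phi> g + \<Phi> h)" by (intro mult_left_mono max_le assms) auto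
  finally show ?thesis .
qed

text \<open>
  Since the weights decrease geometrically with some room to spare, the factor \<open>\<eta>\<^sup>j\<close> can be
  inserted, and a sum of terms \<open>\<eta>\<^bsup>-j\<^esup> h\<^sub>j\<close> is at most a constant times the supremum of the \<open>h\<^sub>j\<close>. The \<open>j\<close>-th dilate then contributes
  \<open>((\<eta>b)\<^sup>p a\<^bsup>-d-1\<^esup>)\<^sup>j\<close>, and \<open>\<eta>\<close> is chosen such that this is \<open>\<rho>\<^bsup>j/2\<^esup>\<close>, where \<open>\<rho> < 1\<close> is
  the ratio without \<open>\<eta>\<close>.
\<close>

lemma dilated_sum_le:
  assumes ab: "a > 0" "b > 0" and lt: "b powr p * a powr (- d - 1) < 1"
  shows "\<exists>C\<ge>0. \<forall>g\<in>borel_measurable borel. \<Phi> (dilated_sum b a g) \<le> ennreal C * \<Phi> g"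
proof -
  define \<rho> where "\<rho> = b powr p * a powr (- d - 1)"
  have \<rho>: "\<rho> > 0" "\<rho> < 1" using ab lt by (auto simp: \<rho>_def)
  define \<eta> where "\<eta> = \<rho> powr (- 1 / (2 * p))"
  have \<eta>p: "\<eta> powr p = \<rho> powr (- 1 / 2)" using p_pos by (simp add: \<eta>_def powr_powr)
  have \<eta>: "\<eta> > 1" unfolding \<eta>_def using powr_less_mono2_neg[of "- 1 / (2 * p)" \<rho> 1] \<rho> p_pos by simp
  define r where "r = \<rho> powr (1 / 2)"
  have r: "0 < r" "r < 1" using \<rho> powr_less_mono2[of "1/2" \<rho> 1] by (auto simp: r_def)
  have r_eq: "(\<eta> * b) powr p * a powr (- d - 1) = r"
  proof -
    have "(\<eta> * b) powr p * a powr (- d - 1) = \<rho> powr (- 1 / 2) * \<rho> powr 1"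
      using ab \<eta> \<eta>p \<rho> by (simp add: powr_mult) (simp add: \<rho>_def)
    also have "\<dots> = r" by (simp only: powr_add[symmetric] r_def) simp
    finally show ?thesis .
  qed
  define K where "K = 1 / (1 - 1 / \<eta>)"
  have K: "K > 0" using \<eta> by (simp add: K_def)
  have "\<Phi> (dilated_sum b a g) \<le> ennreal (K powr p * (1 / (1 - r))) * \<Phi> g"
    if [measurable]: "g \<in> borel_measurable borel" for g
  proof -
    define h where "h = (\<lambda>j x. ennreal ((\<eta> * b) ^ j) * g (a ^ j * x))"
    have [measurable]: "h j \<in> borel_measurable borel" for j by (simp add: h_def)
    have "dilated_sum b a g x \<le> ennreal K * (SUP j. h j x)" for x
    proof -
      have "dilated_sum b a g x = (\<Sum>j. ennreal ((1 / \<eta>) ^ j) * h j x)"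
        unfolding dilated_sum_def h_def using ab \<eta>
        by (intro suminf_cong) (simp add: ennreal_cmult_cmult power_mult_distrib power_divide)
      also have "\<dots> \<le> (\<Sum>j. ennreal ((1 / \<eta>) ^ j) * (SUP j. h j x))"
        by (intro suminf_le mult_left_mono SUP_upper) auto
      also have "\<dots> = ennreal K * (SUP j. h j x)"
        unfolding ennreal_suminf_multc K_def using \<eta> by (subst suminf_ennreal_geometric) auto
      finally show ?thesis .
    qed
    hence "\<Phi> (dilated_sum b a g) \<le> \<Phi> (\<lambda>x. ennreal K * (SUP j. h j x))" by (intro mono) auto
    also have "\<dots> \<le> ennreal (K powr p) * \<Phi> (\<lambda>x. SUP j. h j x)" by (intro cmult_le K) auto
    also have "\<dots> \<le> ennreal (K powr p) * (\<Sum>j. \<Phi> (h j))" by (intro mult_left_mono SUP_le) auto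
    also have "(\<Sum>j. \<Phi> (h j)) \<le> (\<Sum>j. ennreal (r ^ j) * \<Phi> g)"
    proof (intro suminf_le)
      fix j
      have "((\<eta> * b) ^ j) powr p * (a ^ j) powr (- d - 1) = r ^ j"
        using ab \<eta> unfolding r_eq[symmetric]
        by (simp add: powr_powr powr_mult mult_ac flip: powr_realpow)
      moreover have "\<Phi> (h j) \<le> ennreal (((\<eta> * b) ^ j) powr p * (a ^ j) powr (- d - 1)) * \<Phi> g"
        unfolding h_def using ab \<eta> by (intro dilate_le) auto
      ultimately show "\<Phi> (h j) \<le> ennreal (r ^ j) * \<Phi> g" by simp
    qed auto
    also have "\<dots> = ennreal (1 / (1 - r)) * \<Phi> g"
      unfolding ennreal_suminf_multc using r by (subst suminf_ennreal_geometric) auto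
    also have "ennreal (K powr p) * (ennreal (1 / (1 - r)) * \<Phi> g) = ennreal (K powr p * (1 / (1 - r))) * \<Phi> g"
      by (rule ennreal_cmult_cmult) (use r in auto)
    finally show ?thesis by (simp add: mult_left_mono)
  qed
  moreover have "K powr p * (1 / (1 - r)) \<ge> 0" using r by simp
  ultimately show ?thesis by blast
qed

end

definition strong_functional :: "real \<Rightarrow> real \<Rightarrow> (real \<Rightarrow> ennreal) \<Rightarrow> ennreal" where
  "strong_functional p d g = (\<integral>\<^sup>+x. epowr (g x) p \<partial>half_line_measure d)"

text \<open>
  The \<open>p\<close>-th power of the quasinorm of weak \<open>L\<^sup>p(x\<^sup>d dx)\<close>.
\<close>

definition weak_functional :: "real \<Rightarrow> real \<Rightarrow> (real \<Rightarrow> ennreal) \<Rightarrow> ennreal" where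
  "weak_functional p d g = (SUP \<gamma>\<in>{0<..}. ennreal (\<gamma> powr p) * emeasure (half_line_measure d) {x. ennreal \<gamma> < g x})"

lemma nn_integral_half_line_mono:
  assumes [measurable]: "f \<in> borel_measurable borel" "g \<in> borel_measurable borel"
    and "\<And>x. x > 0 \<Longrightarrow> f x \<le> g x"
  shows "(\<integral>\<^sup>+x. f x \<partial>half_line_measure d) \<le> (\<integral>\<^sup>+x. g x \<partial>half_line_measure d)"
  by (simp add: nn_integral_half_line) (intro nn_integral_mono, auto split: split_indicator intro!: mult_left_mono assms)

lemma emeasure_half_line_mono:
  assumes "A \<in> sets borel" "B \<in> sets borel" and "\<And>x. x > 0 \<Longrightarrow> x \<in> A \<Longrightarrow> x \<in> B"
  shows "emeasure (half_line_measure d) A \<le> emeasure (half_line_measure d) B"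
  using nn_integral_half_line_mono[of "indicator A" "indicator B" d] assms by (auto split: split_indicator)

lemma epowr_SUP_le:
  assumes "p > 0"
  shows "epowr (SUP j. g j :: ennreal) p \<le> (\<Sum>j::nat. epowr (g j) p)"
proof -
  have "g j \<le> epowr (\<Sum>j. epowr (g j) p) (1 / p)" for j
  proof -
    have "g j = epowr (epowr (g j) p) (1 / p)" using assms by (simp add: epowr_epowr)
    also have "\<dots> \<le> epowr (\<Sum>j. epowr (g j) p) (1 / p)"
      using assms sum_le_suminf[of "\<lambda>j. epowr (g j) p" "{j}"] by (intro epowr_mono) auto
    finally show ?thesis .
  qed
  hence "epowr (SUP j. g j) p \<le> epowr (epowr (\<Sum>j. epowr (g j) p) (1 / p)) p"
    using assms by (intro epowr_mono SUP_least) auto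
  thus ?thesis using assms by (simp add: epowr_epowr)
qed

lemma strong_functional: 
  assumes p: "p > 0" shows "dilation_functional (strong_functional p d) p d"
proof
  show "p > 0" by (rule p)
next
  fix g h :: "real \<Rightarrow> ennreal" assume [measurable]: "g \<in> borel_measurable borel" "h \<in> borel_measurable borel"
    and "\<And>x. x > 0 \<Longrightarrow> g x \<le> h x"
  thus "strong_functional p d g \<le> strong_functional p d h" unfolding strong_functional_def
    using p by (intro nn_integral_half_line_mono epowr_mono) auto
next
  fix g h :: "real \<Rightarrow> ennreal" assume [measurable]: "g \<in> borel_measurable borel" "h \<in> borel_measurable borel"
  have "strong_functional p d (\<lambda>x. max (g x) (h x)) \<le> (\<integral>\<^sup>+x. epowr (g x) p + epowr (h x) p \<partial>half_line_measure d)"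
    unfolding strong_functional_def by (intro nn_integral_mono) (auto simp: max_def)
  thus "strong_functional p d (\<lambda>x. max (g x) (h x)) \<le> strong_functional p d g + strong_functional p d h"
    unfolding strong_functional_def by (subst (asm) nn_integral_add) auto
next
  fix g :: "nat \<Rightarrow> real \<Rightarrow> ennreal" assume [measurable]: "\<And>j. g j \<in> borel_measurable borel"
  have "strong_functional p d (\<lambda>x. SUP j. g j x) \<le> (\<integral>\<^sup>+x. (\<Sum>j. epowr (g j x) p) \<partial>half_line_measure d)"
    unfolding strong_functional_def by (intro nn_integral_mono epowr_SUP_le p)
  thus "strong_functional p d (\<lambda>x. SUP j. g j x) \<le> (\<Sum>j. strong_functional p d (g j))"
    unfolding strong_functional_def by (subst (asm) nn_integral_suminf) auto
next
  fix g :: "real \<Rightarrow> ennreal" and a c :: real assume [measurable]: "g \<in> borel_measurable borel" and a: "a > 0" "c > 0"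
  have "strong_functional p d (\<lambda>x. ennreal c * g (a * x)) = ennreal (c powr p) * (\<integral>\<^sup>+x. epowr (g (a * x)) p \<partial>half_line_measure d)"
    unfolding strong_functional_def using a by (simp add: epowr_cmult nn_integral_cmult)
  also have "\<dots> = ennreal (c powr p * a powr (- d - 1)) * strong_functional p d g"
    unfolding strong_functional_def using a
    by (subst nn_integral_half_line_dilate[where f="\<lambda>x. epowr (g x) p"]) (auto simp: ennreal_cmult_cmult)
  finally show "strong_functional p d (\<lambda>x. ennreal c * g (a * x)) \<le> ennreal (c powr p * a powr (- d - 1)) * strong_functional p d g" by simp
qed

lemma weak_functional_leI:
  assumes "\<And>\<gamma>. \<gamma> > 0 \<Longrightarrow> ennreal (\<gamma> powr p) * emeasure (half_line_measure d) {x. ennreal \<gamma> < g x} \<le> K"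
  shows "weak_functional p d g \<le> K"
  unfolding weak_functional_def using assms by (intro SUP_least) auto

lemma weak_functionalD:
  "\<gamma> > 0 \<Longrightarrow> ennreal (\<gamma> powr p) * emeasure (half_line_measure d) {x. ennreal \<gamma> < g x} \<le> weak_functional p d g"
  unfolding weak_functional_def by (intro SUP_upper) auto

lemma weak_functional: 
  assumes p: "p > 0" shows "dilation_functional (weak_functional p d) p d"
proof
  show "p > 0" by (rule p)
next
  fix g h :: "real \<Rightarrow> ennreal" assume [measurable]: "g \<in> borel_measurable borel" "h \<in> borel_measurable borel"
    and le: "\<And>x. x > 0 \<Longrightarrow> g x \<le> h x"
  show "weak_functional p d g \<le> weak_functional p d h"
  proof (rule weak_functional_leI)
    fix \<gamma> :: real assume \<gamma>: "\<gamma> > 0"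
    have "emeasure (half_line_measure d) {x. ennreal \<gamma> < g x} \<le> emeasure (half_line_measure d) {x. ennreal \<gamma> < h x}"
      by (intro emeasure_half_line_mono) (use le order_less_le_trans in auto)
    from order_trans[OF mult_left_mono[OF this] weak_functionalD[OF \<gamma>]]
    show "ennreal (\<gamma> powr p) * emeasure (half_line_measure d) {x. ennreal \<gamma> < g x} \<le> weak_functional p d h" by simp
  qed
next
  fix g h :: "real \<Rightarrow> ennreal" assume [measurable]: "g \<in> borel_measurable borel" "h \<in> borel_measurable borel"
  show "weak_functional p d (\<lambda>x. max (g x) (h x)) \<le> weak_functional p d g + weak_functional p d h"
  proof (rule weak_functional_leI)
    fix \<gamma> :: real assume \<gamma>: "\<gamma> > 0"
    have "{x. ennreal \<gamma> < max (g x) (h x)} = {x. ennreal \<gamma> < g x} \<union> {x. ennreal \<gamma> < h x}" by (auto simp: less_max_iff_disj)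
    hence "emeasure (half_line_measure d) {x. ennreal \<gamma> < max (g x) (h x)}
        \<le> emeasure (half_line_measure d) {x. ennreal \<gamma> < g x} + emeasure (half_line_measure d) {x. ennreal \<gamma> < h x}"
      by (simp add: emeasure_subadditive)
    hence "ennreal (\<gamma> powr p) * emeasure (half_line_measure d) {x. ennreal \<gamma> < max (g x) (h x)}
        \<le> ennreal (\<gamma> powr p) * (emeasure (half_line_measure d) {x. ennreal \<gamma> < g x} + emeasure (half_line_measure d) {x. ennreal \<gamma> < h x})"
      by (rule mult_left_mono) simp
    also have "\<dots> \<le> weak_functional p d g + weak_functional p d h"
      unfolding distrib_left by (intro add_mono weak_functionalD \<gamma>)
    finally show "ennreal (\<gamma> powr p) * emeasure (half_line_measure d) {x. ennreal \<gamma> < max (g x) (h x)} \<le> weak_functional p d g + weak_functional p d h" .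
  qed
next
  fix g :: "nat \<Rightarrow> real \<Rightarrow> ennreal" assume [measurable]: "\<And>j. g j \<in> borel_measurable borel"
  show "weak_functional p d (\<lambda>x. SUP j. g j x) \<le> (\<Sum>j. weak_functional p d (g j))"
  proof (rule weak_functional_leI)
    fix \<gamma> :: real assume \<gamma>: "\<gamma> > 0"
    have "{x. ennreal \<gamma> < (SUP j. g j x)} = (\<Union>j. {x. ennreal \<gamma> < g j x})" by (auto simp: less_SUP_iff)
    hence "emeasure (half_line_measure d) {x. ennreal \<gamma> < (SUP j. g j x)} \<le> (\<Sum>j. emeasure (half_line_measure d) {x. ennreal \<gamma> < g j x})"
      by (simp only:) (intro emeasure_subadditive_countably, auto)
    from mult_left_mono[OF this, of "ennreal (\<gamma> powr p)"]
    have "ennreal (\<gamma> powr p) * emeasure (half_line_measure d) {x. ennreal \<gamma> < (SUP j. g j x)}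
       \<le> (\<Sum>j. ennreal (\<gamma> powr p) * emeasure (half_line_measure d) {x. ennreal \<gamma> < g j x})" by simp
    also have "\<dots> \<le> (\<Sum>j. weak_functional p d (g j))"
      by (intro suminf_le weak_functionalD \<gamma>) auto
    finally show "ennreal (\<gamma> powr p) * emeasure (half_line_measure d) {x. ennreal \<gamma> < (SUP j. g j x)} \<le> (\<Sum>j. weak_functional p d (g j))" .
  qed
next
  fix g :: "real \<Rightarrow> ennreal" and a c :: real assume [measurable]: "g \<in> borel_measurable borel" and a: "a > 0" "c > 0"
  show "weak_functional p d (\<lambda>x. ennreal c * g (a * x)) \<le> ennreal (c powr p * a powr (- d - 1)) * weak_functional p d g"
  proof (rule weak_functional_leI)
    fix \<gamma> :: real assume \<gamma>: "\<gamma> > 0"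
    have iff: "ennreal \<gamma> < ennreal c * u \<longleftrightarrow> ennreal (\<gamma> / c) < u" for u
    proof (cases u)
      case (real r)
      have "ennreal c * ennreal r = ennreal (c * r)" using real(1) a by (intro ennreal_mult[symmetric]) auto
      thus ?thesis unfolding real(2) using a \<gamma> real(1) by (simp add: ennreal_less_iff field_simps)
    qed (use a in \<open>simp add: ennreal_mult_top\<close>)
    have "emeasure (half_line_measure d) {x. ennreal \<gamma> < ennreal c * g (a * x)} = (\<integral>\<^sup>+x. indicator {x. ennreal (\<gamma> / c) < g x} (a * x) \<partial>half_line_measure d)"
    proof -
      have "indicator {x. ennreal (\<gamma> / c) < g x} (a * x) = (indicator {x. ennreal (\<gamma> / c) < g (a * x)} x :: ennreal)" for x
        by (simp add: indicator_def)
      thus ?thesis unfolding iff by simp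
    qed
    also have "\<dots> = ennreal (a powr (- d - 1)) * emeasure (half_line_measure d) {x. ennreal (\<gamma> / c) < g x}"
      using a by (subst nn_integral_half_line_dilate) auto
    finally have "ennreal (\<gamma> powr p) * emeasure (half_line_measure d) {x. ennreal \<gamma> < ennreal c * g (a * x)}
      = ennreal (c powr p * a powr (- d - 1)) * (ennreal ((\<gamma> / c) powr p) * emeasure (half_line_measure d) {x. ennreal (\<gamma> / c) < g x})"
      using a \<gamma> by (simp add: ennreal_cmult_cmult powr_divide mult_ac)
    also have "\<dots> \<le> ennreal (c powr p * a powr (- d - 1)) * weak_functional p d g"
      using a \<gamma> by (intro mult_left_mono weak_functionalD) auto
    finally show "ennreal (\<gamma> powr p) * emeasure (half_line_measure d) {x. ennreal \<gamma> < ennreal c * g (a * x)} \<le> ennreal (c powr p * a powr (- d - 1)) * weak_functional p d g" .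
  qed
qed

section \<open>Domination by Hardy operators and the local maximal function\<close>

definition hardy_mean :: "real \<Rightarrow> (real \<Rightarrow> ennreal) \<Rightarrow> real \<Rightarrow> ennreal" where
  "hardy_mean l F x = ennreal (x powr (-2 * l - 1)) * (\<integral>\<^sup>+y\<in>{0<..x}. ennreal (y powr (2 * l)) * F y \<partial>lborel)"

definition hardy_tail :: "(real \<Rightarrow> ennreal) \<Rightarrow> real \<Rightarrow> ennreal" where
  "hardy_tail F x = (\<integral>\<^sup>+y\<in>{x<..}. ennreal (1 / y) * F y \<partial>lborel)"

lemma borel_measurable_hardy_mean [measurable]:
  assumes [measurable]: "F \<in> borel_measurable borel"
  shows "hardy_mean l F \<in> borel_measurable borel"
  unfolding hardy_mean_def indicator_def greaterThanAtMost_iff by measurable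

lemma borel_measurable_hardy_tail [measurable]:
  assumes [measurable]: "F \<in> borel_measurable borel"
  shows "hardy_tail F \<in> borel_measurable borel"
  unfolding hardy_tail_def indicator_def greaterThan_iff by measurable

lemma ennreal_term_le_suminf: "f i \<le> (\<Sum>i. f i :: ennreal)"
  using sum_le_suminf[of f "{i}"] by simp

lemma geometric_interval:
  fixes q s :: real
  assumes q: "q > 1" and s: "s \<ge> 1"
  obtains j :: nat where "q ^ j \<le> s" "s < q ^ Suc j"
proof -
  define n where "n = (LEAST n. s < q ^ n)"
  obtain m where "s < q ^ m" using real_arch_pow[OF q] by blast
  hence n: "s < q ^ n" unfolding n_def by (rule LeastI)
  have "n \<noteq> 0" using n s by (cases n) auto
  then obtain j where j: "n = Suc j" by (cases n) auto
  hence "\<not> s < q ^ j" unfolding n_def by (metis lessI not_less_Least)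
  with n j that[of j] show ?thesis by simp
qed

lemma integral_window_le_local_max:
  assumes "X > 0" and sub: "A \<subseteq> {a<..<b}" and ab: "0 < a" "a < X" "X < b" "b \<le> 5/4 * a" and K: "b - a \<le> K"
    and [measurable]: "F \<in> borel_measurable borel"
  shows "(\<integral>\<^sup>+y\<in>A. F y \<partial>lborel) \<le> ennreal K * local_max F X"
proof -
  have "(\<integral>\<^sup>+y\<in>A. F y \<partial>lborel) \<le> (\<integral>\<^sup>+y\<in>{a<..<b}. F y \<partial>lborel)"
    using sub by (intro nn_integral_mono) (auto split: split_indicator)
  also have "\<dots> \<le> ennreal (b - a) * local_max F X" by (rule average_le_local_max[OF ab])
  also have "\<dots> \<le> ennreal K * local_max F X" using K by (intro mult_right_mono ennreal_leI) auto
  finally show ?thesis .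
qed

text \<open>
  The half-line \<open>(x, \<infinity>)\<close> is cut at the points \<open>(10/9)\<^sup>j x\<close>. Each piece is contained in an interval that is admissible for \<open>local_max\<close>
  at its left endpoint.
\<close>

lemma hardy_tail_le_dilated_sum:
  assumes F[measurable]: "F \<in> borel_measurable borel" and x: "x > 0"
  shows "hardy_tail F x \<le> dilated_sum 1 (10/9) (local_max F) x"
proof -
  define X where "X = (\<lambda>j::nat. (10/9) ^ j * x)"
  have X: "X j > 0" "X (Suc j) = 10/9 * X j" for j using x by (auto simp: X_def)
  have "hardy_tail F x \<le> (\<integral>\<^sup>+y. (\<Sum>j. ennreal (1 / X j) * (F y * indicator {X j..<X (Suc j)} y)) \<partial>lborel)"
    unfolding hardy_tail_def
  proof (intro nn_integral_mono)
    fix y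
    show "ennreal (1 / y) * F y * indicator {x<..} y \<le> (\<Sum>j. ennreal (1 / X j) * (F y * indicator {X j..<X (Suc j)} y))"
    proof (cases "y > x")
      case True
      obtain j where j: "(10/9) ^ j \<le> y / x" "y / x < (10/9) ^ Suc j"
        by (rule geometric_interval[of "10/9" "y / x"]) (use True x in auto)
      hence j: "X j \<le> y" "y < X (Suc j)" using x by (simp_all add: X_def field_simps)
      have "ennreal (1 / y) * F y \<le> ennreal (1 / X j) * F y"
        using X(1)[of j] j by (intro mult_right_mono ennreal_leI) (auto simp: field_simps)
      also have "\<dots> = ennreal (1 / X j) * (F y * indicator {X j..<X (Suc j)} y)" using j by simp
      also have "\<dots> \<le> (\<Sum>j. ennreal (1 / X j) * (F y * indicator {X j..<X (Suc j)} y))"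
        by (rule ennreal_term_le_suminf)
      finally show ?thesis using True by simp
    qed auto
  qed
  also have "\<dots> = (\<Sum>j. ennreal (1 / X j) * (\<integral>\<^sup>+y\<in>{X j..<X (Suc j)}. F y \<partial>lborel))"
    by (subst nn_integral_suminf) (auto simp: nn_integral_cmult)
  also have "\<dots> \<le> (\<Sum>j. ennreal (1 ^ j) * local_max F (X j))"
  proof (intro suminf_le)
    fix j
    have "(\<integral>\<^sup>+y\<in>{X j..<X (Suc j)}. F y \<partial>lborel) \<le> ennreal (X j) * local_max F (X j)"
      \<comment> \<open>\<open>(19/20, 23/20)\<close> contains \<open>[1, 10/9)\<close>, and \<open>23/20\<close> is less than \<open>5/4 * 19/20\<close>.\<close>
      by (rule integral_window_le_local_max[where a="19/20 * X j" and b="23/20 * X j"]) (use X[of j] F in auto)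
    hence "ennreal (1 / X j) * (\<integral>\<^sup>+y\<in>{X j..<X (Suc j)}. F y \<partial>lborel) \<le> ennreal (1 / X j) * (ennreal (X j) * local_max F (X j))"
      by (rule mult_left_mono) simp
    also have "\<dots> = local_max F (X j)" using X(1)[of j] by (subst ennreal_cmult_cmult) auto
    finally show "ennreal (1 / X j) * (\<integral>\<^sup>+y\<in>{X j..<X (Suc j)}. F y \<partial>lborel) \<le> ennreal (1 ^ j) * local_max F (X j)" by simp
  qed auto
  finally show ?thesis by (simp add: dilated_sum_def X_def)
qed

text \<open>
  The interval \<open>(0, x]\<close> is cut at the points \<open>(9/10)\<^sup>j x\<close>. The weight \<open>y\<^bsup>2l\<^esup>\<close> is essentially constant
  on each piece, and together with the length of the piece it produces the factor \<open>(9/10)\<^bsup>j(2l+1)\<^esup>\<close>.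
\<close>

lemma hardy_mean_le_dilated_sum:
  assumes F[measurable]: "F \<in> borel_measurable borel" and x: "x > 0"
  shows "hardy_mean l F x \<le> ennreal (2 powr \<bar>2 * l\<bar>) * dilated_sum ((9/10) powr (2 * l + 1)) (9/10) (local_max F) x"
proof -
  define X where "X = (\<lambda>j::nat. (9/10) ^ j * x)"
  define D where "D = 2 powr \<bar>2 * l\<bar>"
  have X: "X j > 0" "X (Suc j) = 9/10 * X j" for j using x by (auto simp: X_def)
  have "(\<integral>\<^sup>+y\<in>{0<..x}. ennreal (y powr (2 * l)) * F y \<partial>lborel)
      \<le> (\<integral>\<^sup>+y. (\<Sum>j. ennreal (D * X j powr (2 * l)) * (F y * indicator {X (Suc j)<..X j} y)) \<partial>lborel)"
  proof (intro nn_integral_mono)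
    fix y
    show "ennreal (y powr (2 * l)) * F y * indicator {0<..x} y \<le> (\<Sum>j. ennreal (D * X j powr (2 * l)) * (F y * indicator {X (Suc j)<..X j} y))"
    proof (cases "0 < y \<and> y \<le> x")
      case True
      obtain j where j: "(10/9) ^ j \<le> x / y" "x / y < (10/9) ^ Suc j"
        by (rule geometric_interval[of "10/9" "x / y"]) (use True x in auto)
      hence j: "y \<le> X j" "X (Suc j) < y" using True x by (simp_all add: X_def field_simps)
      have "(y / X j) powr (2 * l) \<le> D" unfolding D_def
        by (rule powr_ratio_bound) (use X[of j] j in \<open>auto simp: field_simps\<close>)
      hence "y powr (2 * l) \<le> D * X j powr (2 * l)" using X(1)[of j] by (simp add: powr_divide field_simps)
      hence "ennreal (y powr (2 * l)) * F y \<le> ennreal (D * X j powr (2 * l)) * F y"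
        by (intro mult_right_mono ennreal_leI) auto
      also have "\<dots> = ennreal (D * X j powr (2 * l)) * (F y * indicator {X (Suc j)<..X j} y)" using j by simp
      also have "\<dots> \<le> (\<Sum>j. ennreal (D * X j powr (2 * l)) * (F y * indicator {X (Suc j)<..X j} y))"
        by (rule ennreal_term_le_suminf)
      finally show ?thesis using True by simp
    qed auto
  qed
  also have "\<dots> = (\<Sum>j. ennreal (D * X j powr (2 * l)) * (\<integral>\<^sup>+y\<in>{X (Suc j)<..X j}. F y \<partial>lborel))"
    by (subst nn_integral_suminf) (auto simp: nn_integral_cmult)
  also have "\<dots> \<le> (\<Sum>j. ennreal (D * X j powr (2 * l)) * (ennreal (X j) * local_max F (X j)))"
  proof (intro suminf_le mult_left_mono)
    fix j
    show "(\<integral>\<^sup>+y\<in>{X (Suc j)<..X j}. F y \<partial>lborel) \<le> ennreal (X j) * local_max F (X j)"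
      \<comment> \<open>\<open>(88/100, 11/10)\<close> contains \<open>(9/10, 1]\<close>, and \<open>11/10\<close> equals \<open>5/4 * 88/100\<close>.\<close>
      by (rule integral_window_le_local_max[where a="88/100 * X j" and b="11/10 * X j"]) (use X[of j] F in auto)
  qed auto
  finally have "hardy_mean l F x \<le> (\<Sum>j. ennreal (x powr (-2 * l - 1)) * (ennreal (D * X j powr (2 * l)) * (ennreal (X j) * local_max F (X j))))"
    unfolding hardy_mean_def by (simp add: mult_left_mono)
  also have "\<dots> = (\<Sum>j. ennreal D * (ennreal (((9/10) powr (2 * l + 1)) ^ j) * local_max F ((9/10) ^ j * x)))"
  proof (intro suminf_cong)
    fix j
    have "x powr (-2 * l - 1) * (D * X j powr (2 * l) * X j) = x powr (-2 * l - 1) * (D * X j powr (2 * l + 1))"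
      using X(1)[of j] by (simp add: powr_add)
    also have "X j powr (2 * l + 1) = ((9/10) ^ j) powr (2 * l + 1) * x powr (2 * l + 1)"
      using x by (simp add: X_def powr_mult)
    also have "((9/10) ^ j) powr (2 * l + 1) = ((9/10 :: real) powr (2 * l + 1)) ^ j"
      by (simp add: powr_powr mult.commute flip: powr_realpow)
    also have "x powr (-2 * l - 1) * (D * (((9/10) powr (2 * l + 1)) ^ j * x powr (2 * l + 1)))
       = D * ((9/10) powr (2 * l + 1)) ^ j * (x powr (-2 * l - 1) * x powr (2 * l + 1))" by (simp add: mult_ac)
    also have "x powr (-2 * l - 1) * x powr (2 * l + 1) = 1" using x by (simp flip: powr_add)
    finally have e: "x powr (-2 * l - 1) * (D * X j powr (2 * l) * X j) = D * ((9/10) powr (2 * l + 1)) ^ j"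
      by (simp only: mult_1_right)
    have "ennreal (x powr (-2 * l - 1)) * (ennreal (D * X j powr (2 * l)) * (ennreal (X j) * local_max F (X j)))
      = ennreal (x powr (-2 * l - 1) * (D * X j powr (2 * l) * X j)) * local_max F (X j)"
      using X(1)[of j] by (simp add: ennreal_cmult_cmult D_def)
    thus "ennreal (x powr (-2 * l - 1)) * (ennreal (D * X j powr (2 * l)) * (ennreal (X j) * local_max F (X j)))
      = ennreal D * (ennreal (((9/10) powr (2 * l + 1)) ^ j) * local_max F ((9/10) ^ j * x))"
      unfolding e by (simp add: ennreal_cmult_cmult D_def) (simp add: X_def)
  qed
  finally show ?thesis by (simp add: dilated_sum_def D_def)
qed

text \<open>
  A radially decreasing kernel is a superposition of normalized indicators of intervals, hence its averages are controlled by the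
  maximal function; dyadic radii suffice.
\<close>

lemma gaussian_le_dyadic_sum:
  fixes s :: real
  assumes s: "s \<ge> 0"
  shows "ennreal (exp (- s\<^sup>2 / 4)) \<le> (\<Sum>i. ennreal (16 * (1/4) ^ i) * indicator {..<2 ^ i} s)"
proof -
  have "\<exists>i. s < 2 ^ i \<and> exp (- s\<^sup>2 / 4) \<le> 16 * (1/4) ^ i"
  proof (cases "s < 1")
    case True
    moreover have "exp (- s\<^sup>2 / 4) \<le> 1" by simp
    ultimately show ?thesis by (intro exI[of _ 0]) (simp del: exp_le_one_iff)
  next
    case False
    obtain j where j: "2 ^ j \<le> s" "s < 2 ^ Suc j"
      by (rule geometric_interval[of 2 s]) (use False in auto)
    have "(2 ^ j)\<^sup>2 \<le> s\<^sup>2" using j by (intro power_mono) auto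
    hence s2: "4 ^ j \<le> s\<^sup>2" by (simp add: power2_eq_square flip: power_mult_distrib)
    have "s\<^sup>2 / 4 \<le> exp (s\<^sup>2 / 4)" using exp_ge_add_one_self[of "s\<^sup>2 / 4"] by linarith
    hence "exp (- (s\<^sup>2 / 4)) \<le> 4 / s\<^sup>2" using False by (simp add: exp_minus field_simps)
    also have "\<dots> \<le> 4 / 4 ^ j" using s2 False by (intro divide_left_mono mult_pos_pos) auto
    also have "\<dots> = 16 * (1/4) ^ Suc j" by (simp add: power_divide)
    finally show ?thesis using j by (intro exI[of _ "Suc j"]) simp
  qed
  then obtain i where i: "s < 2 ^ i" "exp (- s\<^sup>2 / 4) \<le> 16 * (1/4) ^ i" by blast
  have "ennreal (exp (- s\<^sup>2 / 4)) \<le> ennreal (16 * (1/4) ^ i) * indicator {..<2 ^ i} s"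
    using i by (simp add: ennreal_leI)
  also have "\<dots> \<le> (\<Sum>i. ennreal (16 * (1/4) ^ i) * indicator {..<2 ^ i} s)"
    by (rule ennreal_term_le_suminf)
  finally show ?thesis .
qed

text \<open>
  For \<open>\<rho>\<close> up to \<open>x/10\<close> the centred interval is itself admissible; for larger \<open>\<rho>\<close> the whole window fits into one admissible
  interval whose length is comparable with \<open>x\<close>.
\<close>

lemma near_window_le_local_max:
  assumes F: "F \<in> borel_measurable borel" and x: "x > 0" and \<rho>: "\<rho> > 0"
  shows "(\<integral>\<^sup>+y\<in>{9/10 * x..10/9 * x} \<inter> {x - \<rho><..<x + \<rho>}. F y \<partial>lborel) \<le> ennreal (3 * \<rho>) * local_max F x"
proof (cases "\<rho> < x / 10")
  case True
  show ?thesis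
    by (rule integral_window_le_local_max[where a="x - \<rho>" and b="x + \<rho>"]) (use True x \<rho> F in auto)
next
  case False
  show ?thesis
    \<comment> \<open>\<open>445/400 = 5/4 * 89/100\<close> is just above \<open>10/9\<close>.\<close>
    by (rule integral_window_le_local_max[where a="89/100 * x" and b="445/400 * x"]) (use False x \<rho> F in auto)
qed

lemma near_part_le_local_max:
  assumes F[measurable]: "F \<in> borel_measurable borel" and x: "x > 0" and t: "t > 0"
  shows "(\<integral>\<^sup>+y\<in>{9/10 * x..10/9 * x}. ennreal (t powr (-1/2) * exp (- (x - y)\<^sup>2 / (4*t)) + 1 / x) * F y \<partial>lborel)
     \<le> ennreal 99 * local_max F x"
proof -
  let ?N = "{9/10 * x..10/9 * x}"
  let ?s = "\<lambda>y. \<bar>x - y\<bar> / sqrt t"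
  have win: "(\<integral>\<^sup>+y\<in>?N. indicator {..<2 ^ i} (?s y) * F y \<partial>lborel) \<le> ennreal (3 * (2 ^ i * sqrt t)) * local_max F x" for i :: nat
  proof -
    have "indicator {..<2 ^ i} (?s y) * F y * indicator ?N y = F y * indicator (?N \<inter> {x - 2 ^ i * sqrt t<..<x + 2 ^ i * sqrt t}) y" for y
      using t by (auto split: split_indicator simp: pos_divide_less_eq abs_less_iff)
    thus ?thesis using near_window_le_local_max[OF F x, of "2 ^ i * sqrt t"] t by simp
  qed
  have one: "(\<integral>\<^sup>+y\<in>?N. F y \<partial>lborel) \<le> ennreal (3 * x) * local_max F x"
    by (rule integral_window_le_local_max[where a="89/100 * x" and b="445/400 * x"]) (use x F in auto)
  have "(\<integral>\<^sup>+y\<in>?N. ennreal (t powr (-1/2) * exp (- (x - y)\<^sup>2 / (4*t)) + 1 / x) * F y \<partial>lborel)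
     \<le> (\<integral>\<^sup>+y. (\<Sum>i. ennreal (t powr (-1/2) * (16 * (1/4) ^ i)) * (indicator {..<2 ^ i} (?s y) * F y * indicator ?N y)) + ennreal (1 / x) * (F y * indicator ?N y) \<partial>lborel)"
  proof (intro nn_integral_mono)
    fix y
    have "- (x - y)\<^sup>2 / (4*t) = - (?s y)\<^sup>2 / 4" using t by (simp add: power_divide)
    hence "ennreal (exp (- (x - y)\<^sup>2 / (4*t))) \<le> (\<Sum>i. ennreal (16 * (1/4) ^ i) * indicator {..<2 ^ i} (?s y))"
      using gaussian_le_dyadic_sum[of "?s y"] t by (simp only: zero_le_divide_iff) simp
    hence "ennreal (t powr (-1/2)) * ennreal (exp (- (x - y)\<^sup>2 / (4*t))) \<le> ennreal (t powr (-1/2)) * (\<Sum>i. ennreal (16 * (1/4) ^ i) * indicator {..<2 ^ i} (?s y))"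
      by (rule mult_left_mono) simp
    also have "\<dots> = (\<Sum>i. ennreal (t powr (-1/2) * (16 * (1/4) ^ i)) * indicator {..<2 ^ i} (?s y))"
      by (simp add: ennreal_cmult_cmult flip: ennreal_suminf_cmult)
    finally have "ennreal (t powr (-1/2) * exp (- (x - y)\<^sup>2 / (4*t)) + 1 / x) \<le> (\<Sum>i. ennreal (t powr (-1/2) * (16 * (1/4) ^ i)) * indicator {..<2 ^ i} (?s y)) + ennreal (1 / x)"
      using x by (simp add: ennreal_plus ennreal_mult add_right_mono)
    from mult_right_mono[OF this, of "F y * indicator ?N y"]
    show "ennreal (t powr (-1/2) * exp (- (x - y)\<^sup>2 / (4*t)) + 1 / x) * F y * indicator ?N y
      \<le> (\<Sum>i. ennreal (t powr (-1/2) * (16 * (1/4) ^ i)) * (indicator {..<2 ^ i} (?s y) * F y * indicator ?N y)) + ennreal (1 / x) * (F y * indicator ?N y)"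
      by (simp add: distrib_right mult.assoc flip: ennreal_suminf_multc)
  qed
  also have "\<dots> = (\<Sum>i. ennreal (t powr (-1/2) * (16 * (1/4) ^ i)) * (\<integral>\<^sup>+y\<in>?N. indicator {..<2 ^ i} (?s y) * F y \<partial>lborel)) + ennreal (1 / x) * (\<integral>\<^sup>+y\<in>?N. F y \<partial>lborel)"
    by (subst nn_integral_add; (measurable)?) (simp add: nn_integral_suminf nn_integral_cmult)
  also have "\<dots> \<le> (\<Sum>i. ennreal (48 * (1/2) ^ i) * local_max F x) + ennreal 3 * local_max F x"
  proof (intro add_mono suminf_le)
    fix i :: nat
    have "ennreal (t powr (-1/2) * (16 * (1/4) ^ i)) * (\<integral>\<^sup>+y\<in>?N. indicator {..<2 ^ i} (?s y) * F y \<partial>lborel)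
      \<le> ennreal (t powr (-1/2) * (16 * (1/4) ^ i)) * (ennreal (3 * (2 ^ i * sqrt t)) * local_max F x)"
      by (intro mult_left_mono win) simp
    also have "\<dots> = ennreal (t powr (-1/2) * (16 * (1/4) ^ i) * (3 * (2 ^ i * sqrt t))) * local_max F x"
      by (rule ennreal_cmult_cmult) (use t in auto)
    also have "t powr (-1/2) * (16 * (1/4) ^ i) * (3 * (2 ^ i * sqrt t)) = 48 * (1/2) ^ i"
    proof -
      have "t powr (-1/2) * sqrt t = 1" using t by (simp add: powr_minus_divide powr_half_sqrt)
      moreover have "(1/4) ^ i * 2 ^ i = (1/2 :: real) ^ i" by (simp flip: power_mult_distrib)
      moreover have "t powr (-1/2) * (16 * (1/4) ^ i) * (3 * (2 ^ i * sqrt t)) = 48 * ((1/4) ^ i * 2 ^ i) * (t powr (-1/2) * sqrt t)"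
        by (simp only: mult_ac)
      ultimately show ?thesis by simp
    qed
    finally show "ennreal (t powr (-1/2) * (16 * (1/4) ^ i)) * (\<integral>\<^sup>+y\<in>?N. indicator {..<2 ^ i} (?s y) * F y \<partial>lborel)
      \<le> ennreal (48 * (1/2) ^ i) * local_max F x" .
  next
    have "ennreal (1 / x) * (\<integral>\<^sup>+y\<in>?N. F y \<partial>lborel) \<le> ennreal (1 / x) * (ennreal (3 * x) * local_max F x)"
      by (intro mult_left_mono one) simp
    thus "ennreal (1 / x) * (\<integral>\<^sup>+y\<in>?N. F y \<partial>lborel) \<le> ennreal 3 * local_max F x"
      using x by (subst (asm) ennreal_cmult_cmult) auto
  qed auto
  also have "(\<Sum>i. ennreal (48 * (1/2) ^ i) * local_max F x) = ennreal 96 * local_max F x"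
  proof -
    have "(\<Sum>i. ennreal (48 * (1/2) ^ i)) = ennreal 48 * (\<Sum>i. ennreal ((1/2) ^ i))"
      by (simp add: ennreal_mult)
    also have "\<dots> = ennreal 96" by (subst suminf_ennreal_geometric) (auto simp flip: ennreal_mult)
    finally show ?thesis by simp
  qed
  also have "ennreal 96 * local_max F x + ennreal 3 * local_max F x = ennreal 99 * local_max F x"
    by (simp flip: distrib_right)
  finally show ?thesis .
qed

definition heat_pos :: "real \<Rightarrow> real \<Rightarrow> (real \<Rightarrow> ennreal) \<Rightarrow> real \<Rightarrow> ennreal" where
  "heat_pos l t F x = (\<integral>\<^sup>+y. ennreal (heat_kernel l t x y) * F y \<partial>half_line_measure (2 * l))"

definition dominating :: "real \<Rightarrow> (real \<Rightarrow> ennreal) \<Rightarrow> real \<Rightarrow> ennreal" where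
  "dominating l F x = hardy_mean l F x + (hardy_tail F x + local_max F x)"

lemma borel_measurable_bessel_I [measurable]: "bessel_I \<nu> \<in> borel_measurable borel"
  unfolding bessel_I_def by measurable

lemma borel_measurable_heat_kernel [measurable (raw)]:
  assumes [measurable]: "f \<in> borel_measurable M" "g \<in> borel_measurable M"
  shows "(\<lambda>y. heat_kernel l t (f y) (g y)) \<in> borel_measurable M"
  unfolding heat_kernel_def by measurable

lemma weighted_heat_kernel_near:
  assumes l: "l > -1/2"
  shows "\<exists>D>0. \<forall>t>0. \<forall>x>0. \<forall>y. 9/10 * x \<le> y \<and> y \<le> 10/9 * x \<longrightarrow>
     y powr (2 * l) * heat_kernel l t x y \<le> D * (t powr (-1/2) * exp (- (x - y)\<^sup>2 / (4*t)) + 1 / x)"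
proof -
  obtain C where C: "C > 0" and near:
    "\<forall>t>0. \<forall>x>0. \<forall>y. 9/10 * x \<le> y \<and> y \<le> 10/9 * x \<longrightarrow>
     heat_kernel l t x y \<le> C * (x powr (-2*l) * (t powr (-1/2) * exp (- (x - y)\<^sup>2 / (4*t)) + 1 / x))"
    using heat_kernel_near[OF l] by blast
  have "y powr (2 * l) * heat_kernel l t x y \<le> C * 2 powr \<bar>2 * l\<bar> * (t powr (-1/2) * exp (- (x - y)\<^sup>2 / (4*t)) + 1 / x)"
    if t: "t > 0" and x: "x > 0" and y: "9/10 * x \<le> y" "y \<le> 10/9 * x" for t x y
  proof -
    let ?n = "t powr (-1/2) * exp (- (x - y)\<^sup>2 / (4*t)) + 1 / x"
    have y0: "y > 0" using x y by linarith
    have "(y / x) powr (2 * l) \<le> 2 powr \<bar>2 * l\<bar>"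
      by (rule powr_ratio_bound) (use y x in \<open>auto simp: field_simps\<close>)
    hence "y powr (2 * l) \<le> 2 powr \<bar>2 * l\<bar> * x powr (2 * l)" using x by (simp add: powr_divide field_simps)
    hence "y powr (2 * l) * heat_kernel l t x y \<le> 2 powr \<bar>2 * l\<bar> * x powr (2 * l) * (C * (x powr (-2*l) * ?n))"
      using near[rule_format, OF t x, of y] y heat_kernel_nonneg[OF l t x y0] by (intro mult_mono) auto
    also have "\<dots> = C * 2 powr \<bar>2 * l\<bar> * (x powr (2 * l) * x powr (-2*l)) * ?n" by simp
    also have "x powr (2 * l) * x powr (-2*l) = 1" using x by (simp flip: powr_add)
    finally show ?thesis by (simp only: mult_1_right)
  qed
  moreover have "C * 2 powr \<bar>2 * l\<bar> > 0" using C by simp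
  ultimately show ?thesis by blast
qed

text \<open>
  The three regions \<open>y < 9x/10\<close>, \<open>y > 10x/9\<close> and the window in between give the three summands of
  the dominating operator. The far bounds are used with \<open>\<sigma> = 0\<close>, so no constant depends on \<open>t\<close>.
\<close>

lemma heat_pos_le_dominating:
  assumes l: "l > -1/2"
  shows "\<exists>C\<ge>0. \<forall>F\<in>borel_measurable borel. \<forall>t>0. \<forall>x>0. heat_pos l t F x \<le> ennreal C * dominating l F x"
proof -
  have "0 \<le> l + 1/2" using l by simp
  from heat_kernel_far[OF l this] obtain C1 where C1: "C1 > 0" and
    F0: "\<forall>t>0. \<forall>x>0. \<forall>y\<ge>10/9 * x. heat_kernel l t x y \<le> C1 * (y powr (-2*l - 1) * (y\<^sup>2 / t) powr 0)" by blast
  have far: "heat_kernel l t x y \<le> C1 * y powr (-2*l - 1)" if "t > 0" "x > 0" "y \<ge> 10/9 * x" for t x y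
    using F0[rule_format, OF that] that by simp
  obtain D where D: "D > 0" and near: "\<forall>t>0. \<forall>x>0. \<forall>y. 9/10 * x \<le> y \<and> y \<le> 10/9 * x \<longrightarrow>
     y powr (2 * l) * heat_kernel l t x y \<le> D * (t powr (-1/2) * exp (- (x - y)\<^sup>2 / (4*t)) + 1 / x)"
    using weighted_heat_kernel_near[OF l] by blast
  define C where "C = C1 + 99 * D"
  have C: "C1 \<le> C" "99 * D \<le> C" using C1 D by (simp_all add: C_def)
  have "heat_pos l t F x \<le> ennreal C * dominating l F x" 
    if [measurable]: "F \<in> borel_measurable borel" and t: "t > 0" and x: "x > 0" for F t x
  proof -
    let ?n = "\<lambda>y. t powr (-1/2) * exp (- (x - y)\<^sup>2 / (4*t)) + 1 / x"
    let ?A = "\<lambda>y. ennreal (x powr (-2*l - 1)) * (ennreal (y powr (2 * l)) * F y * indicator {0<..x} y)"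
    let ?B = "\<lambda>y. ennreal (1 / y) * F y * indicator {x<..} y"
    let ?N = "\<lambda>y. ennreal (?n y) * F y * indicator {9/10 * x..10/9 * x} y"
    have pt: "ennreal (y powr (2 * l)) * indicator {0<..} y * (ennreal (heat_kernel l t x y) * F y)
        \<le> (ennreal C1 * ?A y + ennreal C1 * ?B y) + ennreal D * ?N y" for y
    proof -
      have W: "ennreal (y powr (2 * l)) * indicator {0<..} y * (ennreal (heat_kernel l t x y) * F y)
         = ennreal (y powr (2 * l) * heat_kernel l t x y) * F y" if "y > 0"
        using that heat_kernel_nonneg[OF l t x that] by (simp add: ennreal_cmult_cmult)
      consider "y \<le> 0" | "0 < y" "y < 9/10 * x" | "10/9 * x < y" "0 < y" | "0 < y" "9/10 * x \<le> y" "y \<le> 10/9 * x" using x by linarith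
      thus ?thesis
      proof cases
        case 1
        thus ?thesis by simp
      next
        case 2
        have "heat_kernel l t x y \<le> C1 * x powr (-2*l - 1)"
          using far[OF t 2(1), of x] 2 by (simp add: heat_kernel_commute[of l t x y])
        hence "y powr (2 * l) * heat_kernel l t x y \<le> C1 * x powr (-2*l - 1) * y powr (2 * l)"
          by (metis mult.commute mult_left_mono powr_ge_zero)
        hence "ennreal (y powr (2 * l) * heat_kernel l t x y) * F y \<le> ennreal (C1 * x powr (-2*l - 1) * y powr (2 * l)) * F y"
          by (intro mult_right_mono ennreal_leI) auto
        also have "\<dots> = ennreal C1 * ?A y" using 2 C1 by (simp add: ennreal_cmult_cmult mult.assoc)
        finally show ?thesis unfolding W[OF 2(1)] by (simp add: add_increasing2)
      next
        case 3
        have "y powr (2 * l) * heat_kernel l t x y \<le> y powr (2 * l) * (C1 * y powr (-2*l - 1))"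
          using far[OF t x, of y] 3 by (intro mult_left_mono) auto
        also have "\<dots> = C1 * (y powr (2 * l) * y powr (-2*l - 1))" by simp
        also have "y powr (2 * l) * y powr (-2*l - 1) = y powr (-1)" by (simp only: powr_add[symmetric]) simp
        also have "\<dots> = 1 / y" using 3 by (simp add: powr_minus_divide)
        finally have "ennreal (y powr (2 * l) * heat_kernel l t x y) * F y \<le> ennreal (C1 * (1 / y)) * F y"
          by (intro mult_right_mono ennreal_leI) auto
        also have "\<dots> = ennreal C1 * ?B y" using 3 x C1 by (simp add: ennreal_cmult_cmult)
        finally show ?thesis unfolding W[OF 3(2)] by (simp add: add_increasing2 add_increasing)
      next
        case 4
        have n0: "?n y \<ge> 0" using x by simp
        have "y powr (2 * l) * heat_kernel l t x y \<le> D * ?n y" using near t x 4 by blast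
        hence "ennreal (y powr (2 * l) * heat_kernel l t x y) * F y \<le> ennreal (D * ?n y) * F y"
          by (intro mult_right_mono ennreal_leI) auto
        also have "\<dots> = ennreal D * (ennreal (?n y) * F y)"
          by (rule ennreal_cmult_cmult[symmetric]) (use D n0 in auto)
        finally show ?thesis unfolding W[OF 4(1)] using 4 by (simp add: add_increasing del: ennreal_plus)
      qed
    qed
    have "heat_pos l t F x = (\<integral>\<^sup>+y. ennreal (y powr (2 * l)) * indicator {0<..} y * (ennreal (heat_kernel l t x y) * F y) \<partial>lborel)"
      unfolding heat_pos_def by (rule nn_integral_half_line) measurable
    also have "\<dots> \<le> (\<integral>\<^sup>+y. (ennreal C1 * ?A y + ennreal C1 * ?B y) + ennreal D * ?N y \<partial>lborel)"
      by (intro nn_integral_mono pt)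
    also have "\<dots> = (ennreal C1 * hardy_mean l F x + ennreal C1 * hardy_tail F x) + ennreal D * (\<integral>\<^sup>+y. ?N y \<partial>lborel)"
      unfolding hardy_mean_def hardy_tail_def by (simp add: nn_integral_add nn_integral_cmult)
    also have "\<dots> \<le> (ennreal C * hardy_mean l F x + ennreal C * hardy_tail F x) + ennreal D * (ennreal 99 * local_max F x)"
      using C by (intro add_mono mult_right_mono mult_left_mono ennreal_leI near_part_le_local_max t x that(1)) auto
    also have "ennreal D * (ennreal 99 * local_max F x) = ennreal (D * 99) * local_max F x" by (rule ennreal_cmult_cmult) (use D in auto)
    also have "ennreal (D * 99) * local_max F x \<le> ennreal C * local_max F x"
      using C by (intro mult_right_mono ennreal_leI) auto
    finally show ?thesis unfolding dominating_def by (simp add: distrib_left add.assoc)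
  qed
  moreover have "C \<ge> 0" using C C1 by linarith
  ultimately show ?thesis by blast
qed

section \<open>Bounds for the dominating operator\<close>

lemma nn_integral_powr_from_0:
  assumes "a > -1" "R \<ge> 0"
  shows "(\<integral>\<^sup>+y\<in>{0<..R}. ennreal (y powr a) \<partial>lborel) = ennreal (R powr (a + 1) / (a + 1))"
proof -
  have "(\<integral>\<^sup>+y. ennreal (y powr a) * indicator {0..R} y \<partial>lborel) = ennreal (R powr (a + 1) / (a + 1))"
    by (rule nn_integral_has_integral_lebesgue'[OF _ has_integral_powr_from_0]) (use assms in auto)
  moreover have "(\<integral>\<^sup>+y\<in>{0<..R}. ennreal (y powr a) \<partial>lborel) = (\<integral>\<^sup>+y. ennreal (y powr a) * indicator {0..R} y \<partial>lborel)"
    using AE_lborel_singleton[of 0] by (intro nn_integral_cong_AE) (auto split: split_indicator)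
  ultimately show ?thesis by simp
qed

lemma emeasure_half_line_initial:
  assumes "d > -1" "R \<ge> 0"
  shows "emeasure (half_line_measure d) {0<..R} = ennreal (R powr (d + 1) / (d + 1))"
proof -
  have "ennreal (x powr d) * indicator {0<..} x * indicator {0<..R} x = ennreal (x powr d) * indicator {0<..R} x" for x
    by (auto split: split_indicator)
  thus ?thesis using nn_integral_powr_from_0[OF assms] by (simp add: emeasure_half_line)
qed

lemma weak_functional_le_strong_functional:
  assumes p: "p > 0" and [measurable]: "g \<in> borel_measurable borel"
  shows "weak_functional p d g \<le> strong_functional p d g"
proof (rule weak_functional_leI)
  fix \<gamma> :: real assume \<gamma>: "\<gamma> > 0"
  have "ennreal (\<gamma> powr p) * emeasure (half_line_measure d) {x. ennreal \<gamma> < g x}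
     = (\<integral>\<^sup>+x. ennreal (\<gamma> powr p) * indicator {x. ennreal \<gamma> < g x} x \<partial>half_line_measure d)"
    by (simp add: nn_integral_cmult)
  also have "\<dots> \<le> strong_functional p d g" unfolding strong_functional_def
  proof (intro nn_integral_mono)
    fix x
    have "ennreal (\<gamma> powr p) \<le> epowr (g x) p" if "ennreal \<gamma> < g x"
      using epowr_mono[of "ennreal \<gamma>" "g x" p] that p \<gamma> by simp
    thus "ennreal (\<gamma> powr p) * indicator {x. ennreal \<gamma> < g x} x \<le> epowr (g x) p" by (auto split: split_indicator)
  qed
  finally show "ennreal (\<gamma> powr p) * emeasure (half_line_measure d) {x. ennreal \<gamma> < g x} \<le> strong_functional p d g" .
qed

text \<open>
  The case \<open>p = 1\<close> is the covering argument; for \<open>p > 1\<close> the strong type implies the weak type.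
\<close>

lemma weak_functional_local_max:
  assumes p: "p \<ge> 1"
  shows "\<exists>C\<ge>0. \<forall>F\<in>borel_measurable borel. weak_functional p d (local_max F) \<le> ennreal C * strong_functional p d F"
proof (cases "p = 1")
  case True
  have "weak_functional p d (local_max F) \<le> ennreal (5 * 4 powr \<bar>d\<bar>) * strong_functional p d F"
    if [measurable]: "F \<in> borel_measurable borel" for F
  proof (rule weak_functional_leI)
    fix \<gamma> :: real assume \<gamma>: "\<gamma> > 0"
    have "ennreal (\<gamma> powr p) * emeasure (half_line_measure d) {x. ennreal \<gamma> < local_max F x}
      \<le> ennreal \<gamma> * (ennreal (5 * 4 powr \<bar>d\<bar> / \<gamma>) * (\<integral>\<^sup>+x. F x \<partial>half_line_measure d))"
      using \<gamma> True by (auto intro!: mult_left_mono local_max_weak_type)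
    also have "\<dots> = ennreal (5 * 4 powr \<bar>d\<bar>) * strong_functional p d F"
      using \<gamma> True by (subst ennreal_cmult_cmult) (auto simp: strong_functional_def)
    finally show "ennreal (\<gamma> powr p) * emeasure (half_line_measure d) {x. ennreal \<gamma> < local_max F x}
      \<le> ennreal (5 * 4 powr \<bar>d\<bar>) * strong_functional p d F" .
  qed
  thus ?thesis by (intro exI[of _ "5 * 4 powr \<bar>d\<bar>"]) auto
next
  case False
  hence p1: "p > 1" using p by simp
  let ?C = "10 * 4 powr \<bar>d\<bar> * (p / (p - 1)) * 2 powr (p - 1)"
  have "weak_functional p d (local_max F) \<le> ennreal ?C * strong_functional p d F"
    if [measurable]: "F \<in> borel_measurable borel" for F
    using weak_functional_le_strong_functional[of p "local_max F" d] local_max_strong_type[OF that p1, of d] p1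
    unfolding strong_functional_def by (auto intro: order_trans)
  thus ?thesis using p1 by (intro exI[of _ ?C]) auto
qed

context dilation_functional
begin

lemma tail_and_local_le:
  assumes d: "d > -1"
  shows "\<exists>C\<ge>0. \<forall>F\<in>borel_measurable borel. \<Phi> (\<lambda>x. hardy_tail F x + local_max F x) \<le> ennreal C * \<Phi> (local_max F)"
proof -
  have "(10/9) powr (- d - 1) < (1::real)" using d powr_less_mono[of "-d-1" 0 "10/9"] by simp
  then obtain C where C: "C \<ge> 0" "\<And>g. g \<in> borel_measurable borel \<Longrightarrow> \<Phi> (dilated_sum 1 (10/9) g) \<le> ennreal C * \<Phi> g"
    using dilated_sum_le[of "10/9" 1] by auto
  have "\<Phi> (\<lambda>x. hardy_tail F x + local_max F x) \<le> ennreal (2 powr p * (C + 1)) * \<Phi> (local_max F)"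
    if F[measurable]: "F \<in> borel_measurable borel" for F
  proof -
    have "\<Phi> (\<lambda>x. hardy_tail F x + local_max F x) \<le> \<Phi> (\<lambda>x. dilated_sum 1 (10/9) (local_max F) x + local_max F x)"
      by (intro mono add_right_mono hardy_tail_le_dilated_sum) auto
    also have "\<dots> \<le> ennreal (2 powr p) * (\<Phi> (dilated_sum 1 (10/9) (local_max F)) + \<Phi> (local_max F))"
      by (intro add_le) auto
    also have "\<dots> \<le> ennreal (2 powr p) * (ennreal C * \<Phi> (local_max F) + \<Phi> (local_max F))"
      by (intro mult_left_mono add_right_mono C) auto
    also have "\<dots> = ennreal (2 powr p) * (ennreal (C + 1) * \<Phi> (local_max F))"
      using C by (simp add: distrib_right)
    also have "\<dots> = ennreal (2 powr p * (C + 1)) * \<Phi> (local_max F)" using C by (intro ennreal_cmult_cmult) auto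
    finally show ?thesis .
  qed
  thus ?thesis using C by (intro exI[of _ "2 powr p * (C + 1)"]) auto
qed

lemma dominating_le:
  assumes d: "d > -1" "d < (2 * l + 1) * p - 1"
  shows "\<exists>C\<ge>0. \<forall>F\<in>borel_measurable borel. \<Phi> (dominating l F) \<le> ennreal C * \<Phi> (local_max F)"
proof -
  obtain C where C: "C \<ge> 0" "\<And>F. F \<in> borel_measurable borel \<Longrightarrow> \<Phi> (\<lambda>x. hardy_tail F x + local_max F x) \<le> ennreal C * \<Phi> (local_max F)"
    using tail_and_local_le[OF d(1)] by blast
  let ?b = "(9/10 :: real) powr (2 * l + 1)"
  have "?b powr p * (9/10) powr (- d - 1) = (9/10) powr ((2 * l + 1) * p - d - 1)"
    by (simp only: powr_powr powr_add[symmetric]) (simp add: algebra_simps)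
  also have "\<dots> < 1" using d powr_less_mono2[of "(2 * l + 1) * p - d - 1" "9/10" 1] by simp
  finally have lt: "?b powr p * (9/10) powr (- d - 1) < 1" .
  have "(0 :: real) < 9/10" "0 < ?b" by simp_all
  from dilated_sum_le[OF this lt] obtain B where B: "B \<ge> 0"
    "\<And>g. g \<in> borel_measurable borel \<Longrightarrow> \<Phi> (dilated_sum ?b (9/10) g) \<le> ennreal B * \<Phi> g" by blast
  define K where "K = (2 powr \<bar>2 * l\<bar>) powr p * B"
  have K: "K \<ge> 0" using B by (simp add: K_def)
  have "\<Phi> (dominating l F) \<le> ennreal (2 powr p * (K + C)) * \<Phi> (local_max F)"
    if F[measurable]: "F \<in> borel_measurable borel" for F
  proof -
    have "\<Phi> (hardy_mean l F) \<le> \<Phi> (\<lambda>x. ennreal (2 powr \<bar>2 * l\<bar>) * dilated_sum ?b (9/10) (local_max F) x)"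
      by (intro mono hardy_mean_le_dilated_sum) auto
    also have "\<dots> \<le> ennreal ((2 powr \<bar>2 * l\<bar>) powr p) * \<Phi> (dilated_sum ?b (9/10) (local_max F))"
      by (intro cmult_le) auto
    also have "\<dots> \<le> ennreal ((2 powr \<bar>2 * l\<bar>) powr p) * (ennreal B * \<Phi> (local_max F))"
      by (intro mult_left_mono B) auto
    also have "\<dots> = ennreal K * \<Phi> (local_max F)" unfolding K_def using B by (intro ennreal_cmult_cmult) auto
    finally have H: "\<Phi> (hardy_mean l F) \<le> ennreal K * \<Phi> (local_max F)" .
    have "\<Phi> (dominating l F) \<le> ennreal (2 powr p) * (\<Phi> (hardy_mean l F) + \<Phi> (\<lambda>x. hardy_tail F x + local_max F x))"
      unfolding dominating_def by (intro add_le) auto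
    also have "\<dots> \<le> ennreal (2 powr p) * (ennreal K * \<Phi> (local_max F) + ennreal C * \<Phi> (local_max F))"
      by (intro mult_left_mono add_mono H C) auto
    also have "\<dots> = ennreal (2 powr p) * (ennreal (K + C) * \<Phi> (local_max F))"
      using C K by (simp add: distrib_right)
    also have "\<dots> = ennreal (2 powr p * (K + C)) * \<Phi> (local_max F)" using C K by (intro ennreal_cmult_cmult) auto
    finally show ?thesis .
  qed
  thus ?thesis using C K by (intro exI[of _ "2 powr p * (K + C)"]) auto
qed

end

theorem dominating_strong_type:
  assumes p: "p > 1" and d: "d > -1" "d < (2 * l + 1) * p - 1"
  shows "\<exists>C\<ge>0. \<forall>F\<in>borel_measurable borel. strong_functional p d (dominating l F) \<le> ennreal C * strong_functional p d F"
proof -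
  interpret dilation_functional "strong_functional p d" p d by (rule strong_functional) (use p in simp)
  obtain C where C: "C \<ge> 0" "\<And>F. F \<in> borel_measurable borel \<Longrightarrow> strong_functional p d (dominating l F) \<le> ennreal C * strong_functional p d (local_max F)"
    using dominating_le[OF d] by blast
  let ?B = "10 * 4 powr \<bar>d\<bar> * (p / (p - 1)) * 2 powr (p - 1)"
  have "strong_functional p d (dominating l F) \<le> ennreal (C * ?B) * strong_functional p d F"
    if F[measurable]: "F \<in> borel_measurable borel" for F
  proof -
    have M: "strong_functional p d (local_max F) \<le> ennreal ?B * strong_functional p d F"
      unfolding strong_functional_def by (rule local_max_strong_type[OF F p])
    have "strong_functional p d (dominating l F) \<le> ennreal C * (ennreal ?B * strong_functional p d F)"
      by (rule order_trans[OF C(2)[OF F] mult_left_mono[OF M]]) simp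
    also have "\<dots> = ennreal (C * ?B) * strong_functional p d F" using C p by (intro ennreal_cmult_cmult) auto
    finally show ?thesis .
  qed
  thus ?thesis using C p by (intro exI[of _ "C * ?B"]) auto
qed

theorem dominating_weak_type:
  assumes p: "p \<ge> 1" and d: "d > -1" "d < (2 * l + 1) * p - 1"
  shows "\<exists>C\<ge>0. \<forall>F\<in>borel_measurable borel. weak_functional p d (dominating l F) \<le> ennreal C * strong_functional p d F"
proof -
  interpret dilation_functional "weak_functional p d" p d by (rule weak_functional) (use p in simp)
  obtain C where C: "C \<ge> 0" "\<And>F. F \<in> borel_measurable borel \<Longrightarrow> weak_functional p d (dominating l F) \<le> ennreal C * weak_functional p d (local_max F)"
    using dominating_le[OF d] by blast
  obtain B where B: "B \<ge> 0" "\<And>F. F \<in> borel_measurable borel \<Longrightarrow> weak_functional p d (local_max F) \<le> ennreal B * strong_functional p d F"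
    using weak_functional_local_max[OF p] by blast
  have "weak_functional p d (dominating l F) \<le> ennreal (C * B) * strong_functional p d F"
    if F[measurable]: "F \<in> borel_measurable borel" for F
  proof -
    have "weak_functional p d (dominating l F) \<le> ennreal C * (ennreal B * strong_functional p d F)"
      by (rule order_trans[OF C(2)[OF F] mult_left_mono[OF B(2)[OF F]]]) simp
    also have "\<dots> = ennreal (C * B) * strong_functional p d F" using C B by (intro ennreal_cmult_cmult) auto
    finally show ?thesis .
  qed
  thus ?thesis using C B by (intro exI[of _ "C * B"]) auto
qed

text \<open>
  The superlevel sets of \<open>x\<^bsup>-2l-1\<^esup>\<close> are intervals \<open>(0, R)\<close>, and at the critical exponent the weighted measure of such an interval
  is exactly proportional to \<open>\<gamma>\<^bsup>-p\<^esup>\<close>.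
\<close>

lemma weak_functional_power:
  assumes l: "l > -1/2" and p: "p > 0" and d: "d + 1 = (2 * l + 1) * p"
  shows "weak_functional p d (\<lambda>x. ennreal (x powr (- 2 * l - 1)) * K) \<le> ennreal (1 / (d + 1)) * epowr K p"
proof (cases K)
  case (real \<kappa>)
  have d1: "d + 1 > 0" unfolding d using l p by simp
  show ?thesis
  proof (rule weak_functional_leI)
    fix \<gamma> :: real assume \<gamma>: "\<gamma> > 0"
    \<comment> \<open>The solution of \<open>\<kappa> * x powr (- 2 * l - 1) = \<gamma>\<close>.\<close>
    define R where "R = (\<kappa> / \<gamma>) powr (1 / (2 * l + 1))"
    have "x \<in> {0<..R}" if x: "x > 0" and lt: "ennreal \<gamma> < ennreal (x powr (- 2 * l - 1)) * K" for x
    proof -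
      have "\<gamma> < x powr (- 2 * l - 1) * \<kappa>" using lt real \<gamma> by (simp add: ennreal_less_iff flip: ennreal_mult)
      hence "x powr (2 * l + 1) * \<gamma> < x powr (2 * l + 1) * (x powr (- 2 * l - 1) * \<kappa>)" using x by simp
      also have "\<dots> = (x powr (2 * l + 1) * x powr (- 2 * l - 1)) * \<kappa>" by (simp only: mult.assoc)
      also have "x powr (2 * l + 1) * x powr (- 2 * l - 1) = 1" using x by (simp only: powr_add[symmetric]) simp
      finally have "x powr (2 * l + 1) \<le> \<kappa> / \<gamma>" using \<gamma> by (simp only: mult_1 pos_le_divide_eq less_imp_le)
      hence "(x powr (2 * l + 1)) powr (1 / (2 * l + 1)) \<le> R" unfolding R_def using l by (intro powr_mono2) auto
      moreover have "(x powr (2 * l + 1)) powr (1 / (2 * l + 1)) = x" unfolding powr_powr using x l by simp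
      ultimately show ?thesis using x by simp
    qed
    hence "emeasure (half_line_measure d) {x. ennreal \<gamma> < ennreal (x powr (- 2 * l - 1)) * K} \<le> emeasure (half_line_measure d) {0<..R}"
      by (intro emeasure_half_line_mono) auto
    also have "\<dots> = ennreal (R powr (d + 1) / (d + 1))" by (rule emeasure_half_line_initial) (use d1 in \<open>auto simp: R_def\<close>)
    also have "R powr (d + 1) = (\<kappa> / \<gamma>) powr p" unfolding R_def d powr_powr using l by simp
    finally have "ennreal (\<gamma> powr p) * emeasure (half_line_measure d) {x. ennreal \<gamma> < ennreal (x powr (- 2 * l - 1)) * K}
       \<le> ennreal (\<gamma> powr p) * ennreal ((\<kappa> / \<gamma>) powr p / (d + 1))" by (rule mult_left_mono) simp
    also have "\<dots> = ennreal (1 / (d + 1)) * epowr K p"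
    proof -
      have "\<gamma> powr p * ((\<kappa> / \<gamma>) powr p / (d + 1)) = 1 / (d + 1) * \<kappa> powr p" using \<gamma> by (simp add: powr_divide)
      thus ?thesis unfolding real(2) using real(1) d1 by (simp only: epowr_ennreal ennreal_mult[symmetric] powr_ge_zero divide_nonneg_pos zero_le_one)
    qed
    finally show "ennreal (\<gamma> powr p) * emeasure (half_line_measure d) {x. ennreal \<gamma> < ennreal (x powr (- 2 * l - 1)) * K} \<le> ennreal (1 / (d + 1)) * epowr K p" .
  qed
next
  case top
  have "d + 1 > 0" unfolding d using l p by simp
  thus ?thesis using top by (simp add: ennreal_mult_top)
qed

text \<open>
  At the critical exponent the series of dilates for the Hardy mean diverges. If the integrals of
  \<open>F\<close> over all intervals \<open>(0, x]\<close> have a common bound \<open>K\<close>, then the Hardy mean is at most \<open>K x\<^bsup>-2l-1\<^esup>\<close>, which is of weak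
  type. The tail and the local part are not affected.
\<close>

lemma weak_endpoint:
  assumes l: "l > -1/2" and p: "p \<ge> 1" and d: "d + 1 = (2 * l + 1) * p"
  shows "\<exists>C\<ge>0. \<forall>F\<in>borel_measurable borel. \<forall>K. (\<forall>x>0. (\<integral>\<^sup>+y\<in>{0<..x}. ennreal (y powr (2 * l)) * F y \<partial>lborel) \<le> K) \<longrightarrow>
     weak_functional p d (dominating l F) \<le> ennreal C * (epowr K p + strong_functional p d F)"
proof -
  interpret dilation_functional "weak_functional p d" p d by (rule weak_functional) (use p in simp)
  have "(2 * l + 1) * p > 0" using l p by simp
  hence d1: "d > -1" using d by linarith
  obtain C where C: "C \<ge> 0" "\<And>F. F \<in> borel_measurable borel \<Longrightarrow> weak_functional p d (\<lambda>x. hardy_tail F x + local_max F x) \<le> ennreal C * weak_functional p d (local_max F)"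
    using tail_and_local_le[OF d1] by blast
  obtain B where B: "B \<ge> 0" "\<And>F. F \<in> borel_measurable borel \<Longrightarrow> weak_functional p d (local_max F) \<le> ennreal B * strong_functional p d F"
    using weak_functional_local_max[OF p] by blast
  define A where "A = 1 / (d + 1) + C * B"
  have A: "A \<ge> 0" "1 / (d + 1) \<le> A" "C * B \<le> A" using C B d1 by (auto simp: A_def)
  have "weak_functional p d (dominating l F) \<le> ennreal (2 powr p * A) * (epowr K p + strong_functional p d F)"
    if F[measurable]: "F \<in> borel_measurable borel" and K: "\<forall>x>0. (\<integral>\<^sup>+y\<in>{0<..x}. ennreal (y powr (2 * l)) * F y \<partial>lborel) \<le> K" for F K
  proof -
    have "weak_functional p d (hardy_mean l F) \<le> weak_functional p d (\<lambda>x. ennreal (x powr (- 2 * l - 1)) * K)"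
      by (rule mono) (use K in \<open>auto simp: hardy_mean_def intro!: mult_left_mono\<close>)
    also have "\<dots> \<le> ennreal (1 / (d + 1)) * epowr K p" by (rule weak_functional_power) (use l p d in auto)
    also have "\<dots> \<le> ennreal A * epowr K p" by (intro mult_right_mono ennreal_leI A) auto
    finally have H: "weak_functional p d (hardy_mean l F) \<le> ennreal A * epowr K p" .
    have "weak_functional p d (\<lambda>x. hardy_tail F x + local_max F x) \<le> ennreal C * (ennreal B * strong_functional p d F)"
      by (rule order_trans[OF C(2)[OF F] mult_left_mono[OF B(2)[OF F]]]) simp
    also have "\<dots> = ennreal (C * B) * strong_functional p d F" using C B by (intro ennreal_cmult_cmult) auto
    also have "\<dots> \<le> ennreal A * strong_functional p d F" by (intro mult_right_mono ennreal_leI A) auto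
    finally have T: "weak_functional p d (\<lambda>x. hardy_tail F x + local_max F x) \<le> ennreal A * strong_functional p d F" .
    have "weak_functional p d (dominating l F) \<le> ennreal (2 powr p) * (weak_functional p d (hardy_mean l F) + weak_functional p d (\<lambda>x. hardy_tail F x + local_max F x))"
      unfolding dominating_def by (intro add_le) auto
    also have "\<dots> \<le> ennreal (2 powr p) * (ennreal A * epowr K p + ennreal A * strong_functional p d F)"
      by (intro mult_left_mono add_mono H T) auto
    also have "\<dots> = ennreal (2 powr p * A) * (epowr K p + strong_functional p d F)"
      unfolding distrib_left[symmetric] using A by (intro ennreal_cmult_cmult) auto
    finally show ?thesis .
  qed
  thus ?thesis using A by (intro exI[of _ "2 powr p * A"]) auto
qed

theorem dominating_weak_type_1:
  assumes l: "l > -1/2"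
  shows "\<exists>C\<ge>0. \<forall>F\<in>borel_measurable borel. weak_functional 1 (2 * l) (dominating l F) \<le> ennreal C * strong_functional 1 (2 * l) F"
proof -
  obtain C where C: "C \<ge> 0" "\<forall>F\<in>borel_measurable borel. \<forall>K. (\<forall>x>0. (\<integral>\<^sup>+y\<in>{0<..x}. ennreal (y powr (2 * l)) * F y \<partial>lborel) \<le> K) \<longrightarrow>
     weak_functional 1 (2 * l) (dominating l F) \<le> ennreal C * (epowr K 1 + strong_functional 1 (2 * l) F)"
  proof -
    have "2 * l + 1 = (2 * l + 1) * 1" by simp
    from weak_endpoint[OF l order_refl this] show ?thesis by (elim exE conjE) (rule that)
  qed
  have "weak_functional 1 (2 * l) (dominating l F) \<le> ennreal (C * 2) * strong_functional 1 (2 * l) F"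
    if F[measurable]: "F \<in> borel_measurable borel" for F
  proof -
    have le: "(\<integral>\<^sup>+y\<in>{0<..x}. ennreal (y powr (2 * l)) * F y \<partial>lborel) \<le> strong_functional 1 (2 * l) F" for x
      unfolding strong_functional_def epowr_one nn_integral_half_line[OF F]
      by (intro nn_integral_mono) (auto split: split_indicator)
    have "weak_functional 1 (2 * l) (dominating l F) \<le> ennreal C * (epowr (strong_functional 1 (2 * l) F) 1 + strong_functional 1 (2 * l) F)"
      by (rule C(2)[rule_format, OF F]) (rule le)
    also have "epowr (strong_functional 1 (2 * l) F) 1 + strong_functional 1 (2 * l) F = ennreal 2 * strong_functional 1 (2 * l) F"
    proof -
      have "ennreal 2 = 2" by simp
      thus ?thesis by (simp only: epowr_one mult_2)
    qed
    also have "ennreal C * (ennreal 2 * strong_functional 1 (2 * l) F) = ennreal (C * 2) * strong_functional 1 (2 * l) F" using C by (intro ennreal_cmult_cmult) auto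
    finally show ?thesis .
  qed
  thus ?thesis using C by (intro exI[of _ "C * 2"]) auto
qed

text \<open>
  Among all sets of given weighted measure, an interval \<open>(0, R)\<close> has the largest measure for the smaller power.
  Instead of a rearrangement it suffices to split \<open>E\<close> at the \<open>R\<close> for which \<open>(0, R)\<close> has about the weighted measure of \<open>E\<close>: below \<open>R\<close> the set
  is enlarged to \<open>(0, R]\<close>, above \<open>R\<close> the weights are compared pointwise.
\<close>

lemma measure_of_set_by_weighted_measure:
  assumes l: "l > -1/2" and p: "p \<ge> 1" and d: "d + 1 = (2 * l + 1) * p" and [measurable]: "E \<in> sets borel"
  shows "(\<integral>\<^sup>+y\<in>{0<..x}. ennreal (y powr (2 * l)) * indicator E y \<partial>lborel)
     \<le> ennreal (1 / (2 * l + 1) + 1) * epowr (emeasure (half_line_measure d) E) (1 / p)"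
proof (cases "emeasure (half_line_measure d) E")
  case (real m)
  show ?thesis
  proof (cases "m = 0")
    case True
    hence "(\<integral>\<^sup>+y. ennreal (y powr d) * indicator {0<..} y * indicator E y \<partial>lborel) = 0"
      using real by (simp add: emeasure_half_line)
    hence "AE y in lborel. ennreal (y powr d) * indicator {0<..} y * indicator E y = 0"
      by (subst (asm) nn_integral_0_iff_AE) auto
    hence "AE y in lborel. ennreal (y powr (2 * l)) * indicator E y * indicator {0<..x} y = 0"
      by eventually_elim (auto split: split_indicator_asm split_indicator)
    hence "(\<integral>\<^sup>+y\<in>{0<..x}. ennreal (y powr (2 * l)) * indicator E y \<partial>lborel) = 0"
      by (subst nn_integral_0_iff_AE) auto
    thus ?thesis by simp
  next
    case False
    hence m: "m > 0" using real by simp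
    have d1: "d + 1 > 0" unfolding d using l p by simp
    have "(2 * l + 1) * 1 \<le> (2 * l + 1) * p" by (rule mult_left_mono) (use l p in auto)
    hence "2 * l + 1 \<le> d + 1" unfolding d by (simp only: mult_1_right)
    hence d2: "2 * l \<le> d" by simp
    define R where "R = m powr (1 / (d + 1))"
    have R: "R > 0" using m by (simp add: R_def)
    have R1: "R powr (2 * l + 1) = m powr (1 / p)" unfolding R_def powr_powr d using l p by simp
    have R2: "R powr (2 * l - d) * m = m powr (1 / p)"
    proof -
      have "R powr (d + 1) = m" unfolding R_def powr_powr using m d1 by simp
      hence "R powr (2 * l - d) * m = R powr (2 * l - d) * R powr (d + 1)" by simp
      also have "\<dots> = R powr (2 * l + 1)" by (simp only: powr_add[symmetric]) simp
      finally show ?thesis by (simp add: R1)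
    qed
    have "ennreal (y powr (2 * l)) * indicator E y * indicator {0<..x} y \<le> ennreal (y powr (2 * l)) * indicator {0<..R} y
         + ennreal (R powr (2 * l - d)) * (ennreal (y powr d) * indicator {0<..} y * indicator E y)" for y
    proof (cases "y > R")
      case True
      have "y powr (2 * l) = y powr (2 * l - d) * y powr d" by (simp only: powr_add[symmetric]) simp
      also have "\<dots> \<le> R powr (2 * l - d) * y powr d"
        using True R d2 by (intro mult_right_mono powr_mono2') auto
      finally have "ennreal (y powr (2 * l)) \<le> ennreal (R powr (2 * l - d)) * ennreal (y powr d)"
        by (simp flip: ennreal_mult)
      thus ?thesis using True R by (auto split: split_indicator)
    qed (auto split: split_indicator)
    hence "(\<integral>\<^sup>+y\<in>{0<..x}. ennreal (y powr (2 * l)) * indicator E y \<partial>lborel) \<le> (\<integral>\<^sup>+y. ennreal (y powr (2 * l)) * indicator {0<..R} y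
         + ennreal (R powr (2 * l - d)) * (ennreal (y powr d) * indicator {0<..} y * indicator E y) \<partial>lborel)"
      by (intro nn_integral_mono)
    also have "\<dots> = ennreal (R powr (2 * l + 1) / (2 * l + 1)) + ennreal (R powr (2 * l - d)) * emeasure (half_line_measure d) E"
      using l R by (subst nn_integral_add) (auto simp: nn_integral_cmult nn_integral_powr_from_0 emeasure_half_line)
    also have "\<dots> = ennreal (1 / (2 * l + 1) + 1) * epowr (emeasure (half_line_measure d) E) (1 / p)"
    proof -
      have "m powr (1 / p) / (2 * l + 1) + R powr (2 * l - d) * m = (1 / (2 * l + 1) + 1) * m powr (1 / p)"
        unfolding R2 by (simp add: distrib_right)
      moreover have "ennreal (R powr (2 * l + 1) / (2 * l + 1)) + ennreal (R powr (2 * l - d)) * ennreal m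
         = ennreal (m powr (1 / p) / (2 * l + 1) + R powr (2 * l - d) * m)"
        unfolding R1 using l m by (subst ennreal_mult[symmetric], simp, simp, subst ennreal_plus) auto
      moreover have "0 \<le> 1 / (2 * l + 1) + 1" using l by simp
      ultimately show ?thesis unfolding real(2) using real(1) by (simp only: epowr_ennreal ennreal_mult powr_ge_zero)
    qed
    finally show ?thesis .
  qed
next
  case top
  have "1 / (2 * l + 1) + 1 > 0" using l by (simp add: add_pos_pos)
  hence "ennreal (1 / (2 * l + 1) + 1) \<noteq> 0" by (simp del: ennreal_plus)
  thus ?thesis using top by (simp add: ennreal_mult_top del: ennreal_plus)
qed

lemma strong_functional_indicator:
  assumes [measurable]: "E \<in> sets borel"
  shows "strong_functional p d (indicator E) = emeasure (half_line_measure d) E"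
proof -
  have "epowr (indicator E x) p = indicator E x" for x
    using epowr_ennreal[of 1 p] by (auto split: split_indicator simp del: epowr_ennreal)
  thus ?thesis by (simp add: strong_functional_def)
qed

theorem dominating_restricted_weak_type:
  assumes l: "l > -1/2" and p: "p \<ge> 1" and d: "d + 1 = (2 * l + 1) * p"
  shows "\<exists>C\<ge>0. \<forall>E\<in>sets borel. weak_functional p d (dominating l (indicator E)) \<le> ennreal C * emeasure (half_line_measure d) E"
proof -
  obtain C where C: "C \<ge> 0" "\<forall>F\<in>borel_measurable borel. \<forall>K. (\<forall>x>0. (\<integral>\<^sup>+y\<in>{0<..x}. ennreal (y powr (2 * l)) * F y \<partial>lborel) \<le> K) \<longrightarrow>
     weak_functional p d (dominating l F) \<le> ennreal C * (epowr K p + strong_functional p d F)"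
    using weak_endpoint[OF l p d] by (elim exE conjE) (rule that)
  define A where "A = 1 / (2 * l + 1) + 1"
  have A: "A > 0" using l by (simp add: A_def add_pos_pos)
  have "weak_functional p d (dominating l (indicator E)) \<le> ennreal (C * (A powr p + 1)) * emeasure (half_line_measure d) E"
    if [measurable]: "E \<in> sets borel" for E
  proof -
    let ?m = "emeasure (half_line_measure d) E"
    have "weak_functional p d (dominating l (indicator E)) \<le> ennreal C * (epowr (ennreal A * epowr ?m (1 / p)) p + strong_functional p d (indicator E))"
      using C(2)[rule_format, of "indicator E" "ennreal A * epowr ?m (1 / p)"] measure_of_set_by_weighted_measure[OF l p d that]
      unfolding A_def by simp
    also have "epowr (ennreal A * epowr ?m (1 / p)) p = ennreal (A powr p) * ?m"
      using A p by (simp add: epowr_cmult epowr_epowr)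
    also have "strong_functional p d (indicator E) = ?m" by (rule strong_functional_indicator[OF that])
    also have "ennreal C * (ennreal (A powr p) * ?m + ?m) = ennreal C * (ennreal (A powr p + 1) * ?m)"
      by (simp add: distrib_right)
    also have "\<dots> = ennreal (C * (A powr p + 1)) * ?m" using C by (intro ennreal_cmult_cmult) auto
    finally show ?thesis .
  qed
  thus ?thesis using C by (intro exI[of _ "C * (A powr p + 1)"]) auto
qed

section \<open>Lebesgue measurable functions and measurability of the maximal function\<close>

lemma space_power_measure [simp]: "space (power_measure d) = {0<..}"
  by (simp add: power_measure_def)

lemma sets_power_measure [simp, measurable_cong]: "sets (power_measure d) = sets (lebesgue_on {0<..})"
  by (simp add: power_measure_def)

lemma borel_measurable_lebesgue_onI [measurable (raw)]: "g \<in> borel_measurable borel \<Longrightarrow> g \<in> borel_measurable (lebesgue_on S)"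
  by (simp add: measurable_completion measurable_restrict_space1)

lemma borel_measurable_power_measure_cong: "borel_measurable (power_measure d) = borel_measurable (lebesgue_on {0<..})"
  by (rule measurable_cong_sets) auto

lemma nn_integral_power_measure:
  assumes g[measurable]: "g \<in> borel_measurable (lebesgue_on {0<..})"
  shows "(\<integral>\<^sup>+x. g x \<partial>power_measure d) = (\<integral>\<^sup>+x. ennreal (x powr d) * indicator {0<..} x * g x \<partial>lborel)"
proof -
  have "(\<integral>\<^sup>+x. g x \<partial>power_measure d) = (\<integral>\<^sup>+x. ennreal (x powr d) * g x \<partial>lebesgue_on {0<..})"
    unfolding power_measure_def by (rule nn_integral_density) measurable
  also have "\<dots> = (\<integral>\<^sup>+x. ennreal (x powr d) * g x * indicator {0<..} x \<partial>lebesgue)"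
    by (rule nn_integral_restrict_space) auto
  also have "\<dots> = (\<integral>\<^sup>+x. ennreal (x powr d) * indicator {0<..} x * g x \<partial>lborel)"
    unfolding nn_integral_completion by (simp add: mult_ac)
  finally show ?thesis .
qed

lemma nn_integral_power_measure_borel:
  assumes "g \<in> borel_measurable borel"
  shows "(\<integral>\<^sup>+x. g x \<partial>power_measure d) = (\<integral>\<^sup>+x. g x \<partial>half_line_measure d)"
  using assms by (subst nn_integral_power_measure) (auto simp: nn_integral_half_line)

lemma emeasure_power_measure_borel:
  assumes "A \<in> sets borel" "A \<subseteq> {0<..}"
  shows "emeasure (power_measure d) A = emeasure (half_line_measure d) A"
proof -
  have "A \<in> sets (power_measure d)" using assms by (auto simp: sets_restrict_space_iff)
  hence "emeasure (power_measure d) A = (\<integral>\<^sup>+x. indicator A x \<partial>power_measure d)" by (rule nn_integral_indicator[symmetric])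
  also have "\<dots> = emeasure (half_line_measure d) A"
    using assms by (subst nn_integral_power_measure_borel) auto
  finally show ?thesis .
qed

lemma AE_lebesgue_on_half_line: "(AE x in lebesgue_on {0<..}. P x) \<longleftrightarrow> (AE x in lborel. x > (0::real) \<longrightarrow> P x)"
proof -
  have "(AE x in lebesgue_on {0<..}. P x) \<longleftrightarrow> (AE x in lebesgue. x \<in> {0<..} \<longrightarrow> P x)"
    by (rule AE_restrict_space_iff) auto
  also have "\<dots> \<longleftrightarrow> (AE x in lborel. x > (0::real) \<longrightarrow> P x)"
    unfolding AE_completion_iff by simp
  finally show ?thesis .
qed

text \<open>
  A Borel representative of \<open>|f|\<close> on the half-line; it makes the estimates for Borel functions applicable to \<open>f\<close>.
\<close>

definition borel_modulus :: "(real \<Rightarrow> complex) \<Rightarrow> (real \<Rightarrow> ennreal) \<Rightarrow> bool" where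
  "borel_modulus f F \<longleftrightarrow> F \<in> borel_measurable borel \<and> (AE x in lborel. x > 0 \<longrightarrow> F x = emod f x)"

lemma borel_measurable_emod [measurable]: "f \<in> borel_measurable M \<Longrightarrow> emod f \<in> borel_measurable M"
  unfolding emod_def by measurable

lemma borel_modulus_exists:
  assumes f: "f \<in> borel_measurable (lebesgue_on {0<..})"
  shows "\<exists>F. borel_modulus f F"
proof -
  have "emod f \<in> borel_measurable (lebesgue_on {0<..})" using f by measurable
  hence "(\<lambda>x. emod f x * indicator {0<..} x) \<in> borel_measurable lebesgue"
    by (subst (asm) borel_measurable_restrict_space_iff_ennreal) auto
  from completion_ex_borel_measurable[OF this] obtain F
    where "F \<in> borel_measurable lborel" "AE x in lborel. emod f x * indicator {0<..} x = F x" by auto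
  hence "F \<in> borel_measurable borel" "AE x in lborel. x > 0 \<longrightarrow> F x = emod f x" by auto
  thus ?thesis unfolding borel_modulus_def by blast
qed

lemma nn_integral_borel_modulus:
  assumes F: "borel_modulus f F" and f: "f \<in> borel_measurable (lebesgue_on {0<..})"
    and h: "\<And>u :: real \<Rightarrow> ennreal. u \<in> borel_measurable (lebesgue_on {0<..}) \<Longrightarrow> (\<lambda>x. h x (u x)) \<in> borel_measurable (lebesgue_on {0<..})"
      "(\<lambda>x. h x (F x)) \<in> borel_measurable borel"
  shows "(\<integral>\<^sup>+x. h x (emod f x) \<partial>power_measure d) = (\<integral>\<^sup>+x. h x (F x) \<partial>half_line_measure d)"
proof -
  have "emod f \<in> borel_measurable (lebesgue_on {0<..})" using f by measurable
  hence "(\<integral>\<^sup>+x. h x (emod f x) \<partial>power_measure d) = (\<integral>\<^sup>+x. ennreal (x powr d) * indicator {0<..} x * h x (emod f x) \<partial>lborel)"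
    by (intro nn_integral_power_measure h(1))
  also have "\<dots> = (\<integral>\<^sup>+x. ennreal (x powr d) * indicator {0<..} x * h x (F x) \<partial>lborel)"
    using F unfolding borel_modulus_def by (intro nn_integral_cong_AE) (auto elim!: eventually_mono split: split_indicator)
  also have "\<dots> = (\<integral>\<^sup>+x. h x (F x) \<partial>half_line_measure d)" using h(2) by (rule nn_integral_half_line[symmetric])
  finally show ?thesis .
qed

lemma lp_norm_borel_modulus:
  assumes F: "borel_modulus f F" and f: "f \<in> borel_measurable (lebesgue_on {0<..})"
  shows "lp_norm (power_measure d) p (emod f) = epowr (strong_functional p d F) (1 / p)"
proof -
  have [measurable]: "F \<in> borel_measurable borel" using F by (simp add: borel_modulus_def)
  show ?thesis unfolding lp_norm_def strong_functional_def
    by (subst nn_integral_borel_modulus[OF F f, of "\<lambda>x u. epowr u p"]) auto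
qed

text \<open>
  Integrability of \<open>f\<close> against this weight makes all heat integrals of \<open>f\<close> converge. The weight is
  integrable against \<open>y\<^bsup>2l\<^esup>\<close>, so that bounded functions are included.
\<close>

definition growth_weight :: "real \<Rightarrow> real \<Rightarrow> real" where
  "growth_weight l y = min 1 (y powr (- 2 * l - 2))"

lemma borel_measurable_growth_weight [measurable]: "growth_weight l \<in> borel_measurable borel"
  unfolding growth_weight_def[abs_def] by measurable

definition heat_admissible :: "real \<Rightarrow> (real \<Rightarrow> complex) \<Rightarrow> bool" where
  "heat_admissible l f \<longleftrightarrow> f \<in> borel_measurable (lebesgue_on {0<..}) \<and>
     (\<integral>\<^sup>+y. ennreal (growth_weight l y) * emod f y \<partial>power_measure (2 * l)) < top"

text \<open>
  A bound that is uniform for \<open>x\<close> in a neighbourhood of \<open>x0\<close>, as dominated convergence needs it.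
\<close>

lemma heat_kernel_le_growth_weight:
  assumes l: "l > -1/2" and t: "t > 0" and x0: "x0 > 0"
  shows "\<exists>K>0. \<forall>x y. x0/2 \<le> x \<and> x \<le> 2*x0 \<and> y > 0 \<longrightarrow> heat_kernel l t x y \<le> K * growth_weight l y"
proof -
  have "- 1/2 \<le> l + 1/2" using l by simp
  from heat_kernel_far[OF l this] obtain C1 where C1: "C1 > 0" and
    F1: "\<forall>t>0. \<forall>x>0. \<forall>y\<ge>10/9 * x. heat_kernel l t x y \<le> C1 * (y powr (-2*l - 1) * (y\<^sup>2 / t) powr (-1/2))" by blast
  from heat_kernel_far[OF l order_refl] obtain C2 where C2: "C2 > 0" and
    F2: "\<forall>t>0. \<forall>x>0. \<forall>y\<ge>10/9 * x. heat_kernel l t x y \<le> C2 * (y powr (-2*l - 1) * (y\<^sup>2 / t) powr (l + 1/2))" by blast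
  obtain C3 where C3: "C3 > 0" and N:
    "\<forall>t>0. \<forall>x>0. \<forall>y. 9/10 * x \<le> y \<and> y \<le> 10/9 * x \<longrightarrow>
     heat_kernel l t x y \<le> C3 * (x powr (-2*l) * (t powr (-1/2) * exp (- (x - y)\<^sup>2 / (4*t)) + 1 / x))"
    using heat_kernel_near[OF l] by blast
  have f1: "heat_kernel l t x y \<le> C1 * sqrt t * y powr (-2*l - 2)" if "x > 0" "y \<ge> 10/9 * x" for x y
  proof -
    have y: "y > 0" using that by linarith
    have "(y\<^sup>2 / t) powr (-1/2) = y powr (-1) * sqrt t"
      using y t by (simp add: powr_divide square_powr powr_minus_divide powr_half_sqrt)
    hence "y powr (-2*l - 1) * (y\<^sup>2 / t) powr (-1/2) = (y powr (-2*l - 1) * y powr (-1)) * sqrt t" by (simp only: mult.assoc)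
    also have "y powr (-2*l - 1) * y powr (-1) = y powr (-2*l - 2)"
    proof -
      have "(-2*l - 1) + (-1) = -2*l - 2" by simp
      thus ?thesis by (simp only: powr_add[symmetric])
    qed
    finally show ?thesis using F1 t that by (simp only: mult_ac) (metis mult.commute mult.left_commute)
  qed
  have f2: "heat_kernel l t x y \<le> C2 * t powr (-l - 1/2)" if "x > 0" "y \<ge> 10/9 * x" for x y
  proof -
    have y: "y > 0" using that by linarith
    have "(y\<^sup>2 / t) powr (l + 1/2) = y powr (2*l + 1) * t powr (-l - 1/2)"
    proof -
      have "t powr (-l - 1/2) = 1 / t powr (l + 1/2)" using powr_minus_divide[of t "l + 1/2"] by simp
      moreover have "(y\<^sup>2) powr (l + 1/2) = y powr (2*l + 1)" using y by (simp add: square_powr)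
      moreover have "(y\<^sup>2 / t) powr (l + 1/2) = (y\<^sup>2) powr (l + 1/2) / t powr (l + 1/2)" by (rule powr_divide)
      ultimately show ?thesis by simp
    qed
    hence "y powr (-2*l - 1) * (y\<^sup>2 / t) powr (l + 1/2) = (y powr (-2*l - 1) * y powr (2*l + 1)) * t powr (-l - 1/2)" by (simp only: mult.assoc)
    also have "y powr (-2*l - 1) * y powr (2*l + 1) = 1" using y by (simp only: powr_add[symmetric]) simp
    finally show ?thesis using F2[rule_format, OF t that] by (simp only: mult_1)
  qed
  define A where "A = C2 * t powr (-l - 1/2)"
  define B where "B = C1 * sqrt t"
  define Dn where "Dn = C3 * (2 powr \<bar>-2*l\<bar> * x0 powr (-2*l) * (t powr (-1/2) + 2 / x0))"
  \<comment> \<open>Unless \<open>y \<ge> 10/9 * x\<close>, one has \<open>y \<le> 3 * x0\<close>, and there \<open>g\<close> is a lower bound for the weight.\<close>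
  define g where "g = min 1 ((3 * x0) powr (-2*l - 2))"
  define K where "K = A + B + (A + Dn) / g"
  have pos: "A > 0" "B > 0" "Dn \<ge> 0" "g > 0"
    using t x0 C1 C2 C3 by (auto simp: A_def B_def Dn_def g_def)
  have K: "A \<le> K" "B \<le> K" "(A + Dn) / g \<le> K" "K > 0" using pos by (auto simp: K_def add_pos_nonneg)
  have small: "growth_weight l y \<ge> g" if "0 < y" "y \<le> 3 * x0" for y
  proof -
    have "(3 * x0) powr (-2*l - 2) \<le> y powr (-2*l - 2)" using that l by (intro powr_mono2') auto
    thus ?thesis by (auto simp: growth_weight_def g_def)
  qed
  have mid: "heat_kernel l t x y \<le> K * growth_weight l y" if "heat_kernel l t x y \<le> A + Dn" "0 < y" "y \<le> 3 * x0" for x y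
  proof -
    have "A + Dn = (A + Dn) / g * g" using pos by simp
    also have "\<dots> \<le> K * growth_weight l y" using K pos small[OF that(2,3)] by (intro mult_mono) auto
    finally show ?thesis using that(1) by simp
  qed
  have "heat_kernel l t x y \<le> K * growth_weight l y" if x: "x0/2 \<le> x" "x \<le> 2*x0" and y: "y > 0" for x y
  proof -
    have x_pos: "x > 0" using x x0 by linarith
    consider "y \<ge> 10/9 * x" | "y \<le> 9/10 * x" | "9/10 * x \<le> y" "y \<le> 10/9 * x" by linarith
    thus ?thesis
    proof cases
      case 1
      have "heat_kernel l t x y \<le> K * 1" using f2[OF x_pos 1] K by (simp add: A_def)
      moreover have "heat_kernel l t x y \<le> K * y powr (-2*l - 2)"
        using f1[OF x_pos 1] mult_right_mono[OF K(2), of "y powr (-2*l - 2)"] by (simp add: B_def)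
      ultimately show ?thesis unfolding growth_weight_def by (simp add: min_def)
    next
      case 2
      have "heat_kernel l t x y \<le> A" using f2[OF y, of x] 2 by (simp add: heat_kernel_commute[of l t x y] A_def)
      thus ?thesis using pos 2 x x0 by (intro mid) (use y in auto)
    next
      case 3
      have "(x / x0) powr (-2*l) \<le> 2 powr \<bar>-2*l\<bar>"
        by (rule powr_ratio_bound) (use x x0 in \<open>auto simp: field_simps\<close>)
      hence xx: "x powr (-2*l) \<le> 2 powr \<bar>-2*l\<bar> * x0 powr (-2*l)" using x0 by (simp add: powr_divide field_simps)
      have "t powr (-1/2) * exp (- (x - y)\<^sup>2 / (4*t)) \<le> t powr (-1/2) * 1"
        using t by (intro mult_left_mono) (auto simp: divide_nonpos_pos)
      moreover have "1 / x \<le> 2 / x0" using x x0 x_pos by (simp add: field_simps)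
      ultimately have "t powr (-1/2) * exp (- (x - y)\<^sup>2 / (4*t)) + 1 / x \<le> t powr (-1/2) + 2 / x0" by linarith
      hence "C3 * (x powr (-2*l) * (t powr (-1/2) * exp (- (x - y)\<^sup>2 / (4*t)) + 1 / x)) \<le> Dn"
        unfolding Dn_def using C3 x_pos xx by (intro mult_left_mono mult_mono) auto
      hence "heat_kernel l t x y \<le> A + Dn" using N[rule_format, OF t x_pos, of y] 3 pos by linarith
      thus ?thesis by (rule mid) (use y 3 x in auto)
    qed
  qed
  thus ?thesis using K by blast
qed

lemma heat_admissible_integrable:
  assumes l: "l > -1/2" and t: "t > 0" and x: "x > 0" and f: "heat_admissible l f"
  shows "integrable (power_measure (2 * l)) (\<lambda>y. complex_of_real (heat_kernel l t x y) * f y)"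
proof -
  have [measurable]: "f \<in> borel_measurable (lebesgue_on {0<..})" using f by (simp add: heat_admissible_def)
  obtain K where K: "K > 0" "\<forall>x' y. x/2 \<le> x' \<and> x' \<le> 2*x \<and> y > 0 \<longrightarrow> heat_kernel l t x' y \<le> K * growth_weight l y"
    using heat_kernel_le_growth_weight[OF l t x] by blast
  have W: "(\<lambda>y. complex_of_real (heat_kernel l t x y)) \<in> borel_measurable (lebesgue_on {0<..})"
    by (rule borel_measurable_lebesgue_onI) measurable
  have "(\<integral>\<^sup>+y. ennreal (norm (complex_of_real (heat_kernel l t x y) * f y)) \<partial>power_measure (2 * l))
     \<le> (\<integral>\<^sup>+y. ennreal K * (ennreal (growth_weight l y) * emod f y) \<partial>power_measure (2 * l))"
  proof (intro nn_integral_mono)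
    fix y assume "y \<in> space (power_measure (2 * l))"
    hence y: "y > 0" by simp
    have "norm (complex_of_real (heat_kernel l t x y) * f y) \<le> K * growth_weight l y * cmod (f y)"
      using K(2)[rule_format, of x y] x y heat_kernel_nonneg[OF l t x y] by (simp add: norm_mult mult_right_mono)
    thus "ennreal (norm (complex_of_real (heat_kernel l t x y) * f y)) \<le> ennreal K * (ennreal (growth_weight l y) * emod f y)"
      using K(1) y by (simp add: emod_def growth_weight_def ennreal_leI mult.assoc flip: ennreal_mult)
  qed
  also have "\<dots> = ennreal K * (\<integral>\<^sup>+y. ennreal (growth_weight l y) * emod f y \<partial>power_measure (2 * l))"
    by (rule nn_integral_cmult) measurable
  also have "\<dots> < top" using f by (simp add: heat_admissible_def ennreal_mult_less_top)
  finally show ?thesis using W by (intro integrableI_bounded) auto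
qed

lemma continuous_on_heat_integral:
  assumes l: "l > -1/2" and t: "t > 0" and f: "heat_admissible l f"
  shows "continuous_on {0<..} (heat_integral l t f)"
proof (rule continuous_at_imp_continuous_on, rule ballI)
  fix x0 :: real assume "x0 \<in> {0<..}"
  hence x0: "x0 > 0" by simp
  have f_meas[measurable]: "f \<in> borel_measurable (lebesgue_on {0<..})" using f by (simp add: heat_admissible_def)
  obtain K where K: "K > 0" "\<forall>x y. x0/2 \<le> x \<and> x \<le> 2*x0 \<and> y > 0 \<longrightarrow> heat_kernel l t x y \<le> K * growth_weight l y"
    using heat_kernel_le_growth_weight[OF l t x0] by blast
  show "isCont (heat_integral l t f) x0"
    unfolding continuous_at_sequentially o_def heat_integral_def
  proof (intro allI impI)
    fix X :: "nat \<Rightarrow> real" assume X: "X \<longlonglongrightarrow> x0"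
    \<comment> \<open>The sequence is truncated to the range in which the majorant is valid; this changes finitely many terms.\<close>
    define Y where "Y = (\<lambda>n. max (x0/2) (min (X n) (2*x0)))"
    have Y: "x0/2 \<le> Y n" "Y n \<le> 2*x0" "Y n > 0" for n using x0 by (auto simp: Y_def)
    have "eventually (\<lambda>n. x0/2 < X n \<and> X n < 2*x0) sequentially"
      using order_tendstoD[OF X, of "x0/2"] order_tendstoD[OF X, of "2*x0"] x0 by (auto intro: eventually_conj)
    hence XY: "eventually (\<lambda>n. Y n = X n) sequentially" by eventually_elim (auto simp: Y_def)
    have Ylim: "Y \<longlonglongrightarrow> x0" by (rule Lim_transform_eventually[OF X]) (use XY in \<open>auto elim: eventually_mono\<close>)
    have "(\<lambda>n. LINT y|power_measure (2 * l). complex_of_real (heat_kernel l t (Y n) y) * f y)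
       \<longlonglongrightarrow> (LINT y|power_measure (2 * l). complex_of_real (heat_kernel l t x0 y) * f y)"
    proof (rule integral_dominated_convergence[where w="\<lambda>y. K * growth_weight l y * cmod (f y)"])
      show "(\<lambda>y. complex_of_real (heat_kernel l t x0 y) * f y) \<in> borel_measurable (power_measure (2 * l))"
        using heat_admissible_integrable[OF l t x0 f] by (rule borel_measurable_integrable)
      show "(\<lambda>y. complex_of_real (heat_kernel l t (Y n) y) * f y) \<in> borel_measurable (power_measure (2 * l))" for n
        using heat_admissible_integrable[OF l t Y(3) f] by (rule borel_measurable_integrable)
      have "growth_weight l \<in> borel_measurable (lebesgue_on {0<..})" by (rule borel_measurable_lebesgue_onI) measurable
      moreover have "(\<integral>\<^sup>+y. ennreal (norm (growth_weight l y * cmod (f y))) \<partial>power_measure (2 * l)) < top"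
        using f by (simp add: heat_admissible_def emod_def growth_weight_def ennreal_mult)
      ultimately have "integrable (power_measure (2 * l)) (\<lambda>y. growth_weight l y * cmod (f y))"
        by (intro integrableI_bounded) auto
      from integrable_mult_right[OF this, of K] show "integrable (power_measure (2 * l)) (\<lambda>y. K * growth_weight l y * cmod (f y))"
        by (simp add: mult.assoc)
      show "AE y in power_measure (2 * l). (\<lambda>n. complex_of_real (heat_kernel l t (Y n) y) * f y) \<longlonglongrightarrow> complex_of_real (heat_kernel l t x0 y) * f y"
      proof (rule AE_I2)
        fix y assume "y \<in> space (power_measure (2 * l))"
        hence y: "y > 0" by simp
        have "(\<lambda>n. (Y n, y)) \<longlonglongrightarrow> (x0, y)" by (intro tendsto_intros Ylim)
        moreover have "(Y n, y) \<in> {0<..} \<times> {0<..}" "(x0, y) \<in> {0<..} \<times> {0<..}" for n using Y x0 y by auto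
        ultimately have "(\<lambda>n. heat_kernel l t (Y n) y) \<longlonglongrightarrow> heat_kernel l t x0 y"
          using continuous_on_tendsto_compose[OF continuous_on_heat_kernel[OF l t], of "\<lambda>n. (Y n, y)" "(x0, y)" sequentially]
          by simp
        thus "(\<lambda>n. complex_of_real (heat_kernel l t (Y n) y) * f y) \<longlonglongrightarrow> complex_of_real (heat_kernel l t x0 y) * f y"
          by (intro tendsto_intros)
      qed
      show "AE y in power_measure (2 * l). norm (complex_of_real (heat_kernel l t (Y n) y) * f y) \<le> K * growth_weight l y * cmod (f y)" for n
      proof (rule AE_I2)
        fix y assume "y \<in> space (power_measure (2 * l))"
        hence y: "y > 0" by simp
        show "norm (complex_of_real (heat_kernel l t (Y n) y) * f y) \<le> K * growth_weight l y * cmod (f y)"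
          using K(2) Y y heat_kernel_nonneg[OF l t Y(3) y] by (simp add: norm_mult mult_right_mono)
      qed
    qed
    thus "(\<lambda>n. LINT y|power_measure (2 * l). complex_of_real (heat_kernel l t (X n) y) * f y)
       \<longlonglongrightarrow> (LINT y|power_measure (2 * l). complex_of_real (heat_kernel l t x0 y) * f y)"
      by (rule Lim_transform_eventually) (use XY in \<open>auto elim: eventually_mono\<close>)
  qed
qed

text \<open>
  Each heat integral is continuous in \<open>x\<close>, so the superlevel sets of the supremum over the uncountably many \<open>t\<close> are open.
\<close>

lemma borel_measurable_heat_maximal:
  assumes l: "l > -1/2" and f: "heat_admissible l f"
  shows "heat_maximal l f \<in> borel_measurable (lebesgue_on {0<..})"
proof (rule borel_measurableI_greater)
  fix c :: ennreal
  have "open ({0<..} \<inter> (\<lambda>x. ennreal (cmod (heat_integral l t f x))) -` {c<..})" if "t > 0" for t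
    by (intro continuous_open_preimage continuous_on_ennreal continuous_on_norm continuous_on_heat_integral l f that) auto
  hence "open (\<Union>t\<in>{0<..}. {0<..} \<inter> (\<lambda>x. ennreal (cmod (heat_integral l t f x))) -` {c<..})" by (intro open_UN) auto
  moreover have "{x \<in> space (lebesgue_on {0<..}). c < heat_maximal l f x} = (\<Union>t\<in>{0<..}. {0<..} \<inter> (\<lambda>x. ennreal (cmod (heat_integral l t f x))) -` {c<..})"
    by (auto simp: heat_maximal_def less_SUP_iff)
  ultimately show "{x \<in> space (lebesgue_on {0<..}). c < heat_maximal l f x} \<in> sets (lebesgue_on {0<..})"
    by (auto simp: sets_restrict_space_iff intro!: borel_open)
qed

section \<open>Sufficiency\<close>

lemma heat_integral_le_heat_pos:
  assumes l: "l > -1/2" and t: "t > 0" and x: "x > 0" and F: "borel_modulus f F"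
    and f[measurable]: "f \<in> borel_measurable (lebesgue_on {0<..})"
  shows "ennreal (cmod (heat_integral l t f x)) \<le> heat_pos l t F x"
proof (cases "integrable (power_measure (2 * l)) (\<lambda>y. complex_of_real (heat_kernel l t x y) * f y)")
  case True
  have W[measurable]: "(\<lambda>y. ennreal (heat_kernel l t x y)) \<in> borel_measurable (lebesgue_on {0<..})"
    by (rule borel_measurable_lebesgue_onI) measurable
  have [measurable]: "F \<in> borel_measurable borel" using F by (simp add: borel_modulus_def)
  have "ennreal (cmod (heat_integral l t f x)) \<le> (\<integral>\<^sup>+y. ennreal (norm (complex_of_real (heat_kernel l t x y) * f y)) \<partial>power_measure (2 * l))"
    unfolding heat_integral_def by (rule integral_norm_bound_ennreal[OF True])
  also have "\<dots> = (\<integral>\<^sup>+y. ennreal (heat_kernel l t x y) * emod f y \<partial>power_measure (2 * l))"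
    using heat_kernel_nonneg[OF l t x] by (intro nn_integral_cong) (simp add: norm_mult emod_def ennreal_mult)
  also have "\<dots> = heat_pos l t F x" unfolding heat_pos_def
  proof (rule nn_integral_borel_modulus[OF F f, of "\<lambda>y u. ennreal (heat_kernel l t x y) * u"])
    show "(\<lambda>y. ennreal (heat_kernel l t x y) * u y) \<in> borel_measurable (lebesgue_on {0<..})"
      if "u \<in> borel_measurable (lebesgue_on {0<..})" for u
      by (intro borel_measurable_times_ennreal W that)
    show "(\<lambda>y. ennreal (heat_kernel l t x y) * F y) \<in> borel_measurable borel" by simp
  qed
  finally show ?thesis .
qed (simp add: heat_integral_def not_integrable_integral_eq)

lemma heat_maximal_le:
  assumes l: "l > -1/2" and x: "x > 0" and F: "borel_modulus f F"
    and f: "f \<in> borel_measurable (lebesgue_on {0<..})" and le: "\<And>t. t > 0 \<Longrightarrow> heat_pos l t F x \<le> K"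
  shows "heat_maximal l f x \<le> K"
  unfolding heat_maximal_def using order_trans[OF heat_integral_le_heat_pos[OF l _ x F f] le]
  by (intro SUP_least) auto

lemma nn_integral_growth_weight_le:
  assumes l: "l > -1/2" and R: "R > 0" and [measurable]: "F \<in> borel_measurable borel"
  shows "(\<integral>\<^sup>+y. ennreal (growth_weight l y) * F y \<partial>half_line_measure (2 * l))
     \<le> (\<integral>\<^sup>+y\<in>{0<..R}. ennreal (y powr (2 * l)) * F y \<partial>lborel) + (\<integral>\<^sup>+y\<in>{R<..}. ennreal (y powr (-2)) * F y \<partial>lborel)"
proof -
  have "ennreal (y powr (2 * l)) * indicator {0<..} y * (ennreal (growth_weight l y) * F y)
     \<le> ennreal (y powr (2 * l)) * F y * indicator {0<..R} y + ennreal (y powr (-2)) * F y * indicator {R<..} y" for y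
  proof (cases "y > 0")
    case True
    show ?thesis
    proof (cases "y \<le> R")
      case yR: True
      have "y powr (2 * l) * growth_weight l y \<le> y powr (2 * l) * 1" by (intro mult_left_mono) (auto simp: growth_weight_def)
      hence "ennreal (y powr (2 * l) * growth_weight l y) * F y \<le> ennreal (y powr (2 * l)) * F y"
        by (intro mult_right_mono ennreal_leI) auto
      thus ?thesis using True yR by (simp add: ennreal_cmult_cmult growth_weight_def)
    next
      case yR: False
      have "y powr (2 * l) * growth_weight l y \<le> y powr (2 * l) * y powr (-2 * l - 2)"
        by (intro mult_left_mono) (auto simp: growth_weight_def)
      also have "\<dots> = y powr (-2)" by (simp only: powr_add[symmetric]) simp
      finally have "ennreal (y powr (2 * l) * growth_weight l y) * F y \<le> ennreal (y powr (-2)) * F y"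
        by (intro mult_right_mono ennreal_leI) auto
      thus ?thesis using True yR by (simp add: ennreal_cmult_cmult growth_weight_def)
    qed
  qed simp
  hence "(\<integral>\<^sup>+y. ennreal (growth_weight l y) * F y \<partial>half_line_measure (2 * l))
    \<le> (\<integral>\<^sup>+y. ennreal (y powr (2 * l)) * F y * indicator {0<..R} y + ennreal (y powr (-2)) * F y * indicator {R<..} y \<partial>lborel)"
    by (subst nn_integral_half_line) (auto intro!: nn_integral_mono)
  thus ?thesis by (subst (asm) nn_integral_add) auto
qed

lemma heat_admissible_iff_borel_modulus:
  assumes F: "borel_modulus f F" and f: "f \<in> borel_measurable (lebesgue_on {0<..})"
  shows "heat_admissible l f \<longleftrightarrow> (\<integral>\<^sup>+y. ennreal (growth_weight l y) * F y \<partial>half_line_measure (2 * l)) < top"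
proof -
  have [measurable]: "F \<in> borel_measurable borel" using F by (simp add: borel_modulus_def)
  have [measurable]: "(\<lambda>y. ennreal (growth_weight l y)) \<in> borel_measurable (lebesgue_on {0<..})"
    by (rule borel_measurable_lebesgue_onI) measurable
  show ?thesis unfolding heat_admissible_def using f
    by (subst nn_integral_borel_modulus[OF F f, of "\<lambda>y u. ennreal (growth_weight l y) * u"]) auto
qed

text \<open>
  Finiteness at a single point suffices: the Hardy mean at \<open>x\<close> controls \<open>f\<close> on \<open>(0, x]\<close> and the Hardy tail controls it beyond \<open>x\<close>.
\<close>

lemma heat_admissible_if_dominating_finite:
  assumes l: "l > -1/2" and x: "x > 0" and F: "borel_modulus f F" and f: "f \<in> borel_measurable (lebesgue_on {0<..})"
    and fin: "dominating l F x < top"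
  shows "heat_admissible l f"
proof -
  have [measurable]: "F \<in> borel_measurable borel" using F by (simp add: borel_modulus_def)
  have fin1: "(\<integral>\<^sup>+y\<in>{0<..x}. ennreal (y powr (2 * l)) * F y \<partial>lborel) < top"
  proof -
    have "ennreal (x powr (-2 * l - 1)) \<noteq> 0" using x by simp
    thus ?thesis using fin unfolding dominating_def hardy_mean_def by (auto simp: ennreal_mult_less_top less_top[symmetric] ennreal_mult_eq_top_iff)
  qed
  have fin2: "hardy_tail F x < top" using fin by (simp add: dominating_def less_top)
  have "(\<integral>\<^sup>+y\<in>{x<..}. ennreal (y powr (-2)) * F y \<partial>lborel) \<le> (\<integral>\<^sup>+y. ennreal (1 / x) * (ennreal (1 / y) * F y * indicator {x<..} y) \<partial>lborel)"
  proof (intro nn_integral_mono)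
    fix y
    show "ennreal (y powr (-2)) * F y * indicator {x<..} y \<le> ennreal (1 / x) * (ennreal (1 / y) * F y * indicator {x<..} y)"
    proof (cases "y > x")
      case True
      have "y powr (-2) = 1 / y * (1 / y)" using True x powr_minus_divide[of y 2] by (simp add: power2_eq_square)
      also have "\<dots> \<le> 1 / x * (1 / y)" using True x by (intro mult_right_mono) (auto simp: field_simps)
      finally have "ennreal (y powr (-2)) * F y \<le> ennreal (1 / x * (1 / y)) * F y" by (intro mult_right_mono ennreal_leI) auto
      thus ?thesis using True x by (simp add: ennreal_cmult_cmult)
    qed simp
  qed
  also have "\<dots> = ennreal (1 / x) * hardy_tail F x" unfolding hardy_tail_def by (rule nn_integral_cmult) measurable
  also have "\<dots> < top" using fin2 by (simp add: ennreal_mult_less_top)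
  finally have "(\<integral>\<^sup>+y. ennreal (growth_weight l y) * F y \<partial>half_line_measure (2 * l)) < top"
    using nn_integral_growth_weight_le[OF l x, of F] fin1 by (auto intro: le_less_trans)
  thus ?thesis using heat_admissible_iff_borel_modulus[OF F f] by simp
qed

lemma nn_integral_inverse_square:
  assumes "R > 0"
  shows "(\<integral>\<^sup>+y\<in>{R<..}. ennreal (y powr (-2)) \<partial>lborel) \<le> ennreal (1 / R)"
proof -
  have "((\<lambda>x. x powr (-2)) has_integral -(R powr (-2 + 1)) / (-2 + 1)) {R..}"
    by (rule has_integral_powr_to_inf) (use assms in auto)
  hence "((\<lambda>x. x powr (-2)) has_integral 1 / R) {R..}" using assms by (simp add: powr_minus_divide)
  hence "(\<integral>\<^sup>+y. ennreal (y powr (-2)) * indicator {R..} y \<partial>lborel) = ennreal (1 / R)"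
    by (intro nn_integral_has_integral_lebesgue') auto
  moreover have "(\<integral>\<^sup>+y\<in>{R<..}. ennreal (y powr (-2)) \<partial>lborel) \<le> (\<integral>\<^sup>+y. ennreal (y powr (-2)) * indicator {R..} y \<partial>lborel)"
    by (intro nn_integral_mono) (auto split: split_indicator)
  ultimately show ?thesis by simp
qed

lemma bounded_imp_heat_admissible:
  assumes l: "l > -1/2" and f: "f \<in> borel_measurable (lebesgue_on {0<..})"
    and B: "AE y in lborel. y > 0 \<longrightarrow> emod f y \<le> ennreal B"
  shows "heat_admissible l f"
proof -
  obtain F where F: "borel_modulus f F" using borel_modulus_exists[OF f] by blast
  have [measurable]: "F \<in> borel_measurable borel" using F by (simp add: borel_modulus_def)
  have "(\<integral>\<^sup>+y. ennreal (growth_weight l y) * F y \<partial>half_line_measure (2 * l)) 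
     \<le> (\<integral>\<^sup>+y. ennreal B * (ennreal (growth_weight l y) * 1) \<partial>half_line_measure (2 * l))"
  proof -
    have "AE y in lborel. y > 0 \<longrightarrow> F y \<le> ennreal B"
      using B F unfolding borel_modulus_def by (auto elim!: eventually_elim2)
    hence ae: "AE y in lborel. ennreal (y powr (2 * l)) * indicator {0<..} y * (ennreal (growth_weight l y) * F y)
       \<le> ennreal (y powr (2 * l)) * indicator {0<..} y * (ennreal B * (ennreal (growth_weight l y) * 1))"
      by eventually_elim (auto split: split_indicator intro!: mult_left_mono simp: mult.commute[of "ennreal B"])
    have M: "(\<lambda>y. ennreal (growth_weight l y) * F y) \<in> borel_measurable borel"
      "(\<lambda>y. ennreal B * (ennreal (growth_weight l y) * 1)) \<in> borel_measurable borel" by simp_all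
    show ?thesis unfolding nn_integral_half_line[OF M(1)] nn_integral_half_line[OF M(2)]
      by (rule nn_integral_mono_AE[OF ae])
  qed
  also have "\<dots> = ennreal B * (\<integral>\<^sup>+y. ennreal (growth_weight l y) * 1 \<partial>half_line_measure (2 * l))"
    by (rule nn_integral_cmult) measurable
  also have "\<dots> < top"
  proof -
    have "(\<integral>\<^sup>+y. ennreal (growth_weight l y) * 1 \<partial>half_line_measure (2 * l)) \<le> ennreal (1 powr (2 * l + 1) / (2 * l + 1)) + ennreal (1 / 1)"
      using nn_integral_growth_weight_le[OF l, of 1 "\<lambda>_. 1"] nn_integral_powr_from_0[of "2 * l" 1] nn_integral_inverse_square[of 1] l
      by (auto intro: order_trans add_mono)
    thus ?thesis by (auto simp: ennreal_mult_less_top intro: le_less_trans)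
  qed
  finally show ?thesis using heat_admissible_iff_borel_modulus[OF F f] by simp
qed

lemma weak_functional_finite_imp_point:
  assumes p: "p > 0" and [measurable]: "g \<in> borel_measurable borel" and fin: "weak_functional p d g < top"
  shows "\<exists>x>0. g x < top"
proof (rule ccontr)
  assume "\<not> (\<exists>x>0. g x < top)"
  hence top: "g x = top" if "x > 0" for x using that by (auto simp: less_top[symmetric])
  let ?P = "half_line_measure d"
  have one: "1 \<le> ennreal (2 powr \<bar>d\<bar>) * emeasure ?P {1<..<2}"
    using half_line_comparison(2)[of 1 "\<lambda>_. 1" "{1<..<2}" d] by (auto simp: subset_iff)
  have "of_nat n \<le> ennreal (2 powr \<bar>d\<bar>) * weak_functional p d g" if n: "n > 0" for n :: nat
  proof -
    define \<gamma> where "\<gamma> = real n powr (1 / p)"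
    have \<gamma>: "\<gamma> > 0" "\<gamma> powr p = real n" using n p by (auto simp: \<gamma>_def powr_powr)
    have "of_nat n = ennreal (\<gamma> powr p) * 1" by (simp add: \<gamma> ennreal_of_nat_eq_real_of_nat)
    also have "\<dots> \<le> ennreal (\<gamma> powr p) * (ennreal (2 powr \<bar>d\<bar>) * emeasure ?P {1<..<2})" by (intro mult_left_mono one) simp
    also have "\<dots> \<le> ennreal (\<gamma> powr p) * (ennreal (2 powr \<bar>d\<bar>) * emeasure ?P {x. ennreal \<gamma> < g x})"
      by (intro mult_left_mono emeasure_mono) (use top in auto)
    also have "\<dots> = ennreal (2 powr \<bar>d\<bar>) * (ennreal (\<gamma> powr p) * emeasure ?P {x. ennreal \<gamma> < g x})" by (simp only: mult.left_commute)
    also have "\<dots> \<le> ennreal (2 powr \<bar>d\<bar>) * weak_functional p d g" by (intro mult_left_mono weak_functionalD \<gamma>) simp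
    finally show ?thesis .
  qed
  moreover have "ennreal (2 powr \<bar>d\<bar>) * weak_functional p d g < top" using fin by (simp add: ennreal_mult_less_top)
  then obtain n where "ennreal (2 powr \<bar>d\<bar>) * weak_functional p d g < of_nat n" using ennreal_Ex_less_of_nat by blast
  moreover from this have "n > 0" by (cases n) auto
  ultimately show False by (meson leD)
qed

lemma sublinear_on_heat_maximal:
  assumes l: "l > -1/2" and X: "\<And>f. f \<in> X \<Longrightarrow> heat_admissible l f"
  shows "sublinear_on (power_measure d) X (heat_maximal l)"
  unfolding sublinear_on_def
proof (intro conjI ballI allI AE_I2)
  fix f g x assume fg: "f \<in> X" "g \<in> X" and "x \<in> space (power_measure d)"
  hence x: "x > 0" by simp
  show "heat_maximal l (\<lambda>y. f y + g y) x \<le> heat_maximal l f x + heat_maximal l g x"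
    unfolding heat_maximal_def
  proof (rule SUP_least)
    fix t :: real assume "t \<in> {0<..}"
    hence t: "t > 0" by simp
    have "heat_integral l t (\<lambda>y. f y + g y) x = heat_integral l t f x + heat_integral l t g x"
      unfolding heat_integral_def distrib_left
      by (intro Bochner_Integration.integral_add heat_admissible_integrable l t x X fg)
    hence "ennreal (cmod (heat_integral l t (\<lambda>y. f y + g y) x)) \<le> ennreal (cmod (heat_integral l t f x)) + ennreal (cmod (heat_integral l t g x))"
      by (simp add: norm_triangle_ineq flip: ennreal_plus)
    also have "\<dots> \<le> (SUP t\<in>{0<..}. ennreal (cmod (heat_integral l t f x))) + (SUP t\<in>{0<..}. ennreal (cmod (heat_integral l t g x)))"
      using t by (intro add_mono SUP_upper) auto
    finally show "ennreal (cmod (heat_integral l t (\<lambda>y. f y + g y) x)) \<le> \<dots>" .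
  qed
next
  fix f c x assume "f \<in> X" "x \<in> space (power_measure d)"
  have "heat_integral l t (\<lambda>y. c * f y) x = c * heat_integral l t f x" for t
    unfolding heat_integral_def by (simp add: mult.left_commute)
  thus "heat_maximal l (\<lambda>y. c * f y) x = ennreal (cmod c) * heat_maximal l f x"
    unfolding heat_maximal_def by (simp add: norm_mult ennreal_mult SUP_mult_left_ennreal)
qed

lemma Lp_D:
  assumes f: "f \<in> Lp (power_measure d) p" and p: "p > 0"
  shows "f \<in> borel_measurable (lebesgue_on {0<..})"
    and "borel_modulus f F \<Longrightarrow> strong_functional p d F < top"
    and "borel_modulus f F \<Longrightarrow> epowr (lp_norm (power_measure d) p (emod f)) p = strong_functional p d F"
proof -
  show m: "f \<in> borel_measurable (lebesgue_on {0<..})" using f by (simp add: Lp_def borel_measurable_power_measure_cong)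
  assume F: "borel_modulus f F"
  note n = lp_norm_borel_modulus[OF F m, of d p]
  have "epowr (strong_functional p d F) (1 / p) < top" using f by (simp add: Lp_def n)
  thus "strong_functional p d F < top" by (cases "strong_functional p d F") auto
  show "epowr (lp_norm (power_measure d) p (emod f)) p = strong_functional p d F"
    unfolding n using p by (simp add: epowr_epowr)
qed

lemma ennreal_le_inverse_mult:
  assumes "c > 0" "ennreal c * a \<le> b"
  shows "a \<le> ennreal (1 / c) * b"
proof -
  have "a = ennreal (1 / c) * (ennreal c * a)" using assms(1) by (subst ennreal_cmult_cmult) auto
  also have "\<dots> \<le> ennreal (1 / c) * b" by (intro mult_left_mono assms) simp
  finally show ?thesis .
qed

lemma weak_type_ineq_heat_maximal:
  assumes p: "p > 0" and A: "A \<ge> 0" and B: "B \<ge> 0" and D[measurable]: "D \<in> borel_measurable borel"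
    and le: "\<And>x. x > 0 \<Longrightarrow> S x \<le> ennreal A * D x"
    and D_le: "weak_functional p d D \<le> ennreal B * epowr (lp_norm (power_measure d) p (emod f)) p"
  shows "weak_type_ineq (power_measure d) p ((A + 1) powr p * B) S f"
  unfolding weak_type_ineq_def
proof (intro allI impI)
  fix \<gamma> :: real assume \<gamma>: "\<gamma> > 0"
  let ?N = "epowr (lp_norm (power_measure d) p (emod f)) p"
  let ?E = "{x. ennreal \<gamma> < ennreal (A + 1) * D x}"
  interpret dilation_functional "weak_functional p d" p d by (rule weak_functional[OF p])
  have "S x \<le> ennreal (A + 1) * D x" if "x > 0" for x
  proof -
    have "ennreal A \<le> ennreal (A + 1)" by (rule ennreal_leI) simp
    from order_trans[OF le[OF that] mult_right_mono[OF this]] show ?thesis by simp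
  qed
  hence "{x \<in> space (power_measure d). ennreal \<gamma> < S x} \<subseteq> ?E \<inter> {0<..}" by (auto intro: less_le_trans)
  moreover have "?E \<inter> {0<..} \<in> sets (power_measure d)" by (auto simp: sets_restrict_space_iff)
  ultimately have "emeasure (power_measure d) {x \<in> space (power_measure d). S x > ennreal \<gamma>} \<le> emeasure (power_measure d) (?E \<inter> {0<..})"
    by (intro emeasure_mono)
  also have "\<dots> = emeasure (half_line_measure d) (?E \<inter> {0<..})" by (rule emeasure_power_measure_borel) auto
  also have "\<dots> \<le> emeasure (half_line_measure d) ?E" by (intro emeasure_mono) auto
  also have "\<dots> \<le> ennreal (1 / \<gamma> powr p) * weak_functional p d (\<lambda>x. ennreal (A + 1) * D x)"
    by (rule ennreal_le_inverse_mult) (use \<gamma> weak_functionalD[OF \<gamma>] in auto)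
  also have "\<dots> \<le> ennreal (1 / \<gamma> powr p) * (ennreal ((A + 1) powr p) * (ennreal B * ?N))"
    using A by (intro mult_left_mono order_trans[OF cmult_le] D_le) auto
  also have "\<dots> = ennreal ((A + 1) powr p * B * \<gamma> powr - p) * ?N"
    using B \<gamma> by (simp add: ennreal_cmult_cmult powr_minus_divide)
  finally show "emeasure (power_measure d) {x \<in> space (power_measure d). ennreal \<gamma> < S x} \<le> ennreal ((A + 1) powr p * B * \<gamma> powr - p) * ?N" .
qed

text \<open>
  The weak bound makes the dominating operator finite at some point, so every function in the space
  is admissible. There the maximal operator is sublinear and measurable, and hence it is its own extension.
\<close>

lemma weak_type_heat_maximal:
  assumes l: "l > -1/2" and p: "p > 0" and B: "B \<ge> 0"
    and D: "\<And>F. F \<in> borel_measurable borel \<Longrightarrow> weak_functional p d (dominating l F) \<le> ennreal B * strong_functional p d F"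
  shows "sublinear_extension (power_measure (2 * l)) (power_measure d) p (heat_maximal l) (heat_maximal l)"
    and "weak_type (power_measure (2 * l)) (power_measure d) p (heat_maximal l)"
proof -
  have meas: "dominating l F \<in> borel_measurable borel" if [measurable]: "F \<in> borel_measurable borel" for F
    unfolding dominating_def[abs_def] by measurable
  have adm: "heat_admissible l f" if f: "f \<in> Lp (power_measure d) p" for f
  proof -
    note m = Lp_D(1)[OF f p]
    obtain F where F: "borel_modulus f F" using borel_modulus_exists[OF m] by blast
    have FM: "F \<in> borel_measurable borel" using F by (simp add: borel_modulus_def)
    have "weak_functional p d (dominating l F) < top"
      using D[OF FM] Lp_D(2)[OF f p F] by (auto intro: le_less_trans simp: ennreal_mult_less_top)
    from weak_functional_finite_imp_point[OF p meas[OF FM] this] obtain x where "x > 0" "dominating l F x < top" by blast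
    thus ?thesis by (intro heat_admissible_if_dominating_finite[OF l _ F m])
  qed
  show ext: "sublinear_extension (power_measure (2 * l)) (power_measure d) p (heat_maximal l) (heat_maximal l)"
    unfolding sublinear_extension_def
    using borel_measurable_heat_maximal[OF l adm] sublinear_on_heat_maximal[OF l adm]
    by (auto simp: borel_measurable_power_measure_cong)
  obtain A where A: "A \<ge> 0" "\<forall>F\<in>borel_measurable borel. \<forall>t>0. \<forall>x>0. heat_pos l t F x \<le> ennreal A * dominating l F x"
    using heat_pos_le_dominating[OF l] by blast
  have "weak_type_ineq (power_measure d) p ((A + 1) powr p * B) (heat_maximal l f) f" if f: "f \<in> Lp (power_measure d) p" for f
  proof -
    note m = Lp_D(1)[OF f p]
    obtain F where F: "borel_modulus f F" using borel_modulus_exists[OF m] by blast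
    have FM: "F \<in> borel_measurable borel" using F by (simp add: borel_modulus_def)
    show ?thesis
    proof (rule weak_type_ineq_heat_maximal[OF p A(1) B meas[OF FM]])
      show "heat_maximal l f x \<le> ennreal A * dominating l F x" if "x > 0" for x
        using A(2) FM that by (intro heat_maximal_le[OF l that F m]) auto
      show "weak_functional p d (dominating l F) \<le> ennreal B * epowr (lp_norm (power_measure d) p (emod f)) p"
        unfolding Lp_D(3)[OF f p F] by (rule D[OF FM])
    qed
  qed
  thus "weak_type (power_measure (2 * l)) (power_measure d) p (heat_maximal l)"
    unfolding weak_type_def using ext by blast
qed

theorem heat_maximal_weak_type:
  assumes l: "l > -1/2" and p: "p \<ge> 1" and d: "-1 < d" "d < (2 * l + 1) * p - 1"
  shows "weak_type (power_measure (2 * l)) (power_measure d) p (heat_maximal l)"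
  using dominating_weak_type[OF p d] weak_type_heat_maximal(2)[OF l, of p _ d] p by auto

theorem heat_maximal_weak_type_1:
  assumes l: "l > -1/2"
  shows "weak_type (power_measure (2 * l)) (power_measure (2 * l)) 1 (heat_maximal l)"
  using dominating_weak_type_1[OF l] weak_type_heat_maximal(2)[OF l, of 1 _ "2 * l"] by auto

theorem heat_maximal_strong_type:
  assumes l: "l > -1/2" and p: "p > 1" and d: "-1 < d" "d < (2 * l + 1) * p - 1"
  shows "strong_type (power_measure (2 * l)) (power_measure d) p (heat_maximal l)"
proof -
  have p1: "p \<ge> 1" and p0: "p > 0" using p by auto
  obtain B where "B \<ge> 0" "\<And>F. F \<in> borel_measurable borel \<Longrightarrow> weak_functional p d (dominating l F) \<le> ennreal B * strong_functional p d F"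
    using dominating_weak_type[OF p1 d] by blast
  from weak_type_heat_maximal(1)[OF l p0 this]
  have ext: "sublinear_extension (power_measure (2 * l)) (power_measure d) p (heat_maximal l) (heat_maximal l)" .
  obtain C where C: "C \<ge> 0" "\<And>F. F \<in> borel_measurable borel \<Longrightarrow> strong_functional p d (dominating l F) \<le> ennreal C * strong_functional p d F"
    using dominating_strong_type[OF p d] by blast
  obtain A where A: "A \<ge> 0" "\<forall>F\<in>borel_measurable borel. \<forall>t>0. \<forall>x>0. heat_pos l t F x \<le> ennreal A * dominating l F x"
    using heat_pos_le_dominating[OF l] by blast
  have "lp_norm (power_measure d) p (heat_maximal l f) \<le> ennreal (A * C powr (1 / p)) * lp_norm (power_measure d) p (emod f)"
    if f: "f \<in> Lp (power_measure d) p" for f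
  proof -
    note m = Lp_D(1)[OF f p0]
    obtain F where F: "borel_modulus f F" using borel_modulus_exists[OF m] by blast
    have FM[measurable]: "F \<in> borel_measurable borel" using F by (simp add: borel_modulus_def)
    have [measurable]: "dominating l F \<in> borel_measurable borel" unfolding dominating_def[abs_def] by measurable
    have "(\<integral>\<^sup>+x. epowr (heat_maximal l f x) p \<partial>power_measure d) \<le> (\<integral>\<^sup>+x. epowr (ennreal A * dominating l F x) p \<partial>power_measure d)"
    proof (intro nn_integral_mono epowr_mono)
      fix x assume "x \<in> space (power_measure d)"
      thus "heat_maximal l f x \<le> ennreal A * dominating l F x"
        using A(2) FM by (intro heat_maximal_le[OF l _ F m]) auto
    qed (use p in auto)
    also have "\<dots> = (\<integral>\<^sup>+x. ennreal (A powr p) * epowr (dominating l F x) p \<partial>half_line_measure d)"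
      using A by (subst nn_integral_power_measure_borel) (auto simp: epowr_cmult)
    also have "\<dots> = ennreal (A powr p) * strong_functional p d (dominating l F)"
      unfolding strong_functional_def by (rule nn_integral_cmult) measurable
    also have "\<dots> \<le> ennreal (A powr p) * (ennreal C * strong_functional p d F)" by (intro mult_left_mono C FM) simp
    also have "\<dots> = ennreal (A powr p * C) * strong_functional p d F" using C by (intro ennreal_cmult_cmult) auto
    finally have "lp_norm (power_measure d) p (heat_maximal l f) \<le> epowr (ennreal (A powr p * C) * strong_functional p d F) (1 / p)"
      unfolding lp_norm_def using p by (intro epowr_mono) auto
    also have "\<dots> = ennreal ((A powr p * C) powr (1 / p)) * lp_norm (power_measure d) p (emod f)"
      using C by (simp add: epowr_cmult lp_norm_borel_modulus[OF F m])
    also have "(A powr p * C) powr (1 / p) = A * C powr (1 / p)" using A C p by (simp add: powr_mult powr_powr)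
    finally show ?thesis .
  qed
  thus ?thesis unfolding strong_type_def using ext by blast
qed

text \<open>
  The Hardy tail of the constant function diverges, so the dominating operator is of no use here. For \<open>y > 10x/9\<close> the
  kernel is estimated with \<open>\<sigma> = l + 1/2\<close> up to \<open>y = t\<^bsup>1/2\<^esup>\<close> and with \<open>\<sigma> = -1/2\<close> beyond; both pieces have integrals that
  do not depend on \<open>t\<close>.
\<close>

lemma heat_pos_one_bounded:
  assumes l: "l > -1/2"
  shows "\<exists>C\<ge>0. \<forall>t>0. \<forall>x>0. heat_pos l t (\<lambda>_. 1) x \<le> ennreal C"
proof -
  have "0 \<le> l + 1/2" "-1/2 \<le> l + 1/2" using l by simp_all
  from heat_kernel_far[OF l this(1)] obtain C0 where C0: "C0 > 0" and
    F0: "\<forall>t>0. \<forall>x>0. \<forall>y\<ge>10/9 * x. heat_kernel l t x y \<le> C0 * (y powr (-2*l - 1) * (y\<^sup>2 / t) powr 0)" by blast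
  from heat_kernel_far[OF l \<open>-1/2 \<le> l + 1/2\<close>] obtain C1 where C1: "C1 > 0" and
    F1: "\<forall>t>0. \<forall>x>0. \<forall>y\<ge>10/9 * x. heat_kernel l t x y \<le> C1 * (y powr (-2*l - 1) * (y\<^sup>2 / t) powr (-1/2))" by blast
  from heat_kernel_far[OF l order_refl] obtain C2 where C2: "C2 > 0" and
    F2: "\<forall>t>0. \<forall>x>0. \<forall>y\<ge>10/9 * x. heat_kernel l t x y \<le> C2 * (y powr (-2*l - 1) * (y\<^sup>2 / t) powr (l + 1/2))" by blast
  obtain D where D: "D > 0" and near: "\<forall>t>0. \<forall>x>0. \<forall>y. 9/10 * x \<le> y \<and> y \<le> 10/9 * x \<longrightarrow>
     y powr (2 * l) * heat_kernel l t x y \<le> D * (t powr (-1/2) * exp (- (x - y)\<^sup>2 / (4*t)) + 1 / x)"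
    using weighted_heat_kernel_near[OF l] by blast
  define M where "M = 1 / (2 * l + 1)"
  have M: "M > 0" using l by (simp add: M_def)
  define C where "C = C0 * M + (C2 * M + C1) + D * 99"
  have "heat_pos l t (\<lambda>_. 1) x \<le> ennreal C" if t: "t > 0" and x: "x > 0" for t x
  proof -
    let ?n = "\<lambda>y. t powr (-1/2) * exp (- (x - y)\<^sup>2 / (4*t)) + 1 / x"
    let ?r = "sqrt t"
    have r: "?r > 0" using t by simp
    let ?A = "\<lambda>y. ennreal (C0 * x powr (-2*l - 1)) * (ennreal (y powr (2 * l)) * indicator {0<..x} y)"
    let ?B = "\<lambda>y. ennreal (C2 * t powr (-l - 1/2)) * (ennreal (y powr (2 * l)) * indicator {0<..?r} y)
                 + ennreal (C1 * ?r) * (ennreal (y powr (-2)) * indicator {?r<..} y)"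
    let ?N = "\<lambda>y. ennreal D * (ennreal (?n y) * 1 * indicator {9/10 * x..10/9 * x} y)"
    have pt: "ennreal (y powr (2 * l)) * indicator {0<..} y * (ennreal (heat_kernel l t x y) * 1) \<le> ?A y + ?B y + ?N y" for y
    proof -
      have W: "ennreal (y powr (2 * l)) * indicator {0<..} y * (ennreal (heat_kernel l t x y) * 1)
         = ennreal (y powr (2 * l) * heat_kernel l t x y)" if "y > 0"
        using that heat_kernel_nonneg[OF l t x that] by (simp add: ennreal_mult)
      consider "y \<le> 0" | "0 < y" "y < 9/10 * x" | "0 < y" "10/9 * x < y" | "0 < y" "9/10 * x \<le> y" "y \<le> 10/9 * x" by linarith
      thus ?thesis
      proof cases
        case 1
        thus ?thesis by simp
      next
        case 2
        have "heat_kernel l t x y \<le> C0 * x powr (-2*l - 1)"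
          using F0[rule_format, OF t 2(1), of x] 2 t x by (simp add: heat_kernel_commute[of l t x y])
        from mult_left_mono[OF this, of "y powr (2 * l)"]
        have "ennreal (y powr (2 * l) * heat_kernel l t x y) \<le> ennreal (C0 * x powr (-2*l - 1) * y powr (2 * l))"
          by (intro ennreal_leI) (simp add: mult.commute)
        also have "\<dots> = ?A y" using 2 C0 by (simp add: ennreal_mult)
        finally show ?thesis unfolding W[OF 2(1)] by (simp add: add_increasing2 del: ennreal_plus)
      next
        case 3
        show ?thesis
        proof (cases "y \<le> ?r")
          case True
          have "y powr (-2*l - 1) * (y\<^sup>2 / t) powr (l + 1/2) = t powr (-l - 1/2)"
          proof -
            have "t powr (-l - 1/2) = 1 / t powr (l + 1/2)" using powr_minus_divide[of t "l + 1/2"] by simp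
            moreover have "(y\<^sup>2) powr (l + 1/2) = y powr (2*l + 1)" using 3 by (simp add: square_powr)
            moreover have "(y\<^sup>2 / t) powr (l + 1/2) = (y\<^sup>2) powr (l + 1/2) / t powr (l + 1/2)" by (rule powr_divide)
            moreover have "y powr (-2*l - 1) = 1 / y powr (2*l + 1)" using powr_minus_divide[of y "2*l + 1"] by simp
            ultimately show ?thesis using 3 by simp
          qed
          hence "heat_kernel l t x y \<le> C2 * t powr (-l - 1/2)" using F2[rule_format, OF t x, of y] 3 by simp
          from mult_left_mono[OF this, of "y powr (2 * l)"]
          have "ennreal (y powr (2 * l) * heat_kernel l t x y) \<le> ennreal (C2 * t powr (-l - 1/2) * y powr (2 * l))"
            by (intro ennreal_leI) (simp add: mult.commute)
          also have "\<dots> = ?B y" using 3 True C2 by (simp add: ennreal_mult)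
          finally show ?thesis unfolding W[OF 3(1)] by (simp add: add_increasing2 add_increasing del: ennreal_plus)
        next
          case False
          have "(y\<^sup>2 / t) powr (-1/2) = ?r / y"
            using 3 t by (simp add: powr_divide square_powr powr_minus_divide powr_half_sqrt)
          hence "heat_kernel l t x y \<le> C1 * (y powr (-2*l - 1) * (?r / y))" using F1[rule_format, OF t x, of y] 3 by simp
          from mult_left_mono[OF this, of "y powr (2 * l)"]
          have "y powr (2 * l) * heat_kernel l t x y \<le> C1 * ?r * (y powr (2 * l) * y powr (-2*l - 1) / y)"
            by (simp add: mult_ac)
          also have "y powr (2 * l) * y powr (-2*l - 1) = y powr (-1)" by (simp only: powr_add[symmetric]) simp
          also have "y powr (-1) / y = y powr (-2)" using 3 powr_minus_divide[of y 2] by (simp add: powr_minus_divide power2_eq_square)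
          finally have "ennreal (y powr (2 * l) * heat_kernel l t x y) \<le> ennreal (C1 * ?r * y powr (-2))" by (rule ennreal_leI)
          also have "\<dots> = ?B y" using 3 False C1 t by (simp add: ennreal_mult)
          finally show ?thesis unfolding W[OF 3(1)] by (simp add: add_increasing2 add_increasing del: ennreal_plus)
        qed
      next
        case 4
        have n0: "?n y \<ge> 0" using x by simp
        have "y powr (2 * l) * heat_kernel l t x y \<le> D * ?n y" using near t x 4 by blast
        hence "ennreal (y powr (2 * l) * heat_kernel l t x y) \<le> ennreal (D * ?n y)" by (rule ennreal_leI)
        also have "\<dots> = ennreal D * ennreal (?n y)" by (rule ennreal_mult) (use D n0 in auto)
        finally show ?thesis unfolding W[OF 4(1)] using 4 by (simp add: add_increasing del: ennreal_plus)
      qed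
    qed
    have one: "local_max (\<lambda>_. 1) x \<le> 1" unfolding local_max_def
      by (rule SUP_least) (auto simp: divide_ennreal)
    have "heat_pos l t (\<lambda>_. 1) x = (\<integral>\<^sup>+y. ennreal (y powr (2 * l)) * indicator {0<..} y * (ennreal (heat_kernel l t x y) * 1) \<partial>lborel)"
      unfolding heat_pos_def by (rule nn_integral_half_line) measurable
    also have "\<dots> \<le> (\<integral>\<^sup>+y. ?A y + ?B y + ?N y \<partial>lborel)" by (intro nn_integral_mono pt)
    also have "\<dots> = ennreal (C0 * x powr (-2*l - 1)) * (\<integral>\<^sup>+y\<in>{0<..x}. ennreal (y powr (2 * l)) \<partial>lborel)
       + (ennreal (C2 * t powr (-l - 1/2)) * (\<integral>\<^sup>+y\<in>{0<..?r}. ennreal (y powr (2 * l)) \<partial>lborel)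
          + ennreal (C1 * ?r) * (\<integral>\<^sup>+y\<in>{?r<..}. ennreal (y powr (-2)) \<partial>lborel))
       + ennreal D * (\<integral>\<^sup>+y\<in>{9/10 * x..10/9 * x}. ennreal (?n y) * 1 \<partial>lborel)"
      by (simp add: nn_integral_add nn_integral_cmult del: ennreal_plus mult_1_right)
    also have "\<dots> \<le> ennreal (C0 * M) + (ennreal (C2 * M) + ennreal C1) + ennreal (D * 99)"
    proof (intro add_mono)
      have "x powr (-2*l - 1) * x powr (2 * l + 1) = 1" using x by (simp only: powr_add[symmetric]) simp
      hence "C0 * x powr (-2*l - 1) * (x powr (2 * l + 1) / (2 * l + 1)) = C0 * M" by (simp add: M_def)
      thus "ennreal (C0 * x powr (-2*l - 1)) * (\<integral>\<^sup>+y\<in>{0<..x}. ennreal (y powr (2 * l)) \<partial>lborel) \<le> ennreal (C0 * M)"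
        using l x C0 by (subst nn_integral_powr_from_0) (auto simp flip: ennreal_mult)
      have "?r powr (2 * l + 1) = t powr (l + 1/2)" using t by (simp add: powr_powr flip: powr_half_sqrt) (simp add: field_simps)
      moreover have "t powr (-l - 1/2) = 1 / t powr (l + 1/2)" using powr_minus_divide[of t "l + 1/2"] by simp
      ultimately have "C2 * t powr (-l - 1/2) * (?r powr (2 * l + 1) / (2 * l + 1)) = C2 * M" using t by (simp add: M_def)
      thus "ennreal (C2 * t powr (-l - 1/2)) * (\<integral>\<^sup>+y\<in>{0<..?r}. ennreal (y powr (2 * l)) \<partial>lborel) \<le> ennreal (C2 * M)"
        using l t C2 by (subst nn_integral_powr_from_0) (auto simp flip: ennreal_mult)
      have "ennreal (C1 * ?r) * (\<integral>\<^sup>+y\<in>{?r<..}. ennreal (y powr (-2)) \<partial>lborel) \<le> ennreal (C1 * ?r) * ennreal (1 / ?r)"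
        by (intro mult_left_mono nn_integral_inverse_square r) simp
      also have "\<dots> = ennreal C1" using r C1 by (simp flip: ennreal_mult)
      finally show "ennreal (C1 * ?r) * (\<integral>\<^sup>+y\<in>{?r<..}. ennreal (y powr (-2)) \<partial>lborel) \<le> ennreal C1" .
      have "ennreal D * (\<integral>\<^sup>+y\<in>{9/10 * x..10/9 * x}. ennreal (?n y) * 1 \<partial>lborel) \<le> ennreal D * (ennreal 99 * 1)"
        by (intro mult_left_mono order_trans[OF near_part_le_local_max[of "\<lambda>_. 1", OF _ x t]] one) auto
      also have "\<dots> = ennreal (D * 99)" unfolding mult_1_right using D by (intro ennreal_mult[symmetric]) auto
      finally show "ennreal D * (\<integral>\<^sup>+y\<in>{9/10 * x..10/9 * x}. ennreal (?n y) * 1 \<partial>lborel) \<le> ennreal (D * 99)" .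
    qed
    also have "\<dots> = ennreal C" using C0 C1 C2 D M by (simp add: C_def)
    finally show ?thesis .
  qed
  moreover have "C \<ge> 0" using C0 C1 C2 D M by (simp add: C_def)
  ultimately show ?thesis by blast
qed

theorem heat_maximal_strong_type_infty:
  assumes l: "l > -1/2"
  shows "strong_type_infty (lebesgue_on {0<..}) (heat_maximal l)"
proof -
  obtain C where C: "C \<ge> 0" "\<forall>t>0. \<forall>x>0. heat_pos l t (\<lambda>_. 1) x \<le> ennreal C" using heat_pos_one_bounded[OF l] by blast
  have "heat_maximal l f \<in> borel_measurable (lebesgue_on {0<..}) \<and>
      esssup (lebesgue_on {0<..}) (heat_maximal l f) \<le> ennreal C * esssup (lebesgue_on {0<..}) (emod f)"
    if f: "f \<in> Linfty (lebesgue_on {0<..})" for f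
  proof -
    have m: "f \<in> borel_measurable (lebesgue_on {0<..})" and "esssup (lebesgue_on {0<..}) (emod f) < top"
      using f by (auto simp: Linfty_def)
    then obtain B where B: "B \<ge> 0" "esssup (lebesgue_on {0<..}) (emod f) = ennreal B"
      by (cases "esssup (lebesgue_on {0<..}) (emod f)") auto
    have ae: "AE y in lborel. y > 0 \<longrightarrow> emod f y \<le> ennreal B"
      using esssup_AE[of "emod f" "lebesgue_on {0<..}"] unfolding B(2) AE_lebesgue_on_half_line .
    have adm: "heat_admissible l f" by (rule bounded_imp_heat_admissible[OF l m ae])
    obtain F where F: "borel_modulus f F" using borel_modulus_exists[OF m] by blast
    have FM[measurable]: "F \<in> borel_measurable borel" using F by (simp add: borel_modulus_def)
    have "heat_pos l t F x \<le> ennreal B * ennreal C" if t: "t > 0" and x: "x > 0" for t x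
    proof -
      have M: "(\<lambda>y. ennreal (heat_kernel l t x y) * F y) \<in> borel_measurable borel"
        "(\<lambda>y. ennreal B * (ennreal (heat_kernel l t x y) * 1)) \<in> borel_measurable borel" by simp_all
      have "AE y in lborel. y > 0 \<longrightarrow> F y \<le> ennreal B"
        using ae F unfolding borel_modulus_def by (auto elim!: eventually_elim2)
      hence "AE y in lborel. ennreal (y powr (2 * l)) * indicator {0<..} y * (ennreal (heat_kernel l t x y) * F y)
         \<le> ennreal (y powr (2 * l)) * indicator {0<..} y * (ennreal B * (ennreal (heat_kernel l t x y) * 1))"
        by eventually_elim (auto split: split_indicator intro!: mult_left_mono simp: mult.commute[of "ennreal B"])
      hence "heat_pos l t F x \<le> (\<integral>\<^sup>+y. ennreal B * (ennreal (heat_kernel l t x y) * 1) \<partial>half_line_measure (2 * l))"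
        unfolding heat_pos_def nn_integral_half_line[OF M(1)] nn_integral_half_line[OF M(2)] by (rule nn_integral_mono_AE)
      also have "\<dots> = ennreal B * heat_pos l t (\<lambda>_. 1) x"
        unfolding heat_pos_def by (rule nn_integral_cmult) measurable
      also have "\<dots> \<le> ennreal B * ennreal C" using C t x by (intro mult_left_mono) auto
      finally show ?thesis .
    qed
    hence le: "heat_maximal l f x \<le> ennreal B * ennreal C" if "x > 0" for x
      using that by (intro heat_maximal_le[OF l that F m])
    have meas: "heat_maximal l f \<in> borel_measurable (lebesgue_on {0<..})" by (rule borel_measurable_heat_maximal[OF l adm])
    moreover have "esssup (lebesgue_on {0<..}) (heat_maximal l f) \<le> ennreal B * ennreal C"
      by (rule esssup_I[OF meas]) (use le in \<open>auto intro!: AE_I2\<close>)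
    ultimately show ?thesis by (simp add: B(2) mult.commute)
  qed
  thus ?thesis unfolding strong_type_infty_def by blast
qed

lemma indicator_borel_modulus:
  assumes E: "E \<in> sets (lebesgue_on {0<..})"
  shows "\<exists>B. B \<in> sets borel \<and> borel_modulus (indicator E) (indicator B)"
proof -
  have "indicator E \<in> borel_measurable (lebesgue_on {0<..})" using E by (rule borel_measurable_indicator)
  from borel_modulus_exists[OF this] obtain F where F: "borel_modulus (indicator E) F" by blast
  hence [measurable]: "F \<in> borel_measurable borel" and ae: "AE x in lborel. x > 0 \<longrightarrow> F x = emod (indicator E) x"
    by (auto simp: borel_modulus_def)
  \<comment> \<open>A Borel representative of an indicator need not be an indicator, but almost everywhere it is that of its level set.\<close>
  define B where "B = {x. F x = 1}"
  have "B \<in> sets borel" unfolding B_def by measurable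
  moreover have "AE x in lborel. x > 0 \<longrightarrow> indicator B x = emod (indicator E) x"
    using ae by eventually_elim (auto simp: B_def emod_def split: split_indicator)
  ultimately show ?thesis by (auto simp: borel_modulus_def)
qed

lemma restricted_weak_type_heat_maximal:
  assumes l: "l > -1/2" and p: "p > 0" and B: "B \<ge> 0"
    and D: "\<And>E. E \<in> sets borel \<Longrightarrow> weak_functional p d (dominating l (indicator E)) \<le> ennreal B * emeasure (half_line_measure d) E"
  shows "restricted_weak_type (power_measure d) p (heat_maximal l)"
proof -
  obtain A where A: "A \<ge> 0" "\<forall>F\<in>borel_measurable borel. \<forall>t>0. \<forall>x>0. heat_pos l t F x \<le> ennreal A * dominating l F x"
    using heat_pos_le_dominating[OF l] by blast
  have "heat_maximal l (indicator E) \<in> borel_measurable (power_measure d) \<and>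
     weak_type_ineq (power_measure d) p ((A + 1) powr p * B) (heat_maximal l (indicator E)) (indicator E)"
    if "E \<in> sets (power_measure d)" for E
  proof
    have E: "E \<in> sets (lebesgue_on {0<..})" using that by simp
    have m: "indicator E \<in> borel_measurable (lebesgue_on {0<..})" using E by (rule borel_measurable_indicator)
    have "AE y in lborel. y > 0 \<longrightarrow> emod (indicator E) y \<le> ennreal 1"
      by (intro AE_I2) (auto simp: emod_def split: split_indicator)
    from borel_measurable_heat_maximal[OF l bounded_imp_heat_admissible[OF l m this]]
    show "heat_maximal l (indicator E) \<in> borel_measurable (power_measure d)" by (simp add: borel_measurable_power_measure_cong)
    obtain G where G[measurable]: "G \<in> sets borel" and F: "borel_modulus (indicator E) (indicator G)"
      using indicator_borel_modulus[OF E] by blast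
    show "weak_type_ineq (power_measure d) p ((A + 1) powr p * B) (heat_maximal l (indicator E)) (indicator E)"
    proof (rule weak_type_ineq_heat_maximal[OF p A(1) B])
      show "dominating l (indicator G) \<in> borel_measurable borel" unfolding dominating_def[abs_def] by measurable
      show "heat_maximal l (indicator E) x \<le> ennreal A * dominating l (indicator G) x" if "x > 0" for x
        using A(2) that by (intro heat_maximal_le[OF l that F m]) auto
      have "epowr (lp_norm (power_measure d) p (emod (indicator E))) p = emeasure (half_line_measure d) G"
        unfolding lp_norm_borel_modulus[OF F m] using p by (simp add: epowr_epowr strong_functional_indicator)
      thus "weak_functional p d (dominating l (indicator G)) \<le> ennreal B * epowr (lp_norm (power_measure d) p (emod (indicator E))) p"
        using D[OF G] by simp
    qed
  qed
  thus ?thesis unfolding restricted_weak_type_def by blast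
qed

theorem heat_maximal_restricted_weak_type:
  assumes l: "l > -1/2" and p: "p \<ge> 1" and d: "-1 < d" "d \<le> (2 * l + 1) * p - 1"
  shows "restricted_weak_type (power_measure d) p (heat_maximal l)"
proof (cases "d = (2 * l + 1) * p - 1")
  case True
  hence "d + 1 = (2 * l + 1) * p" by simp
  from dominating_restricted_weak_type[OF l p this] obtain C where "C \<ge> 0"
    "\<And>E. E \<in> sets borel \<Longrightarrow> weak_functional p d (dominating l (indicator E)) \<le> ennreal C * emeasure (half_line_measure d) E" by blast
  thus ?thesis using l p by (intro restricted_weak_type_heat_maximal) auto
next
  case False
  hence "d < (2 * l + 1) * p - 1" using d by simp
  from dominating_weak_type[OF p d(1) this] obtain C where C: "C \<ge> 0"
    "\<And>F. F \<in> borel_measurable borel \<Longrightarrow> weak_functional p d (dominating l F) \<le> ennreal C * strong_functional p d F" by blast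
  have "weak_functional p d (dominating l (indicator E)) \<le> ennreal C * emeasure (half_line_measure d) E" if E: "E \<in> sets borel" for E
    using C(2)[of "indicator E"] E by (simp add: strong_functional_indicator)
  thus ?thesis using l p C(1) by (intro restricted_weak_type_heat_maximal) auto
qed

section \<open>Necessity\<close>

text \<open>
  The heat integral is a Bochner integral, whose value is \<open>0\<close> if the integrand is not integrable. Admissibility is therefore needed
  even for nonnegative functions.
\<close>

lemma heat_maximal_ge_heat_pos:
  assumes l: "l > -1/2" and t: "t > 0" and x: "x > 0" and \<phi>[measurable]: "\<phi> \<in> borel_measurable borel"
    and nonneg: "\<And>y. \<phi> y \<ge> 0" and adm: "heat_admissible l (\<lambda>y. complex_of_real (\<phi> y))"
  shows "heat_pos l t (\<lambda>y. ennreal (\<phi> y)) x \<le> heat_maximal l (\<lambda>y. complex_of_real (\<phi> y)) x"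
proof -
  let ?M = "power_measure (2 * l)"
  have "integrable ?M (\<lambda>y. complex_of_real (heat_kernel l t x y * \<phi> y))"
    using heat_admissible_integrable[OF l t x adm] by simp
  hence int: "integrable ?M (\<lambda>y. heat_kernel l t x y * \<phi> y)" by (simp only: complex_of_real_integrable_eq)
  have pos: "AE y in ?M. 0 \<le> heat_kernel l t x y * \<phi> y"
    using heat_kernel_nonneg[OF l t x] nonneg by (intro AE_I2) simp
  have "heat_pos l t (\<lambda>y. ennreal (\<phi> y)) x = (\<integral>\<^sup>+y. ennreal (heat_kernel l t x y) * ennreal (\<phi> y) \<partial>?M)"
    unfolding heat_pos_def by (rule nn_integral_power_measure_borel[symmetric]) simp
  also have "\<dots> = (\<integral>\<^sup>+y. ennreal (heat_kernel l t x y * \<phi> y) \<partial>?M)"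
    using heat_kernel_nonneg[OF l t x] nonneg by (intro nn_integral_cong) (simp add: ennreal_mult)
  also have "\<dots> = ennreal (LINT y|?M. heat_kernel l t x y * \<phi> y)" by (rule nn_integral_eq_integral[OF int pos])
  also have "\<dots> = ennreal (cmod (heat_integral l t (\<lambda>y. complex_of_real (\<phi> y)) x))"
  proof -
    have "heat_integral l t (\<lambda>y. complex_of_real (\<phi> y)) x = complex_of_real (LINT y|?M. heat_kernel l t x y * \<phi> y)"
      unfolding heat_integral_def by (simp flip: integral_complex_of_real)
    moreover have "(LINT y|?M. heat_kernel l t x y * \<phi> y) \<ge> 0" by (rule integral_nonneg_AE[OF pos])
    ultimately show ?thesis by simp
  qed
  also have "\<dots> \<le> heat_maximal l (\<lambda>y. complex_of_real (\<phi> y)) x"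
    unfolding heat_maximal_def using t by (intro SUP_upper) auto
  finally show ?thesis .
qed

text \<open>
  Bounded nonnegative functions supported in an interval away from \<open>0\<close>; they belong to all the spaces involved, whatever the weight.
\<close>

definition test_function :: "real \<Rightarrow> real \<Rightarrow> (real \<Rightarrow> real) \<Rightarrow> bool" where
  "test_function a b \<phi> \<longleftrightarrow> 0 < a \<and> a < b \<and> \<phi> \<in> borel_measurable borel \<and>
     (\<exists>K. \<forall>y. 0 \<le> \<phi> y \<and> \<phi> y \<le> K * indicator {a<..<b} y)"

lemma test_functionD:
  assumes "test_function a b \<phi>"
  shows "0 < a" "a < b" "\<phi> \<in> borel_measurable borel" "\<phi> y \<ge> 0" "y \<notin> {a<..<b} \<Longrightarrow> \<phi> y = 0"
proof -
  obtain K where K: "0 \<le> \<phi> y \<and> \<phi> y \<le> K * indicator {a<..<b} y" using assms unfolding test_function_def by blast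
  show "0 < a" "a < b" "\<phi> \<in> borel_measurable borel" using assms unfolding test_function_def by blast+
  show "\<phi> y \<ge> 0" using K by blast
  show "y \<notin> {a<..<b} \<Longrightarrow> \<phi> y = 0" using K by (auto intro: antisym)
qed

lemma test_function_modulus:
  assumes "test_function a b \<phi>"
  shows "borel_modulus (\<lambda>y. complex_of_real (\<phi> y)) (\<lambda>y. ennreal (\<phi> y))"
    and "(\<lambda>y. complex_of_real (\<phi> y)) \<in> borel_measurable (lebesgue_on {0<..})"
proof -
  note [measurable] = test_functionD(3)[OF assms]
  show "borel_modulus (\<lambda>y. complex_of_real (\<phi> y)) (\<lambda>y. ennreal (\<phi> y))"
    using test_functionD(4)[OF assms] by (simp add: borel_modulus_def emod_def)
  show "(\<lambda>y. complex_of_real (\<phi> y)) \<in> borel_measurable (lebesgue_on {0<..})"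
    by (rule borel_measurable_lebesgue_onI) simp
qed

lemma strong_functional_test_function_finite:
  assumes \<phi>: "test_function a b \<phi>" and p: "p > 0"
  shows "strong_functional p d (\<lambda>y. ennreal (\<phi> y)) < top"
proof -
  note [measurable] = test_functionD(3)[OF \<phi>]
  obtain K where K: "\<And>y. 0 \<le> \<phi> y" "\<And>y. \<phi> y \<le> K * indicator {a<..<b} y" using \<phi> unfolding test_function_def by blast
  have ab: "0 < a" "a < b" using \<phi> by (auto simp: test_function_def)
  define L where "L = \<bar>K\<bar> powr p * (a powr d + b powr d)"
  have "strong_functional p d (\<lambda>y. ennreal (\<phi> y)) \<le> (\<integral>\<^sup>+y. ennreal L * indicator {a<..<b} y \<partial>lborel)"
    unfolding strong_functional_def
  proof (subst nn_integral_half_line, measurable, intro nn_integral_mono)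
    fix y
    show "ennreal (y powr d) * indicator {0<..} y * epowr (ennreal (\<phi> y)) p \<le> ennreal L * indicator {a<..<b} y"
    proof (cases "y \<in> {a<..<b}")
      case True
      have "\<phi> y powr p \<le> \<bar>K\<bar> powr p" using K[of y] True p by (intro powr_mono2) auto
      moreover have "y powr d \<le> a powr d + b powr d"
      proof (cases "d \<ge> 0")
        case d: True
        have "y powr d \<le> b powr d" using d True ab by (intro powr_mono2) auto
        thus ?thesis by (simp add: add_increasing)
      next
        case d: False
        have "y powr d \<le> a powr d" using d True ab by (intro powr_mono2') auto
        thus ?thesis by (simp add: add_increasing2)
      qed
      ultimately have "y powr d * \<phi> y powr p \<le> L" unfolding L_def by (subst (2) mult.commute) (intro mult_mono, auto)
      thus ?thesis using True ab K(1)[of y] by (simp add: ennreal_leI flip: ennreal_mult)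
    next
      case False
      hence "\<phi> y = 0" by (rule test_functionD(5)[OF \<phi>])
      thus ?thesis by simp
    qed
  qed
  also have "\<dots> = ennreal L * ennreal (b - a)" using ab by (simp add: nn_integral_cmult)
  also have "\<dots> < top" by (simp add: ennreal_mult_less_top)
  finally show ?thesis .
qed

lemma test_function_Lp:
  assumes \<phi>: "test_function a b \<phi>" and p: "p > 0"
  shows "(\<lambda>y. complex_of_real (\<phi> y)) \<in> Lp (power_measure d) p"
  using strong_functional_test_function_finite[OF \<phi> p, of d] test_function_modulus[OF \<phi>]
  by (auto simp: Lp_def borel_measurable_power_measure_cong lp_norm_borel_modulus epowr_def)

lemma test_function_admissible:
  assumes l: "l > -1/2" and \<phi>: "test_function a b \<phi>"
  shows "heat_admissible l (\<lambda>y. complex_of_real (\<phi> y))"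
proof -
  obtain K where K: "\<And>y. 0 \<le> \<phi> y" "\<And>y. \<phi> y \<le> K * indicator {a<..<b} y" using \<phi> unfolding test_function_def by blast
  have "\<phi> y \<le> \<bar>K\<bar>" for y using K(2)[of y] by (auto split: split_indicator_asm)
  thus ?thesis using K(1)
    by (intro bounded_imp_heat_admissible[OF l test_function_modulus(2)[OF \<phi>], of "\<bar>K\<bar>"]) (auto simp: emod_def intro!: ennreal_leI)
qed

text \<open>
  With \<open>t = max(1, x)\<^sup>2\<close> and \<open>y < 1\<close> the kernel is in its small argument regime and the exponential
  is bounded below, so that \<open>W\<^sub>t(x, y)\<close> is at least a multiple of \<open>t\<^bsup>-l-1/2\<^esup>\<close>.
\<close>

lemma heat_maximal_lower_bound:
  assumes l: "l > -1/2"
  shows "\<exists>c>0. \<forall>a \<phi> x. test_function a 1 \<phi> \<longrightarrow> x > 0 \<longrightarrow>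
     ennreal (c * (max 1 x) powr (-2*l - 1)) * strong_functional 1 (2 * l) (\<lambda>y. ennreal (\<phi> y))
       \<le> heat_maximal l (\<lambda>y. complex_of_real (\<phi> y)) x"
proof -
  obtain c0 where c0: "c0 > 0" and W: "\<forall>t>0. \<forall>x>0. \<forall>y>0. c0 * heat_model l t x y \<le> heat_kernel l t x y"
    using heat_kernel_two_sided[OF l] by meson
  define c where "c = c0 * (2 powr (-l - 1/2) * exp (-1/2))"
  have "ennreal (c * (max 1 x) powr (-2*l - 1)) * strong_functional 1 (2 * l) (\<lambda>y. ennreal (\<phi> y))
       \<le> heat_maximal l (\<lambda>y. complex_of_real (\<phi> y)) x" if \<phi>: "test_function a 1 \<phi>" and x: "x > 0" for a \<phi> x
  proof -
    note [measurable] = test_functionD(3)[OF \<phi>]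
    define m where "m = max 1 x"
    have m: "m \<ge> 1" "x \<le> m" by (auto simp: m_def)
    define t where "t = m\<^sup>2"
    have t: "t > 0" using m by (simp add: t_def)
    have ker: "c * m powr (-2*l - 1) \<le> heat_kernel l t x y" if y: "y > 0" "y < 1" for y
    proof -
      have x2: "x\<^sup>2 \<le> m\<^sup>2" using m x by (intro power_mono) auto
      have "y\<^sup>2 \<le> 1\<^sup>2" "1\<^sup>2 \<le> m\<^sup>2" using y m by (intro power_mono; simp)+
      hence y2: "y\<^sup>2 \<le> m\<^sup>2" by simp
      have "x * y \<le> m * m" using m x y by (intro mult_mono) auto
      hence le: "x * y \<le> 2 * t" using t by (simp add: t_def power2_eq_square)
      have "(x\<^sup>2 + y\<^sup>2) / (4 * t) \<le> 1/2" using x2 y2 t by (simp add: t_def field_simps)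
      moreover have "- (x\<^sup>2 + y\<^sup>2) / (4 * t) = - ((x\<^sup>2 + y\<^sup>2) / (4 * t))" by (simp only: minus_divide_left)
      ultimately have "exp (-1/2) \<le> exp (- (x\<^sup>2 + y\<^sup>2) / (4 * t))" by (simp only: exp_le_cancel_iff)
      hence "(2*t) powr (-l - 1/2) * exp (-1/2) \<le> heat_model l t x y"
        unfolding heat_model_def using le by (simp add: mult_left_mono)
      moreover have "(2*t) powr (-l - 1/2) = 2 powr (-l - 1/2) * m powr (-2*l - 1)"
        using m by (simp add: t_def powr_mult square_powr algebra_simps)
      ultimately have "c0 * (2 powr (-l - 1/2) * m powr (-2*l - 1) * exp (-1/2)) \<le> c0 * heat_model l t x y"
        using c0 by (intro mult_left_mono) auto
      also have "\<dots> \<le> heat_kernel l t x y" using W t x y by blast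
      finally show ?thesis by (simp add: c_def mult_ac)
    qed
    have "ennreal (c * m powr (-2*l - 1)) * strong_functional 1 (2 * l) (\<lambda>y. ennreal (\<phi> y))
       = (\<integral>\<^sup>+y. ennreal (c * m powr (-2*l - 1)) * ennreal (\<phi> y) \<partial>half_line_measure (2 * l))"
      unfolding strong_functional_def epowr_one by (rule nn_integral_cmult[symmetric]) simp
    also have "\<dots> \<le> heat_pos l t (\<lambda>y. ennreal (\<phi> y)) x" unfolding heat_pos_def
    proof (intro nn_integral_mono)
      fix y
      show "ennreal (c * m powr (-2*l - 1)) * ennreal (\<phi> y) \<le> ennreal (heat_kernel l t x y) * ennreal (\<phi> y)"
      proof (cases "y \<in> {a<..<1}")
        case True
        hence "y > 0" "y < 1" using test_functionD(1)[OF \<phi>] by auto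
        thus ?thesis by (intro mult_right_mono ennreal_leI ker) auto
      qed (simp add: test_functionD(5)[OF \<phi>])
    qed
    also have "\<dots> \<le> heat_maximal l (\<lambda>y. complex_of_real (\<phi> y)) x"
      by (rule heat_maximal_ge_heat_pos[OF l t x test_functionD(3,4)[OF \<phi>] test_function_admissible[OF l \<phi>]])
    finally show ?thesis by (simp add: m_def)
  qed
  moreover have "c > 0" using c0 by (simp add: c_def)
  ultimately show ?thesis by blast
qed

text \<open>
  At the level \<open>\<gamma> = c \<kappa> R\<^bsup>-2l-1\<^esup>\<close> the superlevel set of the maximal function contains \<open>(0, R)\<close>. The
  function \<open>S\<close> stands for the value of an extension, which agrees with the maximal function almost everywhere only.
\<close>

lemma weak_inequality_on_test_functions:
  assumes l: "l > -1/2" and p: "p > 0" and c: "c > 0" and lower: "\<forall>a \<phi> x. test_function a 1 \<phi> \<longrightarrow> x > 0 \<longrightarrow>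
     ennreal (c * (max 1 x) powr (-2*l - 1)) * strong_functional 1 (2 * l) (\<lambda>y. ennreal (\<phi> y))
       \<le> heat_maximal l (\<lambda>y. complex_of_real (\<phi> y)) x"
    and \<phi>: "test_function a 1 \<phi>" and \<kappa>: "strong_functional 1 (2 * l) (\<lambda>y. ennreal (\<phi> y)) = ennreal \<kappa>" "\<kappa> > 0"
    and S[measurable]: "S \<in> borel_measurable (power_measure d)"
    and ae: "AE x in power_measure d. S x = heat_maximal l (\<lambda>y. complex_of_real (\<phi> y)) x"
    and weak: "weak_type_ineq (power_measure d) p C S (\<lambda>y. complex_of_real (\<phi> y))" and R: "R > 1"
  shows "emeasure (half_line_measure d) {0<..<R} \<le>
     ennreal (\<bar>C\<bar> * (c * \<kappa> * R powr (-2*l - 1)) powr (-p)) * strong_functional p d (\<lambda>y. ennreal (\<phi> y))"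
proof -
  define \<gamma> where "\<gamma> = c * \<kappa> * R powr (-2*l - 1)"
  have \<gamma>: "\<gamma> > 0" using c \<kappa> R by (simp add: \<gamma>_def)
  let ?f = "\<lambda>y. complex_of_real (\<phi> y)"
  have big: "ennreal \<gamma> < heat_maximal l ?f x" if x: "0 < x" "x < R" for x
  proof -
    have "R powr (-2*l - 1) < (max 1 x) powr (-2*l - 1)" using x R l by (intro powr_less_mono2_neg) auto
    hence "\<gamma> < c * (max 1 x) powr (-2*l - 1) * \<kappa>" using c \<kappa>(2) by (simp add: \<gamma>_def)
    hence "ennreal \<gamma> < ennreal (c * (max 1 x) powr (-2*l - 1)) * ennreal \<kappa>"
      using c \<kappa>(2) \<gamma> by (simp add: ennreal_less_iff flip: ennreal_mult)
    also have "\<dots> \<le> heat_maximal l ?f x" using lower \<phi> x(1) unfolding \<kappa>(1)[symmetric] by blast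
    finally show ?thesis .
  qed
  have "emeasure (half_line_measure d) {0<..<R} = emeasure (power_measure d) {0<..<R}"
    by (rule emeasure_power_measure_borel[symmetric]) auto
  also have "\<dots> \<le> emeasure (power_measure d) {x \<in> space (power_measure d). S x > ennreal \<gamma>}"
  proof (rule emeasure_mono_AE)
    show "AE x in power_measure d. x \<in> {0<..<R} \<longrightarrow> x \<in> {x \<in> space (power_measure d). S x > ennreal \<gamma>}"
      using ae by eventually_elim (use big in auto)
    show "{x \<in> space (power_measure d). S x > ennreal \<gamma>} \<in> sets (power_measure d)" by measurable
  qed
  also have "\<dots> \<le> ennreal (C * \<gamma> powr (- p)) * epowr (lp_norm (power_measure d) p (emod ?f)) p"
    using weak \<gamma> unfolding weak_type_ineq_def by blast
  also have "\<dots> = ennreal (C * \<gamma> powr (- p)) * strong_functional p d (\<lambda>y. ennreal (\<phi> y))"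
    by (simp add: Lp_D(3)[OF test_function_Lp[OF \<phi> p] p test_function_modulus(1)[OF \<phi>]])
  also have "\<dots> \<le> ennreal (\<bar>C\<bar> * \<gamma> powr (- p)) * strong_functional p d (\<lambda>y. ennreal (\<phi> y))"
    by (intro mult_right_mono ennreal_leI) auto
  finally show ?thesis by (simp add: \<gamma>_def)
qed

lemma nn_integral_inverse:
  assumes "0 < \<epsilon>" "\<epsilon> < b"
  shows "(\<integral>\<^sup>+y\<in>{\<epsilon><..<b}. ennreal (1 / y) \<partial>lborel) = ennreal (ln (b / \<epsilon>))"
proof -
  have "(\<integral>\<^sup>+y. ennreal (1 / y) * indicator {\<epsilon>..b} y \<partial>lborel) = ennreal (ln b - ln \<epsilon>)"
    by (rule nn_integral_FTC_Icc)
      (use assms in \<open>auto intro!: derivative_eq_intros simp flip: has_real_derivative_iff_has_vector_derivative\<close>)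
  moreover have "(\<integral>\<^sup>+y\<in>{\<epsilon><..<b}. ennreal (1 / y) \<partial>lborel) = (\<integral>\<^sup>+y. ennreal (1 / y) * indicator {\<epsilon>..b} y \<partial>lborel)"
    using AE_lborel_singleton[of \<epsilon>] AE_lborel_singleton[of b] by (intro nn_integral_cong_AE) (auto split: split_indicator)
  ultimately show ?thesis using assms by (simp add: ln_div)
qed

lemma emeasure_half_line_initial_infinite:
  assumes d: "d \<le> -1" and R: "R > 1"
  shows "emeasure (half_line_measure d) {0<..<R} = top"
proof (rule ccontr)
  assume "emeasure (half_line_measure d) {0<..<R} \<noteq> top"
  then obtain n where n: "emeasure (half_line_measure d) {0<..<R} < of_nat n" using ennreal_Ex_less_of_nat less_top by blast
  define \<epsilon> where "\<epsilon> = exp (- real n - 1)"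
  have \<epsilon>: "0 < \<epsilon>" "\<epsilon> < 1" by (simp_all add: \<epsilon>_def)
  have "of_nat n \<le> ennreal (ln (1 / \<epsilon>))"
    by (simp add: \<epsilon>_def ln_div ennreal_of_nat_eq_real_of_nat ennreal_leI)
  also have "\<dots> = (\<integral>\<^sup>+y\<in>{\<epsilon><..<1}. ennreal (1 / y) \<partial>lborel)" by (rule nn_integral_inverse[OF \<epsilon>, symmetric])
  also have "\<dots> \<le> (\<integral>\<^sup>+y. ennreal (y powr d) * indicator {0<..} y * indicator {0<..<R} y \<partial>lborel)"
  proof (intro nn_integral_mono)
    fix y
    show "ennreal (1 / y) * indicator {\<epsilon><..<1} y \<le> ennreal (y powr d) * indicator {0<..} y * indicator {0<..<R} y"
    proof (cases "y \<in> {\<epsilon><..<1}")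
      case True
      hence y: "0 < y" "y < 1" using \<epsilon> by auto
      have "1 / y = y powr (-1)" using y by (simp add: powr_minus_divide)
      also have "\<dots> \<le> y powr d" using d y by (intro powr_mono') auto
      finally have "ennreal (1 / y) \<le> ennreal (y powr d)" by (rule ennreal_leI)
      thus ?thesis using True y R by simp
    qed simp
  qed
  also have "\<dots> = emeasure (half_line_measure d) {0<..<R}" by (rule emeasure_half_line[symmetric]) simp
  finally show False using n by simp
qed

lemma emeasure_half_line_initial_open:
  assumes d: "d > -1" and R: "R > 0"
  shows "emeasure (half_line_measure d) {0<..<R} = ennreal (R powr (d + 1) / (d + 1))"
proof -
  have "emeasure (half_line_measure d) {0<..<R} = (\<integral>\<^sup>+y\<in>{0<..R}. ennreal (y powr d) \<partial>lborel)"
    using AE_lborel_singleton[of R] by (subst emeasure_half_line) (auto intro!: nn_integral_cong_AE split: split_indicator)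
  also have "\<dots> = ennreal (R powr (d + 1) / (d + 1))" using d R by (intro nn_integral_powr_from_0) auto
  finally show ?thesis .
qed

text \<open>
  For the indicator of \<open>(1/2, 1)\<close> the preceding bound is finite, which excludes \<open>d \<le> -1\<close>; and it grows like
  \<open>R\<^bsup>(2l+1)p\<^esup>\<close>, while the weighted measure of \<open>(0, R)\<close> grows like \<open>R\<^bsup>d+1\<^esup>\<close>.
\<close>

lemma restricted_test_necessary:
  assumes l: "l > -1/2" and p: "p > 0"
    and S: "S \<in> borel_measurable (power_measure d)"
    and ae: "AE x in power_measure d. S x = heat_maximal l (indicator {1/2<..<1}) x"
    and weak: "weak_type_ineq (power_measure d) p C S (indicator {1/2<..<1})"
  shows "-1 < d \<and> d \<le> (2 * l + 1) * p - 1"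
proof -
  define \<phi> where "\<phi> = (indicator {1/2<..<1} :: real \<Rightarrow> real)"
  have f: "indicator {1/2<..<1} = (\<lambda>y. complex_of_real (\<phi> y))" by (auto simp: \<phi>_def split: split_indicator)
  have \<phi>: "test_function (1/2) 1 \<phi>" unfolding test_function_def \<phi>_def by (auto intro!: exI[of _ 1])
  note [measurable] = test_functionD(3)[OF \<phi>]
  obtain \<kappa> where \<kappa>0: "strong_functional 1 (2 * l) (\<lambda>y. ennreal (\<phi> y)) = ennreal \<kappa>" "\<kappa> \<ge> 0"
    using strong_functional_test_function_finite[OF \<phi>, of 1 "2 * l"] by (cases "strong_functional 1 (2 * l) (\<lambda>y. ennreal (\<phi> y))") auto
  have "\<kappa> > 0"
  proof -
    have "ennreal (1 powr (2*l)) * (\<integral>\<^sup>+y\<in>{1/2<..<1::real}. 1 \<partial>lborel) \<le> ennreal (2 powr \<bar>2*l\<bar>) * (\<integral>\<^sup>+y\<in>{1/2<..<1}. 1 \<partial>half_line_measure (2*l))"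
      by (rule half_line_comparison(2)) auto
    also have "(\<integral>\<^sup>+y\<in>{1/2<..<1}. 1 \<partial>half_line_measure (2*l)) = ennreal \<kappa>"
    proof -
      have "ennreal (\<phi> y) = 1 * indicator {1/2<..<1} y" for y by (simp add: \<phi>_def split: split_indicator)
      thus ?thesis unfolding \<kappa>0(1)[symmetric] strong_functional_def epowr_one by (simp only:)
    qed
    finally show ?thesis using \<kappa>0(2) by (cases "\<kappa> = 0") auto
  qed
  note \<kappa> = \<kappa>0(1) this
  obtain N where N: "strong_functional p d (\<lambda>y. ennreal (\<phi> y)) = ennreal N" "N \<ge> 0"
    using strong_functional_test_function_finite[OF \<phi> p, of d] by (cases "strong_functional p d (\<lambda>y. ennreal (\<phi> y))") auto
  obtain c where c: "c > 0" and lower: "\<forall>a \<phi> x. test_function a 1 \<phi> \<longrightarrow> x > 0 \<longrightarrow>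
     ennreal (c * (max 1 x) powr (-2*l - 1)) * strong_functional 1 (2 * l) (\<lambda>y. ennreal (\<phi> y))
       \<le> heat_maximal l (\<lambda>y. complex_of_real (\<phi> y)) x"
    using heat_maximal_lower_bound[OF l] by blast
  have key: "emeasure (half_line_measure d) {0<..<R} \<le> ennreal (\<bar>C\<bar> * (c * \<kappa> * R powr (-2*l - 1)) powr (-p) * N)" if "R > 1" for R
    using weak_inequality_on_test_functions[OF l p c lower \<phi> \<kappa> S ae[unfolded f] weak[unfolded f] that] N
    by (simp add: ennreal_mult)
  have d1: "-1 < d"
  proof (rule ccontr)
    assume "\<not> -1 < d"
    hence "emeasure (half_line_measure d) {0<..<2} = top" by (intro emeasure_half_line_initial_infinite) auto
    with key[of 2] show False by (simp add: top_unique)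
  qed
  define E where "E = d + 1 - (2 * l + 1) * p"
  define K where "K = (d + 1) * (\<bar>C\<bar> * (c * \<kappa>) powr (-p) * N)"
  have K: "K \<ge> 0" using d1 N by (simp add: K_def)
  have bd: "R powr E \<le> K" if R: "R > 1" for R
  proof -
    have "ennreal (R powr (d + 1) / (d + 1)) \<le> ennreal (\<bar>C\<bar> * (c * \<kappa> * R powr (-2*l - 1)) powr (-p) * N)"
      using key[OF R] d1 R by (simp add: emeasure_half_line_initial_open)
    hence "R powr (d + 1) / (d + 1) \<le> \<bar>C\<bar> * (c * \<kappa> * R powr (-2*l - 1)) powr (-p) * N"
      using N by (subst (asm) ennreal_le_iff) auto
    also have "(c * \<kappa> * R powr (-2*l - 1)) powr (-p) = (c * \<kappa>) powr (-p) * R powr ((2 * l + 1) * p)"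
      using c \<kappa> by (simp add: powr_mult powr_powr) (simp add: algebra_simps)
    finally have "R powr (d + 1) \<le> K * R powr ((2 * l + 1) * p)" using d1 by (simp add: K_def field_simps)
    from mult_right_mono[OF this, of "R powr (- ((2 * l + 1) * p))"]
    have "R powr (d + 1) * R powr (- ((2 * l + 1) * p)) \<le> K * (R powr ((2 * l + 1) * p) * R powr (- ((2 * l + 1) * p)))" by (simp add: mult.assoc)
    moreover have "R powr ((2 * l + 1) * p) * R powr (- ((2 * l + 1) * p)) = 1" using R by (simp only: powr_add[symmetric]) simp
    moreover have "R powr (d + 1) * R powr (- ((2 * l + 1) * p)) = R powr E" unfolding E_def by (simp only: powr_add[symmetric]) simp
    ultimately show ?thesis by simp
  qed
  have "E \<le> 0"
  proof (rule ccontr)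
    assume "\<not> E \<le> 0"
    hence E: "E > 0" by simp
    define R where "R = (K + 2) powr (1 / E)"
    have "R > 1 powr (1 / E)" unfolding R_def using K E by (intro powr_less_mono2) auto
    hence "R powr E \<le> K" by (intro bd) simp
    moreover have "R powr E = K + 2" unfolding R_def powr_powr using E K by simp
    ultimately show False by simp
  qed
  thus ?thesis using d1 by (simp add: E_def)
qed

lemma weak_type_range:
  assumes l: "l > -1/2" and p: "p > 0" and W: "weak_type (power_measure (2 * l)) (power_measure d) p (heat_maximal l)"
  shows "-1 < d \<and> d \<le> (2 * l + 1) * p - 1"
proof -
  obtain S C where ext: "sublinear_extension (power_measure (2 * l)) (power_measure d) p (heat_maximal l) S"
    and weak: "\<forall>f \<in> Lp (power_measure d) p. weak_type_ineq (power_measure d) p C (S f) f"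
    using W unfolding weak_type_def by blast
  define \<phi> where "\<phi> = (indicator {1/2<..<1} :: real \<Rightarrow> real)"
  have f: "indicator {1/2<..<1} = (\<lambda>y. complex_of_real (\<phi> y))" by (auto simp: \<phi>_def split: split_indicator)
  have \<phi>: "test_function (1/2) 1 \<phi>" unfolding test_function_def \<phi>_def by (auto intro!: exI[of _ 1])
  have "indicator {1/2<..<1} \<in> Lp (power_measure d) p" "indicator {1/2<..<1} \<in> Lp (power_measure (2 * l)) 2"
    unfolding f by (intro test_function_Lp[OF \<phi>] p; simp)+
  thus ?thesis using ext weak unfolding sublinear_extension_def
    by (intro restricted_test_necessary[OF l p, of "S (indicator {1/2<..<1})" d C]) auto
qed

lemma restricted_weak_type_range:
  assumes l: "l > -1/2" and p: "p > 0" and W: "restricted_weak_type (power_measure d) p (heat_maximal l)"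
  shows "-1 < d \<and> d \<le> (2 * l + 1) * p - 1"
proof -
  define \<phi> where "\<phi> = (indicator {1/2<..<1} :: real \<Rightarrow> real)"
  have \<phi>: "test_function (1/2) 1 \<phi>" unfolding test_function_def \<phi>_def by (auto intro!: exI[of _ 1])
  have "emeasure (power_measure d) {1/2<..<1} = strong_functional 1 d (\<lambda>y. ennreal (\<phi> y))"
  proof -
    have "ennreal (\<phi> y) = indicator {1/2<..<1} y" for y by (simp add: \<phi>_def split: split_indicator)
    thus ?thesis unfolding strong_functional_def by (subst emeasure_power_measure_borel) auto
  qed
  hence "emeasure (power_measure d) {1/2<..<1} < top" using strong_functional_test_function_finite[OF \<phi>, of 1 d] by simp
  moreover have "{1/2<..<1} \<in> sets (power_measure d)" by (auto simp: sets_restrict_space_iff)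
  ultimately obtain C where C: "heat_maximal l (indicator {1/2<..<1}) \<in> borel_measurable (power_measure d)"
      "weak_type_ineq (power_measure d) p C (heat_maximal l (indicator {1/2<..<1})) (indicator {1/2<..<1})"
    using W unfolding restricted_weak_type_def by blast
  show ?thesis by (rule restricted_test_necessary[OF l p C(1) _ C(2)]) simp
qed

text \<open>
  The function \<open>y\<^bsup>-2l-1\<^esup>\<close> on \<open>(\<epsilon>, 1)\<close> has both integral and \<open>p\<close>-th power of the norm equal to \<open>L = ln(1/\<epsilon>)\<close>. The weak inequality
  on the fixed interval \<open>(0, 2)\<close> then reads \<open>1 \<le> K L\<^bsup>1-p\<^esup>\<close> for all \<open>L > 0\<close>.
\<close>

lemma weak_type_endpoint_fails:
  assumes l: "l > -1/2" and p: "p > 1" and d: "d + 1 = (2 * l + 1) * p"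
  shows "\<not> weak_type (power_measure (2 * l)) (power_measure d) p (heat_maximal l)"
proof
  assume W: "weak_type (power_measure (2 * l)) (power_measure d) p (heat_maximal l)"
  have p0: "p > 0" using p by simp
  have d1: "d > -1" using weak_type_range[OF l p0 W] by simp
  obtain S C where ext: "sublinear_extension (power_measure (2 * l)) (power_measure d) p (heat_maximal l) S"
    and weak: "\<forall>f \<in> Lp (power_measure d) p. weak_type_ineq (power_measure d) p C (S f) f"
    using W unfolding weak_type_def by blast
  obtain c where c: "c > 0" and lower: "\<forall>a \<phi> x. test_function a 1 \<phi> \<longrightarrow> x > 0 \<longrightarrow>
     ennreal (c * (max 1 x) powr (-2*l - 1)) * strong_functional 1 (2 * l) (\<lambda>y. ennreal (\<phi> y))
       \<le> heat_maximal l (\<lambda>y. complex_of_real (\<phi> y)) x"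
    using heat_maximal_lower_bound[OF l] by blast
  define K where "K = (d + 1) / 2 powr (d + 1) * (\<bar>C\<bar> * (c * 2 powr (-2*l - 1)) powr (-p))"
  have K: "K \<ge> 0" using d1 by (simp add: K_def)
  have bd: "L powr (p - 1) \<le> K" if L: "L > 0" for L
  proof -
    define \<epsilon> where "\<epsilon> = exp (- L)"
    have \<epsilon>: "0 < \<epsilon>" "\<epsilon> < 1" using L by (simp_all add: \<epsilon>_def)
    have lnL: "ln (1 / \<epsilon>) = L" by (simp add: \<epsilon>_def ln_div)
    define \<phi> where "\<phi> = (\<lambda>y::real. y powr (-2*l - 1) * indicator {\<epsilon><..<1} y)"
    have "\<phi> y \<le> \<epsilon> powr (-2*l - 1) * indicator {\<epsilon><..<1} y" for y
      using \<epsilon> l by (auto simp: \<phi>_def split: split_indicator intro!: powr_mono2')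
    hence \<phi>: "test_function \<epsilon> 1 \<phi>" unfolding test_function_def using \<epsilon> by (auto simp: \<phi>_def intro!: exI[of _ "\<epsilon> powr (-2*l - 1)"])
    have \<kappa>: "strong_functional q e (\<lambda>y. ennreal (\<phi> y)) = ennreal L" if e: "e + 1 = (2 * l + 1) * q" for q e
    proof -
      have "strong_functional q e (\<lambda>y. ennreal (\<phi> y)) = (\<integral>\<^sup>+y\<in>{\<epsilon><..<1}. ennreal (1 / y) \<partial>lborel)"
        unfolding strong_functional_def
      proof (subst nn_integral_half_line)
        show "(\<lambda>y. epowr (ennreal (\<phi> y)) q) \<in> borel_measurable borel" unfolding \<phi>_def by measurable
        show "(\<integral>\<^sup>+y. ennreal (y powr e) * indicator {0<..} y * epowr (ennreal (\<phi> y)) q \<partial>lborel) = (\<integral>\<^sup>+y\<in>{\<epsilon><..<1}. ennreal (1 / y) \<partial>lborel)"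
        proof (intro nn_integral_cong)
          fix y
          show "ennreal (y powr e) * indicator {0<..} y * epowr (ennreal (\<phi> y)) q = ennreal (1 / y) * indicator {\<epsilon><..<1} y"
          proof (cases "y \<in> {\<epsilon><..<1}")
            case True
            hence y: "y > 0" using \<epsilon> by auto
            have "e + (-2*l - 1) * q = -1" using e by (simp add: algebra_simps)
            hence "y powr e * (y powr (-2*l - 1)) powr q = y powr (-1)" by (simp only: powr_powr powr_add[symmetric])
            also have "\<dots> = 1 / y" using y by (simp add: powr_minus_divide)
            finally have "y powr e * (y powr (-2*l - 1)) powr q = 1 / y" .
            thus ?thesis using True y by (simp add: \<phi>_def flip: ennreal_mult)
          qed (simp add: \<phi>_def)
        qed
      qed
      also have "\<dots> = ennreal L" unfolding nn_integral_inverse[OF \<epsilon>] lnL ..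
      finally show ?thesis .
    qed
    have \<kappa>1: "strong_functional 1 (2 * l) (\<lambda>y. ennreal (\<phi> y)) = ennreal L" by (rule \<kappa>) simp
    let ?f = "\<lambda>y. complex_of_real (\<phi> y)"
    have "?f \<in> Lp (power_measure d) p" "?f \<in> Lp (power_measure (2 * l)) 2"
      by (intro test_function_Lp[OF \<phi>] p0; simp)+
    hence S: "S ?f \<in> borel_measurable (power_measure d)" "AE x in power_measure d. S ?f x = heat_maximal l ?f x"
      "weak_type_ineq (power_measure d) p C (S ?f) ?f"
      using ext weak unfolding sublinear_extension_def by blast+
    have "emeasure (half_line_measure d) {0<..<2} \<le> ennreal (\<bar>C\<bar> * (c * L * 2 powr (-2*l - 1)) powr (-p)) * ennreal L"
      using weak_inequality_on_test_functions[OF l p0 c lower \<phi> \<kappa>1 L S, of 2] unfolding \<kappa>[OF d] by simp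
    hence "ennreal (2 powr (d + 1) / (d + 1)) \<le> ennreal (\<bar>C\<bar> * (c * L * 2 powr (-2*l - 1)) powr (-p) * L)"
      using d1 L by (simp add: emeasure_half_line_initial_open ennreal_mult)
    hence "2 powr (d + 1) / (d + 1) \<le> \<bar>C\<bar> * (c * L * 2 powr (-2*l - 1)) powr (-p) * L"
      using L by (subst (asm) ennreal_le_iff) auto
    also have "(c * L * 2 powr (-2*l - 1)) powr (-p) = (c * 2 powr (-2*l - 1)) powr (-p) * L powr (-p)"
    proof -
      have "c * L * 2 powr (-2*l - 1) = (c * 2 powr (-2*l - 1)) * L" by simp
      thus ?thesis using c L by (simp only: powr_mult)
    qed
    finally have "2 powr (d + 1) / (d + 1) \<le> \<bar>C\<bar> * (c * 2 powr (-2*l - 1)) powr (-p) * (L powr (-p) * L)" by (simp add: mult.assoc)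
    also have "L powr (-p) * L = L powr (-p) * L powr 1" using L by simp
    also have "\<dots> = L powr (- (p - 1))" by (simp only: powr_add[symmetric]) simp
    finally have "2 powr (d + 1) / (d + 1) \<le> \<bar>C\<bar> * (c * 2 powr (-2*l - 1)) powr (-p) * L powr (- (p - 1))" .
    from mult_right_mono[OF this, of "L powr (p - 1)"]
    have "2 powr (d + 1) / (d + 1) * L powr (p - 1) \<le> \<bar>C\<bar> * (c * 2 powr (-2*l - 1)) powr (-p) * (L powr (- (p - 1)) * L powr (p - 1))" by (simp add: mult.assoc)
    also have "L powr (- (p - 1)) * L powr (p - 1) = 1" using L by (simp only: powr_add[symmetric]) simp
    finally have "2 powr (d + 1) / (d + 1) * L powr (p - 1) \<le> \<bar>C\<bar> * (c * 2 powr (-2*l - 1)) powr (-p)" by (simp only: mult_1_right)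
    from mult_left_mono[OF this, of "(d + 1) / 2 powr (d + 1)"] d1
    show ?thesis by (simp add: K_def)
  qed
  \<comment> \<open>The value at which \<open>L powr (p - 1)\<close> exceeds the bound \<open>K\<close>.\<close>
  define L where "L = (K + 1) powr (1 / (p - 1))"
  have "L > 0" using K by (simp add: L_def)
  from bd[OF this] have "L powr (p - 1) \<le> K" .
  moreover have "L powr (p - 1) = K + 1" unfolding L_def powr_powr using p K by simp
  ultimately show False by simp
qed

lemma strong_type_imp_weak_type:
  assumes p: "p > 0" and ST: "strong_type M0 M p T"
  shows "weak_type M0 M p T"
proof -
  obtain S C where ext: "sublinear_extension M0 M p T S"
    and C: "\<forall>f \<in> Lp M p. lp_norm M p (S f) \<le> ennreal C * lp_norm M p (emod f)"
    using ST unfolding strong_type_def by blast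
  have "weak_type_ineq M p (\<bar>C\<bar> powr p) (S f) f" if f: "f \<in> Lp M p" for f
    unfolding weak_type_ineq_def
  proof (intro allI impI)
    fix \<gamma> :: real assume \<gamma>: "\<gamma> > 0"
    have [measurable]: "S f \<in> borel_measurable M" using ext f unfolding sublinear_extension_def by blast
    let ?E = "{x \<in> space M. S f x > ennreal \<gamma>}"
    have "ennreal (\<gamma> powr p) * emeasure M ?E = (\<integral>\<^sup>+x. ennreal (\<gamma> powr p) * indicator ?E x \<partial>M)"
      by (simp add: nn_integral_cmult)
    also have "\<dots> \<le> (\<integral>\<^sup>+x. epowr (S f x) p \<partial>M)"
    proof (intro nn_integral_mono)
      fix x
      have "ennreal (\<gamma> powr p) \<le> epowr (S f x) p" if "S f x > ennreal \<gamma>"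
        using epowr_mono[of "ennreal \<gamma>" "S f x" p] that \<gamma> p by simp
      thus "ennreal (\<gamma> powr p) * indicator ?E x \<le> epowr (S f x) p" by (auto split: split_indicator)
    qed
    also have "\<dots> = epowr (lp_norm M p (S f)) p" unfolding lp_norm_def using p by (simp add: epowr_epowr)
    also have "\<dots> \<le> epowr (ennreal \<bar>C\<bar> * lp_norm M p (emod f)) p"
    proof (rule epowr_mono)
      have "lp_norm M p (S f) \<le> ennreal C * lp_norm M p (emod f)" using C f by blast
      also have "\<dots> \<le> ennreal \<bar>C\<bar> * lp_norm M p (emod f)" by (intro mult_right_mono ennreal_leI) auto
      finally show "lp_norm M p (S f) \<le> ennreal \<bar>C\<bar> * lp_norm M p (emod f)" .
    qed (use p in simp)
    also have "\<dots> = ennreal (\<bar>C\<bar> powr p) * epowr (lp_norm M p (emod f)) p" by (rule epowr_cmult) simp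
    finally have "emeasure M ?E \<le> ennreal (1 / \<gamma> powr p) * (ennreal (\<bar>C\<bar> powr p) * epowr (lp_norm M p (emod f)) p)"
      using \<gamma> by (intro ennreal_le_inverse_mult) auto
    also have "\<dots> = ennreal (1 / \<gamma> powr p * \<bar>C\<bar> powr p) * epowr (lp_norm M p (emod f)) p"
      by (rule ennreal_cmult_cmult) auto
    also have "1 / \<gamma> powr p * \<bar>C\<bar> powr p = \<bar>C\<bar> powr p * \<gamma> powr (- p)" by (simp add: powr_minus_divide)
    finally show "emeasure M ?E \<le> ennreal (\<bar>C\<bar> powr p * \<gamma> powr (- p)) * epowr (lp_norm M p (emod f)) p" .
  qed
  thus ?thesis unfolding weak_type_def using ext by blast
qed

text \<open>
  The choice \<open>t = (x - 1)\<^sup>2\<close> makes the width of the Gaussian equal to the distance of \<open>x\<close> from the left end of the bump. For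
  \<open>x < 2\<close> this is in the large argument regime.
\<close>

lemma heat_maximal_near_unit_interval:
  assumes l: "l > -1/2"
  shows "\<exists>c>0. \<forall>\<epsilon> x. 0 < \<epsilon> \<longrightarrow> 1 + \<epsilon> < x \<longrightarrow> x < 2 \<longrightarrow>
     ennreal (c * \<epsilon> * (1 / (x - 1))) \<le> heat_maximal l (\<lambda>y. complex_of_real (indicator {1<..<1+\<epsilon>} y)) x"
proof -
  obtain c0 where c0: "c0 > 0" and W: "\<forall>t>0. \<forall>x>0. \<forall>y>0. c0 * heat_model l t x y \<le> heat_kernel l t x y"
    using heat_kernel_two_sided[OF l] by meson
  define A where "A = 4 powr (-\<bar>l\<bar>) * 2 powr (-1/2) * exp (-1/4 :: real)"
  define c where "c = 2 powr (-\<bar>2*l\<bar>) * (c0 * A)"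
  have "ennreal (c * \<epsilon> * (1 / (x - 1))) \<le> heat_maximal l (\<lambda>y. complex_of_real (indicator {1<..<1+\<epsilon>} y)) x"
    if \<epsilon>: "0 < \<epsilon>" "1 + \<epsilon> < x" "x < 2" for \<epsilon> x
  proof -
    let ?\<phi> = "\<lambda>y::real. indicator {1<..<1+\<epsilon>} y :: real"
    have \<phi>: "test_function 1 (1 + \<epsilon>) ?\<phi>" unfolding test_function_def using \<epsilon> by (auto intro!: exI[of _ 1])
    note [measurable] = test_functionD(3)[OF \<phi>]
    define t where "t = (x - 1)\<^sup>2"
    have t: "t > 0" and x: "x > 0" and x1: "x - 1 > 0" using \<epsilon> by (auto simp: t_def)
    have ker: "c0 * A / (x - 1) \<le> heat_kernel l t x y" if y: "1 < y" "y < 1 + \<epsilon>" for y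
    proof -
      have "(x - 1) * (x - 1) \<le> (x - 1) * 1" using \<epsilon> by (intro mult_left_mono) auto
      hence "t \<le> x - 1" by (simp add: t_def power2_eq_square)
      hence "2 * t < x" using \<epsilon> by linarith
      also have "x \<le> x * y" using x y by simp
      finally have gt: "x * y > 2 * t" .
      have xy: "1 \<le> x * y" "x * y \<le> 4"
      proof -
        have "1 * 1 \<le> x * y" "x * y \<le> 2 * 2" using \<epsilon> y by (intro mult_mono; simp)+
        thus "1 \<le> x * y" "x * y \<le> 4" by simp_all
      qed
      have p1: "4 powr (-\<bar>l\<bar>) \<le> (x * y) powr (-l)"
      proof -
        have "4 powr (-\<bar>l\<bar>) \<le> (x * y) powr (-\<bar>l\<bar>)" using xy by (intro powr_mono2') auto
        also have "\<dots> \<le> (x * y) powr (-l)" using xy by (intro powr_mono) auto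
        finally show ?thesis .
      qed
      have p2: "(2 * t) powr (-1/2) = 2 powr (-1/2) * (1 / (x - 1))"
        using x1 by (simp add: t_def powr_mult square_powr powr_minus_divide)
      have p3: "exp (-1/4) \<le> exp (- (x - y)\<^sup>2 / (4 * t))"
      proof -
        have "(x - y)\<^sup>2 \<le> t" unfolding t_def using \<epsilon> y by (intro power_mono) auto
        hence "(x - y)\<^sup>2 / (4 * t) \<le> 1/4" using t by (simp add: field_simps)
        moreover have "- (x - y)\<^sup>2 / (4 * t) = - ((x - y)\<^sup>2 / (4 * t))" by (simp only: minus_divide_left)
        ultimately show ?thesis by (simp only: exp_le_cancel_iff)
      qed
      have "4 powr (-\<bar>l\<bar>) * (2 powr (-1/2) * (1 / (x - 1))) * exp (-1/4) \<le> (x * y) powr (-l) * (2 * t) powr (-1/2) * exp (- (x - y)\<^sup>2 / (4 * t))"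
        unfolding p2[symmetric] by (intro mult_mono p1 p3) auto
      hence "A / (x - 1) \<le> heat_model l t x y" using gt by (simp add: heat_model_def A_def)
      from mult_left_mono[OF this, of c0] c0 have "c0 * A / (x - 1) \<le> c0 * heat_model l t x y" by simp
      also have "\<dots> \<le> heat_kernel l t x y" using W t x y by simp
      finally show ?thesis .
    qed
    have e1: "\<epsilon> < 1" using \<epsilon> by simp
    have "ennreal \<epsilon> \<le> ennreal (2 powr \<bar>2*l\<bar>) * (\<integral>\<^sup>+y\<in>{1<..<1+\<epsilon>}. 1 \<partial>half_line_measure (2 * l))"
      using half_line_comparison(2)[of 1 "\<lambda>_. 1" "{1<..<1+\<epsilon>}" "2*l"] e1 \<epsilon> by (auto simp: subset_iff)
    from ennreal_le_inverse_mult[of "2 powr (-\<bar>2*l\<bar>)" "ennreal \<epsilon>", OF _ order_refl]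
    have m: "ennreal (2 powr (-\<bar>2*l\<bar>)) * ennreal \<epsilon> \<le> (\<integral>\<^sup>+y\<in>{1<..<1+\<epsilon>}. 1 \<partial>half_line_measure (2 * l))"
    proof -
      have "ennreal (2 powr (-\<bar>2*l\<bar>)) * ennreal \<epsilon> \<le> ennreal (2 powr (-\<bar>2*l\<bar>)) * (ennreal (2 powr \<bar>2*l\<bar>) * (\<integral>\<^sup>+y\<in>{1<..<1+\<epsilon>}. 1 \<partial>half_line_measure (2 * l)))"
        by (rule mult_left_mono) (use \<open>ennreal \<epsilon> \<le> _\<close> in auto)
      also have "\<dots> = (\<integral>\<^sup>+y\<in>{1<..<1+\<epsilon>}. 1 \<partial>half_line_measure (2 * l))"
        by (subst ennreal_cmult_cmult) (auto simp: powr_minus_divide)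
      finally show ?thesis .
    qed
    have A0: "A \<ge> 0" by (simp add: A_def)
    have "ennreal (c * \<epsilon> * (1 / (x - 1))) = ennreal (c0 * A / (x - 1)) * (ennreal (2 powr (-\<bar>2*l\<bar>)) * ennreal \<epsilon>)"
      using c0 A0 \<epsilon> x1 by (simp add: c_def flip: ennreal_mult)
    also have "\<dots> \<le> ennreal (c0 * A / (x - 1)) * (\<integral>\<^sup>+y\<in>{1<..<1+\<epsilon>}. 1 \<partial>half_line_measure (2 * l))"
      by (intro mult_left_mono m) simp
    also have "\<dots> = (\<integral>\<^sup>+y. ennreal (c0 * A / (x - 1)) * (1 * indicator {1<..<1+\<epsilon>} y) \<partial>half_line_measure (2 * l))"
      by (rule nn_integral_cmult[symmetric]) simp
    also have "\<dots> \<le> heat_pos l t (\<lambda>y. ennreal (?\<phi> y)) x" unfolding heat_pos_def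
    proof (intro nn_integral_mono)
      fix y
      show "ennreal (c0 * A / (x - 1)) * (1 * indicator {1<..<1+\<epsilon>} y) \<le> ennreal (heat_kernel l t x y) * ennreal (?\<phi> y)"
        using ker[of y] by (cases "y \<in> {1<..<1+\<epsilon>}") (auto intro!: ennreal_leI)
    qed
    also have "\<dots> \<le> heat_maximal l (\<lambda>y. complex_of_real (?\<phi> y)) x"
      by (rule heat_maximal_ge_heat_pos[OF l t x test_functionD(3,4)[OF \<phi>] test_function_admissible[OF l \<phi>]])
    finally show ?thesis .
  qed
  moreover have "c > 0" using c0 by (simp add: c_def A_def)
  ultimately show ?thesis by blast
qed

text \<open>
  The indicators of \<open>(1, 1 + \<epsilon>)\<close> have norm of order \<open>\<epsilon>\<close>, but by the preceding bound the norm of their maximal functions is at least of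
  order \<open>\<epsilon> ln(1/\<epsilon>)\<close>.
\<close>

lemma strong_type_1_fails:
  assumes l: "l > -1/2"
  shows "\<not> strong_type (power_measure (2 * l)) (power_measure d) 1 (heat_maximal l)"
proof
  assume "strong_type (power_measure (2 * l)) (power_measure d) 1 (heat_maximal l)"
  then obtain S C where ext: "sublinear_extension (power_measure (2 * l)) (power_measure d) 1 (heat_maximal l) S"
    and C: "\<forall>f \<in> Lp (power_measure d) 1. lp_norm (power_measure d) 1 (S f) \<le> ennreal C * lp_norm (power_measure d) 1 (emod f)"
    unfolding strong_type_def by blast
  obtain c where c: "c > 0" and lower: "\<forall>\<epsilon> x. 0 < \<epsilon> \<longrightarrow> 1 + \<epsilon> < x \<longrightarrow> x < 2 \<longrightarrow>
     ennreal (c * \<epsilon> * (1 / (x - 1))) \<le> heat_maximal l (\<lambda>y. complex_of_real (indicator {1<..<1+\<epsilon>} y)) x"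
    using heat_maximal_near_unit_interval[OF l] by blast
  define D where "D = 2 powr \<bar>d\<bar>"
  have D: "D > 0" by (simp add: D_def)
  define K where "K = D * \<bar>C\<bar> * D / c"
  have bd: "ln (1 / \<epsilon>) \<le> K" if \<epsilon>: "0 < \<epsilon>" "\<epsilon> < 1" for \<epsilon>
  proof -
    let ?\<phi> = "\<lambda>y::real. indicator {1<..<1+\<epsilon>} y :: real"
    let ?f = "\<lambda>y. complex_of_real (?\<phi> y)"
    have \<phi>: "test_function 1 (1 + \<epsilon>) ?\<phi>" unfolding test_function_def using \<epsilon> by (auto intro!: exI[of _ 1])
    have "?f \<in> Lp (power_measure d) 1" "?f \<in> Lp (power_measure (2 * l)) 2"
      by (intro test_function_Lp[OF \<phi>]; simp)+
    hence S[measurable]: "S ?f \<in> borel_measurable (power_measure d)" and ae: "AE x in power_measure d. S ?f x = heat_maximal l ?f x"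
      and le: "lp_norm (power_measure d) 1 (S ?f) \<le> ennreal C * lp_norm (power_measure d) 1 (emod ?f)"
      using ext C unfolding sublinear_extension_def by blast+
    have up: "lp_norm (power_measure d) 1 (emod ?f) \<le> ennreal (D * \<epsilon>)"
    proof -
      have "lp_norm (power_measure d) 1 (emod ?f) = (\<integral>\<^sup>+y\<in>{1<..<1+\<epsilon>}. 1 \<partial>half_line_measure d)"
      proof -
        have "epowr (ennreal (?\<phi> y)) 1 = 1 * indicator {1<..<1+\<epsilon>} y" for y by (simp split: split_indicator)
        thus ?thesis unfolding lp_norm_borel_modulus[OF test_function_modulus[OF \<phi>]] strong_functional_def
          by (simp only: div_by_1 epowr_one)
      qed
      also have "\<dots> \<le> ennreal (2 powr \<bar>d\<bar> * 1 powr d) * (\<integral>\<^sup>+y\<in>{1<..<1+\<epsilon>}. 1 \<partial>lborel)"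
        by (rule half_line_comparison(1)) (use \<epsilon> in auto)
      also have "\<dots> = ennreal (D * \<epsilon>)" using \<epsilon> by (simp add: D_def ennreal_mult)
      finally show ?thesis .
    qed
    have "ennreal (c * \<epsilon> * ln (1 / \<epsilon>)) = ennreal (c * \<epsilon>) * (\<integral>\<^sup>+y\<in>{\<epsilon><..<1}. ennreal (1 / y) \<partial>lborel)"
      using nn_integral_inverse[OF \<epsilon>] \<epsilon> c by (simp add: ennreal_mult')
    also have "(\<integral>\<^sup>+y\<in>{\<epsilon><..<1}. ennreal (1 / y) \<partial>lborel) = (\<integral>\<^sup>+x\<in>{1+\<epsilon><..<2}. ennreal (1 / (x - 1)) \<partial>lborel)"
      using nn_integral_real_affine[of "\<lambda>y. ennreal (1 / y) * indicator {\<epsilon><..<1} y" 1 "-1"]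
      by (auto intro!: nn_integral_cong split: split_indicator)
    also have "ennreal (c * \<epsilon>) * (\<integral>\<^sup>+x\<in>{1+\<epsilon><..<2}. ennreal (1 / (x - 1)) \<partial>lborel)
        = (\<integral>\<^sup>+x\<in>{1+\<epsilon><..<2}. ennreal (c * \<epsilon> * (1 / (x - 1))) \<partial>lborel)"
    proof -
      have "ennreal (c * \<epsilon>) * (ennreal (1 / (x - 1)) * indicator {1+\<epsilon><..<2} x)
         = ennreal (c * \<epsilon> * (1 / (x - 1))) * indicator {1+\<epsilon><..<2} x" for x
      proof (cases "x \<in> {1+\<epsilon><..<2}")
        case True
        have "ennreal (c * \<epsilon> * (1 / (x - 1))) = ennreal (c * \<epsilon>) * ennreal (1 / (x - 1))"
          by (rule ennreal_mult) (use c \<epsilon> True in auto)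
        thus ?thesis by (simp only: mult.assoc)
      qed simp
      thus ?thesis by (subst nn_integral_cmult[symmetric]) auto
    qed
    also have "\<dots> \<le> ennreal D * (\<integral>\<^sup>+x\<in>{1+\<epsilon><..<2}. ennreal (c * \<epsilon> * (1 / (x - 1))) \<partial>half_line_measure d)"
      using half_line_comparison(2)[of 1 "\<lambda>x. ennreal (c * \<epsilon> * (1 / (x - 1)))" "{1+\<epsilon><..<2}" d] \<epsilon> by (auto simp: D_def subset_iff)
    also have "\<dots> = ennreal D * (\<integral>\<^sup>+x\<in>{1+\<epsilon><..<2}. ennreal (c * \<epsilon> * (1 / (x - 1))) \<partial>power_measure d)"
      by (subst nn_integral_power_measure_borel) auto
    also have "(\<integral>\<^sup>+x\<in>{1+\<epsilon><..<2}. ennreal (c * \<epsilon> * (1 / (x - 1))) \<partial>power_measure d) \<le> (\<integral>\<^sup>+x. S ?f x \<partial>power_measure d)"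
    proof (rule nn_integral_mono_AE)
      show "AE x in power_measure d. ennreal (c * \<epsilon> * (1 / (x - 1))) * indicator {1+\<epsilon><..<2} x \<le> S ?f x"
        using ae by eventually_elim (use lower \<epsilon> in \<open>auto split: split_indicator\<close>)
    qed
    also have "(\<integral>\<^sup>+x. S ?f x \<partial>power_measure d) = lp_norm (power_measure d) 1 (S ?f)" by (simp add: lp_norm_def)
    also have "\<dots> \<le> ennreal \<bar>C\<bar> * ennreal (D * \<epsilon>)"
      by (rule order_trans[OF le]) (intro mult_mono up ennreal_leI; simp)
    finally have "ennreal (c * \<epsilon> * ln (1 / \<epsilon>)) \<le> ennreal D * (ennreal \<bar>C\<bar> * ennreal (D * \<epsilon>))"
      by (simp add: mult_left_mono)
    also have "\<dots> = ennreal (D * (\<bar>C\<bar> * (D * \<epsilon>)))" using D \<epsilon> by (simp add: ennreal_mult)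
    finally have "c * \<epsilon> * ln (1 / \<epsilon>) \<le> D * (\<bar>C\<bar> * (D * \<epsilon>))" using D \<epsilon> by (subst (asm) ennreal_le_iff) auto
    hence "\<epsilon> * (c * ln (1 / \<epsilon>)) \<le> \<epsilon> * (D * \<bar>C\<bar> * D)" by (simp add: mult_ac)
    hence "c * ln (1 / \<epsilon>) \<le> D * \<bar>C\<bar> * D" using \<epsilon> by (simp only: mult_le_cancel_left_pos)
    thus ?thesis unfolding K_def using c by (simp add: pos_le_divide_eq mult.commute)
  qed
  have K: "K \<ge> 0" using c D by (simp add: K_def)
  have "ln (1 / exp (- (K + 1))) \<le> K" by (rule bd) (use K in auto)
  thus False by (simp add: ln_div)
qed

theorem theorem1:
  fixes l p \<delta> :: real
  assumes "l > - 1 / 2" and "1 \<le> p"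
  shows
    "(strong_type (power_measure (2 * l)) (power_measure \<delta>) p (heat_maximal l)
        \<longleftrightarrow> p > 1 \<and> - 1 < \<delta> \<and> \<delta> < (2 * l + 1) * p - 1) \<and>
     (weak_type (power_measure (2 * l)) (power_measure \<delta>) p (heat_maximal l)
        \<longleftrightarrow> (- 1 < \<delta> \<and> \<delta> < (2 * l + 1) * p - 1) \<or> \<delta> = 2 * l) \<and>
     (restricted_weak_type (power_measure \<delta>) p (heat_maximal l)
        \<longleftrightarrow> - 1 < \<delta> \<and> \<delta> \<le> (2 * l + 1) * p - 1) \<and>
     strong_type_infty (lebesgue_on {0<..}) (heat_maximal l)"
proof -
  have l: "l > -1/2" and p: "p \<ge> 1" and p0: "p > 0" using assms by auto
  let ?T = "heat_maximal l" and ?L = "power_measure (2 * l)" and ?M = "power_measure \<delta>"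
  have weak_range: "(-1 < \<delta> \<and> \<delta> < (2 * l + 1) * p - 1) \<or> p = 1 \<and> \<delta> = 2 * l" if W: "weak_type ?L ?M p ?T"
  proof -
    have r: "-1 < \<delta>" "\<delta> \<le> (2 * l + 1) * p - 1" using weak_type_range[OF l p0 W] by auto
    show ?thesis
    proof (cases "\<delta> = (2 * l + 1) * p - 1")
      case True
      hence e: "\<delta> + 1 = (2 * l + 1) * p" by simp
      have "p = 1" using weak_type_endpoint_fails[OF l _ e] p W by (cases "p = 1") auto
      thus ?thesis using True by simp
    next
      case False
      thus ?thesis using r by simp
    qed
  qed
  have a: "strong_type ?L ?M p ?T \<longleftrightarrow> p > 1 \<and> -1 < \<delta> \<and> \<delta> < (2 * l + 1) * p - 1"
  proof
    assume S: "strong_type ?L ?M p ?T"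
    have "p \<noteq> 1" using S strong_type_1_fails[OF l] by auto
    thus "p > 1 \<and> -1 < \<delta> \<and> \<delta> < (2 * l + 1) * p - 1"
      using weak_range[OF strong_type_imp_weak_type[OF p0 S]] p by auto
  qed (auto intro: heat_maximal_strong_type[OF l])
  have b: "weak_type ?L ?M p ?T \<longleftrightarrow> (-1 < \<delta> \<and> \<delta> < (2 * l + 1) * p - 1) \<or> \<delta> = 2 * l"
  proof
    assume "(-1 < \<delta> \<and> \<delta> < (2 * l + 1) * p - 1) \<or> \<delta> = 2 * l"
    moreover have "-1 < \<delta> \<and> \<delta> < (2 * l + 1) * p - 1" if "\<delta> = 2 * l" "p \<noteq> 1"
    proof -
      have "(2 * l + 1) * 1 < (2 * l + 1) * p" using l p that by (intro mult_strict_left_mono) auto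
      hence "2 * l < (2 * l + 1) * p - 1" by (simp only: mult_1_right less_diff_eq)
      thus ?thesis using l that by simp
    qed
    ultimately show "weak_type ?L ?M p ?T"
      using heat_maximal_weak_type[OF l p] heat_maximal_weak_type_1[OF l] by (cases "p = 1") auto
  qed (use weak_range in blast)
  have c: "restricted_weak_type ?M p ?T \<longleftrightarrow> -1 < \<delta> \<and> \<delta> \<le> (2 * l + 1) * p - 1"
    using restricted_weak_type_range[OF l p0] heat_maximal_restricted_weak_type[OF l p] by blast
  from a b c heat_maximal_strong_type_infty[OF l] show ?thesis by blast
qed

end
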